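(* Let $a > 0$ with $a \neq 1$, let $n \geq 2$ be an integer, and let $s > a/4$. Then there is a number $C$ such that for every radial function $f \in C_0^\infty(\mathbb{R}^n \setminus \{0\})$, $$\left( \int_{\mathbb{R}^n} \sup_{|t| < 1} \left| (S^a f)[x](t) \right|^2 \, dx \right)^{1/2} \leq C \, \| f \|_{H^s(\mathbb{R}^n)} .$$ Here $C$ is independent of $f$.
   Context: The Fourier transform of $f$ is $\widehat f(\xi) = \int_{\mathbb{R}^n} e^{-i x\cdot \xi} f(x)\,dx$. For $x \in \mathbb{R}^n$ and $t \in \mathbb{R}$, $$(S^a f)[x](t) = \frac{1}{(2\pi)^n} \int_{\mathbb{R}^n} e^{i(x\cdot\xi + t|\xi|^a)} \widehat f(\xi)\, d\xi .$$ The inhomogeneous Sobolev norm is $\|f\|_{H^s(\mathbb{R}^n)} = \left( \int_{\mathbb{R}^n} (1+|\xi|^2)^s |\widehat f(\xi)|^2 \, d\xi \right)^{1/2}$. $C_0^\infty(\mathbb{R}^n\setminus\{0\})$ denotes the smooth functions with compact support contained in $\mathbb{R}^n \setminus \{0\}$. A function $f$ is radial if $f(x)$ depends only on $|x|$. *)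

theory Defs
  imports "HOL-Analysis.Analysis"
begin

definition fourier :: "(real^'n \<Rightarrow> complex) \<Rightarrow> real^'n \<Rightarrow> complex" where
  "fourier f \<xi> = (LINT x|lborel. exp (- (\<i> * complex_of_real (x \<bullet> \<xi>))) * f x)"

definition S_op :: "real \<Rightarrow> (real^'n \<Rightarrow> complex) \<Rightarrow> real^'n \<Rightarrow> real \<Rightarrow> complex" where
  "S_op a f x t =
     complex_of_real (1 / (2 * pi) ^ CARD('n)) *
     (LINT \<xi>|lborel. exp (\<i> * complex_of_real (x \<bullet> \<xi> + t * norm \<xi> powr a)) * fourier f \<xi>)"

text \<open>Norms take values in \<^typ>\<open>ennreal\<close>, so a divergent integral counts as infinite
  rather than as the default value 0 of the Bochner integral.\<close>

definition ennreal_sqrt :: "ennreal \<Rightarrow> ennreal" where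
  "ennreal_sqrt y = (if y = top then top else ennreal (sqrt (enn2real y)))"

definition sobolev_norm :: "real \<Rightarrow> (real^'n \<Rightarrow> complex) \<Rightarrow> ennreal" where
  "sobolev_norm s f =
     ennreal_sqrt (\<integral>\<^sup>+ \<xi>. ennreal ((1 + (norm \<xi>)\<^sup>2) powr s * (cmod (fourier f \<xi>))\<^sup>2) \<partial>lborel)"

primrec times_cont_diff :: "nat \<Rightarrow> (real^'n \<Rightarrow> complex) \<Rightarrow> bool" where
  "times_cont_diff 0 f \<longleftrightarrow> continuous_on UNIV f"
| "times_cont_diff (Suc k) f \<longleftrightarrow>
     (\<forall>x. f differentiable (at x)) \<and>
     (\<forall>v. times_cont_diff k (\<lambda>x. frechet_derivative f (at x) v))"

definition smooth :: "(real^'n \<Rightarrow> complex) \<Rightarrow> bool" where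
  "smooth f \<longleftrightarrow> (\<forall>k. times_cont_diff k f)"

text \<open>Elements of \<open>C_0^\<infinity>(U)\<close> are represented by their extensions by zero to the whole space.\<close>

definition test_functions :: "(real^'n) set \<Rightarrow> (real^'n \<Rightarrow> complex) set" where
  "test_functions U =
     {f. smooth f \<and> compact (closure (support_on UNIV f)) \<and> closure (support_on UNIV f) \<subseteq> U}"

definition radial :: "(real^'n \<Rightarrow> complex) \<Rightarrow> bool" where
  "radial f \<longleftrightarrow> (\<exists>g :: real \<Rightarrow> complex. \<forall>x. f x = g (norm x))"

end

theory Submission
  imports Defs
begin

text \<open>
  Write \<open>k = (n - 1) / 2\<close>. The Fourier transform of a radial function is radial, and for a radial
  function \<open>F0 (norm \<xi>)\<close> the integral of \<open>cis (x \<bullet> \<xi>) F0 (norm \<xi>)\<close> is, up to a constant, the integral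
  over \<open>r > 0\<close> of \<open>r ^ (n - 1) J (r \<rho>) F0 r\<close>, where \<open>\<rho> = norm x\<close> and \<open>J\<close> is the Fourier transform of
  the sphere (\<open>fourier_polar\<close>). Put \<open>g r = r powr k * F0 r\<close> and \<open>V s = s powr k * J s\<close>. Then, up to a constant,
  \<open>\<rho> powr k\<close> times the solution at \<open>x\<close> is the integral of \<open>V (r \<rho>) cis (t * r powr a) g r\<close>. The factors
  \<open>\<rho> powr k\<close> and \<open>r powr k\<close> are the square roots of the two polar densities, so the theorem
  becomes an estimate from \<open>L\<^sup>2\<close> to \<open>L\<^sup>2\<close> on the half-line.

  The function \<open>V\<close> solves \<open>V'' + V = k (k - 1) V / s\<^sup>2\<close>, a perturbed harmonic oscillator. Hence
  \<open>V s = A cis s + B cis (- s)\<close> up to an error of size \<open>min 1 (1 / s)\<close>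
  (\<open>sphere_transform_asymptotics\<close>). The error is harmless: the kernel \<open>min 1 (1 / (r \<rho>))\<close> ignores \<open>t\<close>
  and is bounded on \<open>L\<^sup>2\<close> by Schur's test (\<open>hardy_kernel_bound\<close>). The two main terms reduce
  everything to the one-dimensional maximal function of the integral of
  \<open>cis (r \<rho> + t * r powr a) g r\<close> (\<open>maximal_oscillatory_bound\<close>).

  For the latter, choose for each \<open>\<rho>\<close> a time \<open>\<tau> \<rho>\<close> that nearly attains the supremum. By duality it
  suffices to bound the transposed operator \<open>h \<mapsto> H\<close>, where \<open>H r\<close> is the integral of
  \<open>cis (- (r \<rho> + \<tau> \<rho> * r powr a)) h \<rho>\<close>. Restricted to frequencies \<open>r\<close> in \<open>{N..2 * N}\<close>, the square of
  its norm is governed by the kernel \<open>\<integral> cutoff N r * cis (r z + t * r powr a) dr\<close>. Since \<open>a \<noteq> 1\<close>, the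
  phase is curved, and van der Corput's lemma bounds the kernel, uniformly over
  \<open>\<bar>t\<bar> \<le> 2\<close>, by a function of \<open>z\<close> whose integral is a multiple of \<open>N powr (a / 2)\<close>
  (\<open>unit_kernel_bounds\<close>, \<open>nn_integral_kernel_majorant\<close>). The powers \<open>N powr (a / 2 - 2 * s)\<close> form a
  convergent geometric series over dyadic \<open>N \<ge> 1\<close> exactly because \<open>s > a / 4\<close>. Frequencies below 1
  have time phases of size at most 1, and there a power series in \<open>t\<close> suffices (\<open>dual_transform_low\<close>).
\<close>

section \<open>Van der Corput estimates\<close>

lemma has_vector_derivative_cis_compose:
  assumes "(\<phi> has_real_derivative d) (at r)"
  shows "((\<lambda>r. cis (\<phi> r)) has_vector_derivative d *\<^sub>R (\<i> * cis (\<phi> r))) (at r)"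
proof -
  have 1: "((\<lambda>r. complex_of_real (\<phi> r)) has_vector_derivative of_real d) (at r)"
    using has_vector_derivative_of_real[OF assms] by simp
  have 2: "((\<lambda>w. exp (\<i> * w)) has_field_derivative \<i> * exp (\<i> * of_real (\<phi> r))) (at (of_real (\<phi> r)))"
    by (auto intro!: derivative_eq_intros)
  from field_vector_diff_chain_at[OF 1 2] show ?thesis
    by (simp add: o_def cis_conv_exp scaleR_conv_of_real mult_ac)
qed

lemma continuous_on_if_derivative:
  assumes "\<And>r. r \<in> S \<Longrightarrow> (\<phi> has_real_derivative d r) (at r)"
  shows "continuous_on S \<phi>"
  by (rule DERIV_continuous_on[OF has_field_derivative_at_within[OF assms]])

lemma continuous_on_cis_phase:
  assumes "\<And>r. r \<in> S \<Longrightarrow> (\<phi> has_real_derivative d r) (at r)"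
  shows "continuous_on S (\<lambda>r. cis (\<phi> r))"
  by (rule continuous_on_cis[OF continuous_on_if_derivative[OF assms]])

text \<open>Integrate by parts, writing \<open>cis \<phi>\<close> as the derivative of \<open>cis \<phi> / (\<i> \<phi>')\<close> up to an error. The error
has absolute value \<open>\<phi>'' / \<phi>'\<^sup>2\<close>, which is the derivative of \<open>- 1 / \<phi>'\<close> because \<open>\<phi>''\<close> has a sign; so
it integrates to a difference of boundary values, without any bound on \<open>\<phi>''\<close>.\<close>

lemma van_der_Corput_1_convex:
  fixes \<phi> \<phi>1 \<phi>2 :: "real \<Rightarrow> real"
  assumes ab: "\<alpha> \<le> \<beta>" and d: "\<delta> > 0"
    and D1: "\<And>r. r \<in> {\<alpha>..\<beta>} \<Longrightarrow> (\<phi> has_real_derivative \<phi>1 r) (at r)"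
    and D2: "\<And>r. r \<in> {\<alpha>..\<beta>} \<Longrightarrow> (\<phi>1 has_real_derivative \<phi>2 r) (at r)"
    and pos: "\<And>r. r \<in> {\<alpha>..\<beta>} \<Longrightarrow> 0 \<le> \<phi>2 r"
    and low: "(\<forall>r \<in> {\<alpha>..\<beta>}. \<phi>1 r \<ge> \<delta>) \<or> (\<forall>r \<in> {\<alpha>..\<beta>}. \<phi>1 r \<le> - \<delta>)"
  shows "cmod (integral {\<alpha>..\<beta>} (\<lambda>r. cis (\<phi> r))) \<le> 3 / \<delta>"
proof -
  have nz: "\<phi>1 r \<noteq> 0" if "r \<in> {\<alpha>..\<beta>}" for r
    using low d that by fastforce
  have ab1: "1 / \<bar>\<phi>1 r\<bar> \<le> 1 / \<delta>" if "r \<in> {\<alpha>..\<beta>}" for r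
    using low d that nz[OF that] by (intro divide_left_mono mult_pos_pos) fastforce+
  define G where "G r = cis (\<phi> r) * (- \<i> * of_real (1 / \<phi>1 r))" for r
  define E where "E r = cis (\<phi> r) * (\<i> * of_real (\<phi>2 r / (\<phi>1 r)\<^sup>2))" for r
  have G': "(G has_vector_derivative (cis (\<phi> r) + E r)) (at r within {\<alpha>..\<beta>})"
    if r: "r \<in> {\<alpha>..\<beta>}" for r
  proof -
    have 1: "((\<lambda>r. cis (\<phi> r)) has_vector_derivative (\<phi>1 r) *\<^sub>R (\<i> * cis (\<phi> r))) (at r)"
      by (rule has_vector_derivative_cis_compose[OF D1[OF r]])
    have 2: "((\<lambda>r. 1 / \<phi>1 r) has_real_derivative (- \<phi>2 r / (\<phi>1 r)\<^sup>2)) (at r)"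
      using D2[OF r] nz[OF r] by (auto intro!: derivative_eq_intros simp: power2_eq_square)
    have 3: "((\<lambda>r. complex_of_real (1 / \<phi>1 r)) has_vector_derivative of_real (- \<phi>2 r / (\<phi>1 r)\<^sup>2)) (at r)"
      using has_vector_derivative_of_real[OF 2] .
    have "(G has_vector_derivative (cis (\<phi> r) + E r)) (at r)"
      unfolding G_def
      by (rule derivative_eq_intros 1 3 refl)+
         (use nz[OF r] in \<open>simp add: E_def scaleR_conv_of_real field_simps power2_eq_square\<close>)
    then show ?thesis by (rule has_vector_derivative_at_within)
  qed
  have I1: "((\<lambda>r. cis (\<phi> r) + E r) has_integral (G \<beta> - G \<alpha>)) {\<alpha>..\<beta>}"
    by (rule fundamental_theorem_of_calculus[OF ab G'])
  have cc: "continuous_on {\<alpha>..\<beta>} (\<lambda>r. cis (\<phi> r))"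
    by (rule continuous_on_cis_phase[OF D1])
  have ci: "(\<lambda>r. cis (\<phi> r)) integrable_on {\<alpha>..\<beta>}"
    by (rule integrable_continuous_real[OF cc])
  have Ei: "E integrable_on {\<alpha>..\<beta>}"
    using integrable_diff[OF has_integral_integrable[OF I1] ci] by simp
  have I2: "((\<lambda>r. \<phi>2 r / (\<phi>1 r)\<^sup>2) has_integral (- (1 / \<phi>1 \<beta>) - (- (1 / \<phi>1 \<alpha>)))) {\<alpha>..\<beta>}"
  proof (rule fundamental_theorem_of_calculus[OF ab])
    fix r assume r: "r \<in> {\<alpha>..\<beta>}"
    have "((\<lambda>r. - (1 / \<phi>1 r)) has_real_derivative (\<phi>2 r / (\<phi>1 r)\<^sup>2)) (at r within {\<alpha>..\<beta>})"
      using has_field_derivative_at_within[OF D2[OF r]] nz[OF r]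
      by (auto intro!: derivative_eq_intros simp: power2_eq_square)
    then show "((\<lambda>r. - (1 / \<phi>1 r)) has_vector_derivative (\<phi>2 r / (\<phi>1 r)\<^sup>2)) (at r within {\<alpha>..\<beta>})"
      by (simp add: has_real_derivative_iff_has_vector_derivative)
  qed
  have Eb: "cmod (integral {\<alpha>..\<beta>} E) \<le> 1 / \<delta>"
  proof -
    have "cmod (integral {\<alpha>..\<beta>} E) \<le> integral {\<alpha>..\<beta>} (\<lambda>r. \<phi>2 r / (\<phi>1 r)\<^sup>2)"
      by (rule integral_norm_bound_integral[OF Ei])
         (use I2 pos in \<open>auto simp: E_def norm_mult norm_divide norm_power\<close>)
    also have "\<dots> = 1 / \<phi>1 \<alpha> - 1 / \<phi>1 \<beta>" using I2 by (simp add: integral_unique)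
    also have "\<dots> \<le> 1 / \<delta>"
      using low
    proof
      assume "\<forall>r\<in>{\<alpha>..\<beta>}. \<delta> \<le> \<phi>1 r"
      then have "0 < \<phi>1 \<alpha>" "0 < \<phi>1 \<beta>" "1 / \<phi>1 \<alpha> \<le> 1 / \<delta>" using ab d ab1[of \<alpha>] by force+
      then show ?thesis by (smt (verit) divide_pos_pos)
    next
      assume "\<forall>r\<in>{\<alpha>..\<beta>}. \<phi>1 r \<le> -\<delta>"
      then have "0 > \<phi>1 \<alpha>" "0 > \<phi>1 \<beta>" "- 1 / \<phi>1 \<beta> \<le> 1 / \<delta>" using ab d ab1[of \<beta>] by force+
      then show ?thesis by (smt (verit) divide_pos_neg minus_divide_left)
    qed
    finally show ?thesis .
  qed
  have "integral {\<alpha>..\<beta>} (\<lambda>r. cis (\<phi> r)) = (G \<beta> - G \<alpha>) - integral {\<alpha>..\<beta>} E"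
    using integral_add[OF ci Ei] I1 by (simp add: integral_unique algebra_simps)
  also have "cmod \<dots> \<le> cmod (G \<beta>) + cmod (G \<alpha>) + cmod (integral {\<alpha>..\<beta>} E)"
    by (rule order_trans[OF norm_triangle_ineq4 add_right_mono[OF norm_triangle_ineq4]])
  also have "\<dots> \<le> 1 / \<delta> + 1 / \<delta> + 1 / \<delta>"
    using ab1[of \<alpha>] ab1[of \<beta>] ab Eb by (intro add_mono) (auto simp: G_def norm_mult norm_divide)
  finally show ?thesis by simp
qed

text \<open>Since \<open>\<phi>'\<close> grows at rate at least \<open>\<kappa>\<close>, it is large outside a neighbourhood of one point \<open>m\<close>: the first
derivative test applies at distance \<open>\<eta>\<close> from \<open>m\<close>, with bound \<open>3 / (\<kappa> \<eta>)\<close> on each side, and the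
neighbourhood contributes at most its length. The choice \<open>\<eta> = 1 / sqrt \<kappa>\<close> balances the two.\<close>

lemma van_der_Corput_2_convex:
  fixes \<phi> \<phi>1 \<phi>2 :: "real \<Rightarrow> real"
  assumes ab: "\<alpha> \<le> \<beta>" and l: "\<kappa> > 0"
    and D1: "\<And>r. r \<in> {\<alpha>..\<beta>} \<Longrightarrow> (\<phi> has_real_derivative \<phi>1 r) (at r)"
    and D2: "\<And>r. r \<in> {\<alpha>..\<beta>} \<Longrightarrow> (\<phi>1 has_real_derivative \<phi>2 r) (at r)"
    and low: "\<And>r. r \<in> {\<alpha>..\<beta>} \<Longrightarrow> \<kappa> \<le> \<phi>2 r"
  shows "cmod (integral {\<alpha>..\<beta>} (\<lambda>r. cis (\<phi> r))) \<le> 8 / sqrt \<kappa>"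
proof -
  have inc: "\<kappa> * (y - x) \<le> \<phi>1 y - \<phi>1 x" if "\<alpha> \<le> x" "x \<le> y" "y \<le> \<beta>" for x y
  proof (cases "x = y")
    case False
    then have "x < y" using that by simp
    moreover have "(\<phi>1 has_real_derivative \<phi>2 u) (at u)" if "x \<le> u" "u \<le> y" for u
      using that \<open>\<alpha> \<le> x\<close> \<open>y \<le> \<beta>\<close> by (intro D2) auto
    ultimately obtain z where z: "z > x" "z < y" "\<phi>1 y - \<phi>1 x = (y - x) * \<phi>2 z"
      using MVT2[of x y \<phi>1 \<phi>2] by blast
    have "(y - x) * \<kappa> \<le> (y - x) * \<phi>2 z"
      using low[of z] z that by (intro mult_left_mono) auto
    then show ?thesis using z by (simp add: mult.commute)
  qed simp
  \<comment> \<open>The point of least slope: a zero of \<open>\<phi>1\<close>, or an endpoint if \<open>\<phi>1\<close> has no zero.\<close>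
  obtain m where m: "m \<in> {\<alpha>..\<beta>}" "\<And>r. r \<in> {m<..\<beta>} \<Longrightarrow> \<kappa> * (r - m) \<le> \<phi>1 r"
      "\<And>r. r \<in> {\<alpha>..<m} \<Longrightarrow> \<phi>1 r \<le> - (\<kappa> * (m - r))"
  proof -
    consider "\<phi>1 \<alpha> \<ge> 0" | "\<phi>1 \<beta> \<le> 0" | "\<phi>1 \<alpha> < 0" "\<phi>1 \<beta> > 0" by linarith
    then show ?thesis
    proof cases
      case 1
      show ?thesis
      proof (rule that[of \<alpha>])
        show "\<kappa> * (r - \<alpha>) \<le> \<phi>1 r" if "r \<in> {\<alpha><..\<beta>}" for r
          using that inc[of \<alpha> r] 1 ab by auto
        show "\<phi>1 r \<le> - (\<kappa> * (\<alpha> - r))" if "r \<in> {\<alpha>..<\<alpha>}" for r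
          using that inc[of r \<alpha>] 1 ab by auto
      qed (use 1 ab in auto)
    next
      case 2
      show ?thesis
      proof (rule that[of \<beta>])
        show "\<kappa> * (r - \<beta>) \<le> \<phi>1 r" if "r \<in> {\<beta><..\<beta>}" for r
          using that inc[of \<beta> r] 2 ab by auto
        show "\<phi>1 r \<le> - (\<kappa> * (\<beta> - r))" if "r \<in> {\<alpha>..<\<beta>}" for r
          using that inc[of r \<beta>] 2 ab by auto
      qed (use 2 ab in auto)
    next
      case 3
      have "continuous_on {\<alpha>..\<beta>} \<phi>1"
        by (rule continuous_on_if_derivative[OF D2])
      then obtain m where m: "\<alpha> \<le> m" "m \<le> \<beta>" "\<phi>1 m = 0"
        using IVT'[of \<phi>1 \<alpha> 0 \<beta>] 3 ab by auto
      show ?thesis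
      proof (rule that[of m])
        show "\<kappa> * (r - m) \<le> \<phi>1 r" if "r \<in> {m<..\<beta>}" for r
          using that inc[of m r] m by auto
        show "\<phi>1 r \<le> - (\<kappa> * (m - r))" if "r \<in> {\<alpha>..<m}" for r
          using that inc[of r m] m by auto
      qed (use m in auto)
    qed
  qed
  define \<eta> where "\<eta> = 1 / sqrt \<kappa>"
  have \<eta>: "\<eta> > 0" "\<kappa> * \<eta> = sqrt \<kappa>" using l by (simp_all add: \<eta>_def real_div_sqrt)
  define p where "p = max \<alpha> (m - \<eta>)"
  define q where "q = min \<beta> (m + \<eta>)"
  have pq: "\<alpha> \<le> p" "p \<le> m" "m \<le> q" "q \<le> \<beta>" "q - p \<le> 2 * \<eta>"
    using \<eta> m ab by (auto simp: p_def q_def)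
  let ?f = "\<lambda>r. cis (\<phi> r)"
  have cc: "continuous_on {\<alpha>..\<beta>} ?f"
    by (rule continuous_on_cis_phase[OF D1])
  have ci: "?f integrable_on {x..y}" if "\<alpha> \<le> x" "y \<le> \<beta>" for x y
    using that by (intro integrable_continuous_real continuous_on_subset[OF cc]) auto
  have L: "cmod (integral {\<alpha>..p} ?f) \<le> 3 / sqrt \<kappa>"
  proof (cases "\<alpha> < p")
    case True
    then have pe: "p = m - \<eta>" by (simp add: p_def max_def split: if_splits)
    have "\<phi>1 r \<le> - sqrt \<kappa>" if "r \<in> {\<alpha>..p}" for r
    proof -
      have "\<kappa> * \<eta> \<le> \<kappa> * (m - r)" using that pe l by (intro mult_left_mono) auto
      then show ?thesis using m(3)[of r] that pe \<eta> by auto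
    qed
    then show ?thesis using True l pq low
      by (intro van_der_Corput_1_convex[OF _ _ D1 D2]) (auto intro: order_trans[of 0 \<kappa>] less_imp_le)
  qed (use pq l in auto)
  have R: "cmod (integral {q..\<beta>} ?f) \<le> 3 / sqrt \<kappa>"
  proof (cases "q < \<beta>")
    case True
    then have pe: "q = m + \<eta>" by (simp add: q_def min_def split: if_splits)
    have "sqrt \<kappa> \<le> \<phi>1 r" if "r \<in> {q..\<beta>}" for r
    proof -
      have "\<kappa> * \<eta> \<le> \<kappa> * (r - m)" using that pe l by (intro mult_left_mono) auto
      then show ?thesis using m(2)[of r] that pe \<eta> by auto
    qed
    then show ?thesis using True l pq low
      by (intro van_der_Corput_1_convex[OF _ _ D1 D2]) (auto intro: order_trans[of 0 \<kappa>] less_imp_le)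
  qed (use pq l in auto)
  have M: "cmod (integral {p..q} ?f) \<le> 2 * \<eta>"
  proof -
    have "cmod (integral {p..q} ?f) \<le> 1 * (q - p)"
      by (rule integral_bound) (use pq in \<open>auto intro: continuous_on_subset[OF cc]\<close>)
    then show ?thesis using pq by simp
  qed
  have "integral {\<alpha>..\<beta>} ?f = integral {\<alpha>..p} ?f + integral {p..q} ?f + integral {q..\<beta>} ?f"
    using pq by (simp add: Henstock_Kurzweil_Integration.integral_combine ci)
  also have "cmod \<dots> \<le> 3 / sqrt \<kappa> + 2 * \<eta> + 3 / sqrt \<kappa>"
    by (intro norm_triangle_le add_mono L M R)
  finally show ?thesis by (simp add: \<eta>_def)
qed

lemma integral_cis_uminus: "cmod (integral S (\<lambda>r. cis (- \<phi> r))) = cmod (integral S (\<lambda>r. cis (\<phi> r)))"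
proof -
  have "integral S (\<lambda>r. cis (- \<phi> r)) = cnj (integral S (\<lambda>r. cis (\<phi> r)))"
    by (subst integral_cnj) (simp add: cis_cnj)
  then show ?thesis by simp
qed

lemma van_der_Corput_1:
  fixes \<phi> \<phi>1 \<phi>2 :: "real \<Rightarrow> real"
  assumes ab: "\<alpha> \<le> \<beta>" and d: "\<delta> > 0"
    and D1: "\<And>r. r \<in> {\<alpha>..\<beta>} \<Longrightarrow> (\<phi> has_real_derivative \<phi>1 r) (at r)"
    and D2: "\<And>r. r \<in> {\<alpha>..\<beta>} \<Longrightarrow> (\<phi>1 has_real_derivative \<phi>2 r) (at r)"
    and sgn: "(\<forall>r \<in> {\<alpha>..\<beta>}. \<phi>2 r \<ge> 0) \<or> (\<forall>r \<in> {\<alpha>..\<beta>}. \<phi>2 r \<le> 0)"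
    and low: "(\<forall>r \<in> {\<alpha>..\<beta>}. \<phi>1 r \<ge> \<delta>) \<or> (\<forall>r \<in> {\<alpha>..\<beta>}. \<phi>1 r \<le> - \<delta>)"
  shows "cmod (integral {\<alpha>..\<beta>} (\<lambda>r. cis (\<phi> r))) \<le> 3 / \<delta>"
  using sgn
proof
  assume "\<forall>r \<in> {\<alpha>..\<beta>}. \<phi>2 r \<ge> 0"
  then show ?thesis by (intro van_der_Corput_1_convex[OF ab d D1 D2 _ low]) auto
next
  assume "\<forall>r \<in> {\<alpha>..\<beta>}. \<phi>2 r \<le> 0"
  then have "cmod (integral {\<alpha>..\<beta>} (\<lambda>r. cis (- \<phi> r))) \<le> 3 / \<delta>"
    using low
    by (intro van_der_Corput_1_convex[OF ab d, where ?\<phi>1.0 = "\<lambda>r. - \<phi>1 r" and ?\<phi>2.0 = "\<lambda>r. - \<phi>2 r"])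
       (auto intro!: DERIV_minus D1 D2)
  then show ?thesis by (simp add: integral_cis_uminus)
qed

lemma van_der_Corput_2:
  fixes \<phi> \<phi>1 \<phi>2 :: "real \<Rightarrow> real"
  assumes ab: "\<alpha> \<le> \<beta>" and d: "\<kappa> > 0"
    and D1: "\<And>r. r \<in> {\<alpha>..\<beta>} \<Longrightarrow> (\<phi> has_real_derivative \<phi>1 r) (at r)"
    and D2: "\<And>r. r \<in> {\<alpha>..\<beta>} \<Longrightarrow> (\<phi>1 has_real_derivative \<phi>2 r) (at r)"
    and sgn: "(\<forall>r \<in> {\<alpha>..\<beta>}. \<phi>2 r \<ge> \<kappa>) \<or> (\<forall>r \<in> {\<alpha>..\<beta>}. \<phi>2 r \<le> - \<kappa>)"
  shows "cmod (integral {\<alpha>..\<beta>} (\<lambda>r. cis (\<phi> r))) \<le> 8 / sqrt \<kappa>"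
  using sgn
proof
  assume "\<forall>r \<in> {\<alpha>..\<beta>}. \<phi>2 r \<ge> \<kappa>"
  then show ?thesis by (intro van_der_Corput_2_convex[OF ab d D1 D2]) auto
next
  assume neg: "\<forall>r \<in> {\<alpha>..\<beta>}. \<phi>2 r \<le> -\<kappa>"
  have "\<kappa> \<le> - \<phi>2 r" if "r \<in> {\<alpha>..\<beta>}" for r using neg[rule_format, OF that] by linarith
  then have "cmod (integral {\<alpha>..\<beta>} (\<lambda>r. cis (- \<phi> r))) \<le> 8 / sqrt \<kappa>"
    by (intro van_der_Corput_2_convex[OF ab d, where ?\<phi>1.0 = "\<lambda>r. - \<phi>1 r" and ?\<phi>2.0 = "\<lambda>r. - \<phi>2 r"])
       (auto intro!: DERIV_minus D1 D2)
  then show ?thesis by (simp add: integral_cis_uminus)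
qed

text \<open>Abel summation: integration by parts moves the derivative onto the weight, and the weight vanishes at
the right endpoint while the primitive of \<open>f\<close> vanishes at the left one.\<close>

lemma weighted_integral_bound:
  fixes f :: "real \<Rightarrow> complex" and \<psi> \<psi>1 :: "real \<Rightarrow> real"
  assumes ab: "\<alpha> \<le> \<beta>" and f: "continuous_on {\<alpha>..\<beta>} f"
    and M: "\<And>x. x \<in> {\<alpha>..\<beta>} \<Longrightarrow> cmod (integral {\<alpha>..x} f) \<le> M"
    and D: "\<And>r. r \<in> {\<alpha>..\<beta>} \<Longrightarrow> (\<psi> has_real_derivative \<psi>1 r) (at r)"
    and c: "continuous_on {\<alpha>..\<beta>} \<psi>1"
    and B: "\<And>r. r \<in> {\<alpha>..\<beta>} \<Longrightarrow> \<bar>\<psi>1 r\<bar> \<le> B" and z: "\<psi> \<beta> = 0"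
  shows "cmod (integral {\<alpha>..\<beta>} (\<lambda>r. of_real (\<psi> r) * f r)) \<le> B * M * (\<beta> - \<alpha>)"
proof -
  define \<Omega> where "\<Omega> x = integral {\<alpha>..x} f" for x
  have O': "(\<Omega> has_vector_derivative f x) (at x within {\<alpha>..\<beta>})" if "x \<in> {\<alpha>..\<beta>}" for x
    unfolding \<Omega>_def using integral_has_vector_derivative[OF f that] .
  have Oc: "continuous_on {\<alpha>..\<beta>} \<Omega>"
    using O' by (rule continuous_on_vector_derivative)
  have pc: "continuous_on {\<alpha>..\<beta>} \<psi>"
    by (rule continuous_on_if_derivative[OF D])
  have "((\<lambda>r. of_real (\<psi> r) * f r + of_real (\<psi>1 r) * \<Omega> r) has_integral
      (of_real (\<psi> \<beta>) * \<Omega> \<beta> - of_real (\<psi> \<alpha>) * \<Omega> \<alpha>)) {\<alpha>..\<beta>}"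
  proof (rule fundamental_theorem_of_calculus[OF ab])
    fix x assume x: "x \<in> {\<alpha>..\<beta>}"
    have "((\<lambda>r. complex_of_real (\<psi> r)) has_vector_derivative of_real (\<psi>1 x)) (at x within {\<alpha>..\<beta>})"
      by (rule has_vector_derivative_of_real[OF has_field_derivative_at_within[OF D[OF x]]])
    from has_vector_derivative_mult[OF this O'[OF x]]
    show "((\<lambda>r. of_real (\<psi> r) * \<Omega> r) has_vector_derivative
        of_real (\<psi> x) * f x + of_real (\<psi>1 x) * \<Omega> x) (at x within {\<alpha>..\<beta>})" .
  qed
  then have I: "((\<lambda>r. of_real (\<psi> r) * f r + of_real (\<psi>1 r) * \<Omega> r) has_integral 0) {\<alpha>..\<beta>}"
    by (simp add: z \<Omega>_def)
  have i2: "(\<lambda>r. of_real (\<psi>1 r) * \<Omega> r) integrable_on {\<alpha>..\<beta>}"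
    by (intro integrable_continuous_real continuous_intros c Oc)
  have i1: "(\<lambda>r. of_real (\<psi> r) * f r) integrable_on {\<alpha>..\<beta>}"
    by (intro integrable_continuous_real continuous_intros f pc)
  have "integral {\<alpha>..\<beta>} (\<lambda>r. of_real (\<psi> r) * f r) = - integral {\<alpha>..\<beta>} (\<lambda>r. of_real (\<psi>1 r) * \<Omega> r)"
    using integral_add[OF i1 i2] I by (simp add: integral_unique eq_neg_iff_add_eq_0)
  also have "cmod \<dots> \<le> B * M * (\<beta> - \<alpha>)"
    unfolding norm_minus_cancel
  proof (rule integral_bound[OF ab])
    show "continuous_on {\<alpha>..\<beta>} (\<lambda>r. of_real (\<psi>1 r) * \<Omega> r)"
      by (intro continuous_intros c Oc)
    fix t assume t: "t \<in> {\<alpha>..\<beta>}"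
    show "cmod (of_real (\<psi>1 t) * \<Omega> t) \<le> B * M"
      unfolding norm_mult norm_of_real
      by (rule mult_mono) (use B[OF t] M[OF t] in \<open>auto simp: \<Omega>_def intro: order_trans[of 0 "\<bar>\<psi>1 t\<bar>"]\<close>)
  qed
  finally show ?thesis .
qed

section \<open>The kernel at unit frequency\<close>

text \<open>A weight that is at least 1 on \<open>{1..2}\<close> and vanishes at the ends of \<open>{1/2..3}\<close>. The vanishing is what
makes the kernel decay like \<open>1 / z\<^sup>2\<close>; a sharp cutoff would only give \<open>1 / \<bar>z\<bar>\<close>, which is not
integrable.\<close>

definition bump :: "real \<Rightarrow> real" where "bump r = (r - 1/2) * (3 - r)"

definition unit_kernel :: "real \<Rightarrow> real \<Rightarrow> real \<Rightarrow> complex" where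
  "unit_kernel a z t = integral {1/2..3} (\<lambda>r. of_real (bump r) * cis (r * z + t * r powr a))"

lemma powr_bounds_unit:
  fixes r b e :: real
  assumes "r \<in> {1/2..3}" "\<bar>b\<bar> \<le> e"
  shows "r powr b \<le> 3 powr e" "1 / 3 powr e \<le> r powr b"
proof -
  have r: "r > 0" using assms by simp
  have "ln r \<le> ln 3" "- ln 3 \<le> ln r"
    using assms r by (auto simp: ln_div[symmetric] simp flip: ln_inverse)
  then have "\<bar>ln r\<bar> \<le> ln 3" by simp
  then have "\<bar>b * ln r\<bar> \<le> e * ln 3"
    unfolding abs_mult using assms by (intro mult_mono) auto
  then show "r powr b \<le> 3 powr e" "1 / 3 powr e \<le> r powr b"
    using r by (auto simp: powr_def field_simps simp flip: exp_minus exp_add)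
qed

context
  fixes a L :: real
  assumes a: "a > 0" "a \<noteq> 1"
  defines "L \<equiv> 3 powr (a + 3)"
begin

lemma powr_bound_pos: "L > 0" by (simp add: L_def)

lemma powr_bound: "r \<in> {1/2..3} \<Longrightarrow> \<bar>b\<bar> \<le> a + 3 \<Longrightarrow> r powr b \<le> L"
  "r \<in> {1/2..3} \<Longrightarrow> \<bar>b\<bar> \<le> a + 3 \<Longrightarrow> 1 / L \<le> r powr b"
  using powr_bounds_unit unfolding L_def by blast+

lemma phase_derivs:
  fixes z t r :: real
  assumes "r \<in> {1/2..3}"
  shows "((\<lambda>r. r * z + t * r powr a) has_real_derivative z + t * a * r powr (a - 1)) (at r)"
    "((\<lambda>r. z + t * a * r powr (a - 1)) has_real_derivative t * a * (a - 1) * r powr (a - 2)) (at r)"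
    "((\<lambda>r. t * a * (a - 1) * r powr (a - 2)) has_real_derivative t * a * (a - 1) * (a - 2) * r powr (a - 3)) (at r)"
proof -
  have p: "((\<lambda>r. c * r powr b) has_real_derivative c * b * r powr b') (at r)" if "b' = b - 1" for b b' c
    using DERIV_cmult[OF has_real_derivative_powr[of r b], of c] assms that by (simp add: mult_ac)
  show "((\<lambda>r. r * z + t * r powr a) has_real_derivative z + t * a * r powr (a - 1)) (at r)"
    by (intro DERIV_add p) (auto intro!: derivative_eq_intros)
  show "((\<lambda>r. z + t * a * r powr (a - 1)) has_real_derivative t * a * (a - 1) * r powr (a - 2)) (at r)"
    using DERIV_add[OF DERIV_const p[of "a - 2" "a - 1" "t * a"]] by simp
  show "((\<lambda>r. t * a * (a - 1) * r powr (a - 2)) has_real_derivative t * a * (a - 1) * (a - 2) * r powr (a - 3)) (at r)"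
    by (rule p) simp
qed

lemma time_slope_small:
  assumes "r \<in> {1/2..3}" "a * \<bar>t\<bar> * L \<le> \<bar>z\<bar> / 2"
  shows "\<bar>t * a * r powr (a - 1)\<bar> \<le> \<bar>z\<bar> / 2"
proof -
  have "\<bar>t * a * r powr (a - 1)\<bar> = a * \<bar>t\<bar> * r powr (a - 1)"
    using a by (simp add: abs_mult)
  also have "\<dots> \<le> a * \<bar>t\<bar> * L"
    using a assms by (intro mult_left_mono powr_bound) auto
  finally show ?thesis using assms by simp
qed

text \<open>The slope of the phase is \<open>z + t * a * r powr (a - 1)\<close>. If \<open>\<bar>t\<bar>\<close> is small against \<open>\<bar>z\<bar>\<close>, the slope is
at least \<open>\<bar>z\<bar> / 2\<close> and the first derivative test applies. Otherwise the second derivative is at least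
a multiple of \<open>\<bar>z\<bar>\<close>; this is where \<open>a \<noteq> 1\<close> enters.\<close>

lemma unweighted_kernel_bound:
  assumes z: "z \<noteq> 0" and x: "x \<in> {1/2..3}"
  shows "cmod (integral {1/2..x} (\<lambda>r. cis (r * z + t * r powr a)))
      \<le> (6 + 8 * sqrt (2 * L\<^sup>2 / \<bar>a - 1\<bar>)) / sqrt \<bar>z\<bar>"
proof -
  let ?I = "cmod (integral {1/2..x} (\<lambda>r. cis (r * z + t * r powr a)))"
  have D1: "((\<lambda>r. r * z + t * r powr a) has_real_derivative z + t * a * r powr (a - 1)) (at r)"
   and D2: "((\<lambda>r. z + t * a * r powr (a - 1)) has_real_derivative t * a * (a - 1) * r powr (a - 2)) (at r)"
     if "r \<in> {1/2..x}" for r using that x phase_derivs[of r] by auto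
  have sgn: "(\<forall>r\<in>{1/2..x}. t * a * (a - 1) * r powr (a - 2) \<ge> 0) \<or> (\<forall>r\<in>{1/2..x}. t * a * (a - 1) * r powr (a - 2) \<le> 0)"
    by (cases "t * a * (a - 1) \<ge> 0") (auto intro: mult_nonneg_nonneg mult_nonpos_nonneg)
  have s0: "sqrt \<bar>z\<bar> > 0" using z by simp
  show ?thesis
  proof (cases "a * \<bar>t\<bar> * L \<le> \<bar>z\<bar> / 2")
    case True
    have sl: "\<bar>t * a * r powr (a - 1)\<bar> \<le> \<bar>z\<bar> / 2" if "r \<in> {1/2..x}" for r
      using time_slope_small[OF _ True, of r] that x by auto
    have "?I \<le> 3 / (\<bar>z\<bar> / 2)"
    proof (rule van_der_Corput_1[OF _ _ D1 D2 sgn])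
      show "(\<forall>r\<in>{1 / 2..x}. \<bar>z\<bar> / 2 \<le> z + t * a * r powr (a - 1)) \<or>
            (\<forall>r\<in>{1 / 2..x}. z + t * a * r powr (a - 1) \<le> - (\<bar>z\<bar> / 2))"
        using sl by (cases "z > 0") (fastforce simp: abs_le_iff)+
    qed (use x z in auto)
    moreover have "?I \<le> 1 * (x - 1/2)"
      by (rule integral_bound[OF _ continuous_on_cis_phase[OF D1]]) (use x in auto)
    ultimately have I: "?I \<le> 6 / \<bar>z\<bar>" "?I \<le> 6" using x by auto
    have "?I \<le> 6 / sqrt \<bar>z\<bar>"
    proof (cases "\<bar>z\<bar> \<ge> 1")
      case True
      then have "1 \<le> sqrt \<bar>z\<bar>" by simp
      then have "sqrt \<bar>z\<bar> * 1 \<le> sqrt \<bar>z\<bar> * sqrt \<bar>z\<bar>" by (intro mult_left_mono) auto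
      then have "sqrt \<bar>z\<bar> \<le> \<bar>z\<bar>" by simp
      then have "6 / \<bar>z\<bar> \<le> 6 / sqrt \<bar>z\<bar>" using s0 by (intro divide_left_mono) auto
      then show ?thesis using I by simp
    next
      case False
      then have "sqrt \<bar>z\<bar> \<le> 1" by simp
      then have "6 / 1 \<le> 6 / sqrt \<bar>z\<bar>" using s0 by (intro divide_left_mono) auto
      then show ?thesis using I by simp
    qed
    also have "\<dots> \<le> (6 + 8 * sqrt (2 * L\<^sup>2 / \<bar>a - 1\<bar>)) / sqrt \<bar>z\<bar>"
      using s0 by (intro divide_right_mono) auto
    finally show ?thesis .
  next
    case False
    define \<kappa> where "\<kappa> = \<bar>z\<bar> * \<bar>a - 1\<bar> / (2 * L\<^sup>2)"
    have k0: "\<kappa> > 0" using z a powr_bound_pos by (simp add: \<kappa>_def)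
    have kb: "\<kappa> \<le> \<bar>t * a * (a - 1) * r powr (a - 2)\<bar>" if "r \<in> {1/2..x}" for r
    proof -
      have "\<bar>z\<bar> / (2 * L) \<le> a * \<bar>t\<bar>" using False powr_bound_pos by (simp add: field_simps)
      then have "(\<bar>z\<bar> / (2 * L)) * \<bar>a - 1\<bar> * (1 / L) \<le> (a * \<bar>t\<bar>) * \<bar>a - 1\<bar> * r powr (a - 2)"
        using that x a powr_bound_pos by (intro mult_mono powr_bound) auto
      then show ?thesis using a by (simp add: \<kappa>_def abs_mult power2_eq_square mult_ac)
    qed
    have "?I \<le> 8 / sqrt \<kappa>"
    proof (rule van_der_Corput_2[OF _ k0 D1 D2])
      show "(\<forall>r\<in>{1/2..x}. \<kappa> \<le> t * a * (a - 1) * r powr (a - 2)) \<or>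
            (\<forall>r\<in>{1/2..x}. t * a * (a - 1) * r powr (a - 2) \<le> - \<kappa>)"
        using sgn kb by fastforce
    qed (use x in auto)
    also have "8 / sqrt \<kappa> = (8 * sqrt (2 * L\<^sup>2 / \<bar>a - 1\<bar>)) / sqrt \<bar>z\<bar>"
      using z a powr_bound_pos by (simp add: \<kappa>_def real_sqrt_divide real_sqrt_mult)
    also have "\<dots> \<le> (6 + 8 * sqrt (2 * L\<^sup>2 / \<bar>a - 1\<bar>)) / sqrt \<bar>z\<bar>"
      using s0 by (intro divide_right_mono) auto
    finally show ?thesis .
  qed
qed

lemma unit_kernel_bound_sqrt:
  "\<exists>C>0. \<forall>z t. z \<noteq> 0 \<longrightarrow> cmod (unit_kernel a z t) \<le> C / sqrt \<bar>z\<bar>"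
proof (intro exI conjI allI impI)
  define C where "C = 6 + 8 * sqrt (2 * L\<^sup>2 / \<bar>a - 1\<bar>)"
  have C0: "C > 0" by (simp add: C_def add_pos_nonneg)
  then show "5/2 * C * (3 - 1/2) > 0" by simp
  fix z t :: real assume z: "z \<noteq> 0"
  have "cmod (unit_kernel a z t) \<le> 5/2 * (C / sqrt \<bar>z\<bar>) * (3 - 1/2)"
    unfolding unit_kernel_def
  proof (rule weighted_integral_bound)
    show "(bump has_real_derivative (7/2 - 2 * r)) (at r)" for r
      unfolding bump_def by (auto intro!: derivative_eq_intros)
    show "continuous_on {1/2..3} (\<lambda>r. cis (r * z + t * r powr a))"
      by (rule continuous_on_cis_phase[OF phase_derivs(1)])
    show "cmod (integral {1 / 2..x} (\<lambda>r. cis (r * z + t * r powr a))) \<le> C / sqrt \<bar>z\<bar>"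
      if "x \<in> {1/2..3}" for x
      using unweighted_kernel_bound[OF z that] by (simp add: C_def)
    show "\<bar>7/2 - 2 * r\<bar> \<le> 5/2" if "r \<in> {1/2..3}" for r :: real
      using that unfolding abs_le_iff by auto
  qed (auto simp: bump_def intro!: continuous_intros)
  then show "cmod (unit_kernel a z t) \<le> 5/2 * C * (3 - 1/2) / sqrt \<bar>z\<bar>" by simp
qed

text \<open>When the slope is comparable to \<open>z\<close> throughout, two integrations by parts gain \<open>1 / z\<^sup>2\<close>. The second
one leaves boundary terms, which are already of the right size.\<close>

lemma unit_kernel_decay:
  "\<exists>C>0. \<forall>z t. z \<noteq> 0 \<longrightarrow> a * \<bar>t\<bar> * L \<le> \<bar>z\<bar> / 2 \<longrightarrow> cmod (unit_kernel a z t) \<le> C / z\<^sup>2"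
proof -
  define Q where "Q = 2 + 2 * \<bar>a - 1\<bar> + 2 * \<bar>a - 1\<bar> * \<bar>a - 2\<bar> + 4 * (a - 1)\<^sup>2"
  have Q: "Q > 0" unfolding Q_def by (intro add_pos_nonneg) auto
  have main: "cmod (unit_kernel a z t) \<le> 68 * Q\<^sup>2 / z\<^sup>2" if z: "z \<noteq> 0" and far: "a * \<bar>t\<bar> * L \<le> \<bar>z\<bar> / 2" for z t
  proof -
    define \<phi> where "\<phi> r = r * z + t * r powr a" for r
    define \<phi>1 where "\<phi>1 r = z + t * a * r powr (a - 1)" for r
    define \<phi>2 where "\<phi>2 r = t * a * (a - 1) * r powr (a - 2)" for r
    define \<phi>3 where "\<phi>3 r = t * a * (a - 1) * (a - 2) * r powr (a - 3)" for r
    let ?S = "{1/2..3::real}"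
    have D: "(\<phi> has_real_derivative \<phi>1 r) (at r)" "(\<phi>1 has_real_derivative \<phi>2 r) (at r)"
      "(\<phi>2 has_real_derivative \<phi>3 r) (at r)" if "r \<in> ?S" for r
      using phase_derivs[OF that] unfolding \<phi>_def \<phi>1_def \<phi>2_def \<phi>3_def by auto
    have low: "\<bar>\<phi>1 r\<bar> \<ge> \<bar>z\<bar> / 2" if "r \<in> ?S" for r
      using time_slope_small[OF that far] unfolding \<phi>1_def by linarith
    have nz: "\<phi>1 r \<noteq> 0" if "r \<in> ?S" for r using low[OF that] z by auto
    have atb: "a * \<bar>t\<bar> * r powr b \<le> \<bar>z\<bar> / 2" if "r \<in> ?S" "\<bar>b\<bar> \<le> a + 3" for r b
      using order_trans[OF mult_left_mono[OF powr_bound(1)[OF that]] far] a by simp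
    have up2: "\<bar>\<phi>2 r\<bar> \<le> \<bar>a - 1\<bar> * (\<bar>z\<bar> / 2)" if "r \<in> ?S" for r
      using mult_left_mono[OF atb[OF that, of "a - 2"], of "\<bar>a - 1\<bar>"] a by (simp add: \<phi>2_def abs_mult mult_ac)
    have up3: "\<bar>\<phi>3 r\<bar> \<le> \<bar>a - 1\<bar> * \<bar>a - 2\<bar> * (\<bar>z\<bar> / 2)" if "r \<in> ?S" for r
      using mult_left_mono[OF atb[OF that, of "a - 3"], of "\<bar>a - 1\<bar> * \<bar>a - 2\<bar>"] a
      by (simp add: \<phi>3_def abs_mult mult_ac)
    define p where "p r = 1 / \<phi>1 r" for r
    define p1 where "p1 r = - \<phi>2 r * (p r)^2" for r
    define p2 where "p2 r = - \<phi>3 r * (p r)^2 + 2 * (\<phi>2 r)^2 * (p r)^3" for r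
    have P: "(p has_real_derivative p1 r) (at r)" "(p1 has_real_derivative p2 r) (at r)" if "r \<in> ?S" for r
    proof -
      show *: "(p has_real_derivative p1 r) (at r)"
        unfolding p_def p1_def using D(2)[OF that] nz[OF that]
        by (auto intro!: derivative_eq_intros simp: power2_eq_square)
      show "(p1 has_real_derivative p2 r) (at r)"
        unfolding p1_def[abs_def] by (rule derivative_eq_intros D(3)[OF that] * refl)+
          (simp add: p1_def p2_def power2_eq_square power3_eq_cube algebra_simps)
    qed
    have pb0: "\<bar>p r\<bar> \<le> 2 / \<bar>z\<bar>" if "r \<in> ?S" for r
    proof -
      have "1 / \<bar>\<phi>1 r\<bar> \<le> 1 / (\<bar>z\<bar> / 2)" using low[OF that] z nz[OF that] by (intro divide_left_mono) auto
      then show ?thesis by (simp add: p_def)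
    qed
    have pb: "\<bar>p r\<bar> \<le> Q / \<bar>z\<bar>" "\<bar>p1 r\<bar> \<le> Q / \<bar>z\<bar>" "\<bar>p2 r\<bar> \<le> Q / \<bar>z\<bar>" if r: "r \<in> ?S" for r
    proof -
      have z0: "\<bar>z\<bar> > 0" using z by simp
      show "\<bar>p r\<bar> \<le> Q / \<bar>z\<bar>"
        by (rule order_trans[OF pb0[OF r] divide_right_mono]) (auto simp: Q_def)
      have sq: "\<bar>p r\<bar>^2 \<le> (2 / \<bar>z\<bar>)^2" using pb0[OF r] by (intro power_mono) auto
      have cu: "\<bar>p r\<bar>^3 \<le> (2 / \<bar>z\<bar>)^3" using pb0[OF r] by (intro power_mono) auto
      have "\<bar>p1 r\<bar> = \<bar>\<phi>2 r\<bar> * \<bar>p r\<bar>^2" by (simp add: p1_def abs_mult)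
      also have "\<dots> \<le> (\<bar>a - 1\<bar> * (\<bar>z\<bar> / 2)) * (2 / \<bar>z\<bar>)^2"
        by (intro mult_mono up2[OF r] sq) auto
      also have "\<dots> = 2 * \<bar>a - 1\<bar> / \<bar>z\<bar>" using z0 by (simp add: field_simps power2_eq_square)
      also have "\<dots> \<le> Q / \<bar>z\<bar>" by (intro divide_right_mono) (auto simp: Q_def)
      finally show "\<bar>p1 r\<bar> \<le> Q / \<bar>z\<bar>" .
      have "\<bar>p2 r\<bar> \<le> \<bar>\<phi>3 r\<bar> * \<bar>p r\<bar>^2 + 2 * \<bar>\<phi>2 r\<bar>^2 * \<bar>p r\<bar>^3"
        unfolding p2_def by (rule order_trans[OF abs_triangle_ineq]) (simp add: abs_mult power_abs)
      also have "\<dots> \<le> (\<bar>a - 1\<bar> * \<bar>a - 2\<bar> * (\<bar>z\<bar> / 2)) * (2 / \<bar>z\<bar>)^2 + 2 * (\<bar>a - 1\<bar> * (\<bar>z\<bar> / 2))^2 * (2 / \<bar>z\<bar>)^3"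
        by (intro add_mono mult_mono up3[OF r] power_mono up2[OF r] sq cu pb0[OF r]) auto
      also have "\<dots> = (2 * \<bar>a - 1\<bar> * \<bar>a - 2\<bar> + 4 * (a - 1)^2) / \<bar>z\<bar>"
      proof -
        have "e * f * (y / 2) * (2 / y)^2 + 2 * (e * (y / 2))^2 * (2 / y)^3 = (2 * e * f + 4 * e^2) / y"
          if "y > 0" for e f y :: real
          using that by (simp add: field_simps power2_eq_square power3_eq_cube)
        from this[OF z0, of "\<bar>a - 1\<bar>" "\<bar>a - 2\<bar>"] show ?thesis by (simp only: power2_abs)
      qed
      also have "\<dots> \<le> Q / \<bar>z\<bar>" by (intro divide_right_mono) (auto simp: Q_def)
      finally show "\<bar>p2 r\<bar> \<le> Q / \<bar>z\<bar>" .
    qed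
    define w where "w r = 7/2 - 2 * r" for r :: real
    have B: "(bump has_real_derivative w r) (at r)" "(w has_real_derivative -2) (at r)" for r
      unfolding bump_def w_def by (auto intro!: derivative_eq_intros)
    have Bb: "\<bar>bump r\<bar> \<le> 4" "\<bar>w r\<bar> \<le> 4" if "r \<in> ?S" for r
    proof -
      have 1: "0 \<le> bump r" unfolding bump_def using that by (intro mult_nonneg_nonneg) auto
      have "bump r = 25/16 - (r - 7/4)^2"
        by (simp add: bump_def power2_eq_square field_simps)
      then have "bump r \<le> 25/16" using zero_le_power2[of "r - 7/4"] by linarith
      with 1 show "\<bar>bump r\<bar> \<le> 4" by linarith
      show "\<bar>w r\<bar> \<le> 4" using that by (auto simp: w_def abs_le_iff)
    qed
    define q where "q r = bump r * p r" for r
    define u where "u r = (w r * p r + bump r * p1 r) * p r" for r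
    define u1 where "u1 r = (- 2 * p r + 2 * w r * p1 r + bump r * p2 r) * p r + (w r * p r + bump r * p1 r) * p1 r" for r
    have q': "(q has_real_derivative (w r * p r + bump r * p1 r)) (at r)" if "r \<in> ?S" for r
      unfolding q_def by (rule derivative_eq_intros B P[OF that] refl)+ simp
    have u': "(u has_real_derivative u1 r) (at r)" if "r \<in> ?S" for r
      unfolding u_def by (rule derivative_eq_intros B P[OF that] refl)+ (simp add: u1_def algebra_simps)
    \<comment> \<open>The antiderivative after both integrations by parts: with \<open>p = 1 / \<phi>'\<close> and \<open>q = bump * p\<close>,
      \<open>F = cis \<phi> * (q' p - \<i> q)\<close> has derivative \<open>cis \<phi> * (bump + (q' p)')\<close>.\<close>
    define F where "F r = cis (\<phi> r) * Complex (u r) (- q r)" for r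
    have F': "(F has_vector_derivative of_real (bump r) * cis (\<phi> r) + of_real (u1 r) * cis (\<phi> r)) (at r within ?S)"
      if r: "r \<in> ?S" for r
    proof -
      have 1: "((\<lambda>r. cis (\<phi> r)) has_vector_derivative (\<phi>1 r) *\<^sub>R (\<i> * cis (\<phi> r))) (at r)"
        by (rule has_vector_derivative_cis_compose[OF D(1)[OF r]])
      have 2: "((\<lambda>r. of_real (u r) - \<i> * of_real (q r)) has_vector_derivative
          (of_real (u1 r) - \<i> * of_real (w r * p r + bump r * p1 r))) (at r)"
        by (intro derivative_intros has_vector_derivative_of_real has_vector_derivative_mult_right u' q' r)
      have eq: "F = (\<lambda>r. cis (\<phi> r) * (of_real (u r) - \<i> * of_real (q r)))"
        by (auto simp: F_def complex_eq_iff)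
      have pp: "\<phi>1 r * p r = 1" using nz[OF r] by (simp add: p_def)
      have e1: "\<phi>1 r * u r = w r * p r + bump r * p1 r" "\<phi>1 r * q r = bump r"
      proof -
        have "\<phi>1 r * (X * p r) = X" for X using pp by (simp add: mult.left_commute)
        then show "\<phi>1 r * u r = w r * p r + bump r * p1 r" "\<phi>1 r * q r = bump r"
          unfolding u_def q_def by blast+
      qed
      have "(F has_vector_derivative of_real (bump r) * cis (\<phi> r) + of_real (u1 r) * cis (\<phi> r)) (at r)"
        unfolding eq
      proof (rule has_vector_derivative_eq_rhs[OF has_vector_derivative_mult[OF 1 2]])
        let ?W = "of_real (u r) - \<i> * of_real (q r)"
        let ?X = "of_real (w r * p r + bump r * p1 r)"
        have "of_real (\<phi>1 r) * of_real (u r) = (?X :: complex)"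
          "of_real (\<phi>1 r) * of_real (q r) = (of_real (bump r) :: complex)"
          by (simp_all only: e1 flip: of_real_mult)
        then have W: "of_real (\<phi>1 r) * ?W = ?X - \<i> * of_real (bump r)"
          by (simp only: right_diff_distrib mult.left_commute[of _ \<i>])
        have "cis (\<phi> r) * (of_real (u1 r) - \<i> * ?X) + \<phi>1 r *\<^sub>R (\<i> * cis (\<phi> r)) * ?W =
          cis (\<phi> r) * (of_real (u1 r) - \<i> * ?X) + \<i> * cis (\<phi> r) * (of_real (\<phi>1 r) * ?W)"
          by (simp only: scaleR_conv_of_real mult_ac)
        also have "\<dots> = of_real (bump r) * cis (\<phi> r) + of_real (u1 r) * cis (\<phi> r)"
          unfolding W by (simp add: algebra_simps del: of_real_add of_real_mult)
        finally show "cis (\<phi> r) * (of_real (u1 r) - \<i> * ?X) + \<phi>1 r *\<^sub>R (\<i> * cis (\<phi> r)) * ?W =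
            of_real (bump r) * cis (\<phi> r) + of_real (u1 r) * cis (\<phi> r)" .
      qed
      then show ?thesis by (rule has_vector_derivative_at_within)
    qed
    have I: "((\<lambda>r. of_real (bump r) * cis (\<phi> r) + of_real (u1 r) * cis (\<phi> r)) has_integral (F 3 - F (1/2))) ?S"
      by (rule fundamental_theorem_of_calculus[OF _ F']) auto
    have c: "continuous_on ?S (\<lambda>r. of_real (bump r) * cis (\<phi> r))"
    proof -
      have "continuous_on ?S \<phi>"
        by (rule continuous_on_if_derivative[OF D(1)])
      then show ?thesis unfolding bump_def by (intro continuous_intros)
    qed
    have i1: "(\<lambda>r. of_real (bump r) * cis (\<phi> r)) integrable_on ?S"
      by (rule integrable_continuous_real[OF c])
    have i2: "(\<lambda>r. of_real (u1 r) * cis (\<phi> r)) integrable_on ?S"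
      using integrable_diff[OF has_integral_integrable[OF I] i1] by simp
    have u1b: "\<bar>u1 r\<bar> \<le> 24 * Q\<^sup>2 / z\<^sup>2" if r: "r \<in> ?S" for r
    proof -
      let ?q = "Q / \<bar>z\<bar>"
      have q0: "?q \<ge> 0" using Q by simp
      have m: "\<bar>x * y\<bar> \<le> X * Y" if "\<bar>x\<bar> \<le> X" "\<bar>y\<bar> \<le> Y" for x y X Y :: real
        unfolding abs_mult using that by (intro mult_mono) auto
      have 1: "\<bar>w r * p r + bump r * p1 r\<bar> \<le> 4 * ?q + 4 * ?q"
        by (rule order_trans[OF abs_triangle_ineq
              add_mono[OF m[OF Bb(2)[OF r] pb(1)[OF r]] m[OF Bb(1)[OF r] pb(2)[OF r]]]])
      have lin: "\<bar>- 2 * x + 2 * y + v\<bar> \<le> 16 * k" if "\<bar>x\<bar> \<le> k" "\<bar>y\<bar> \<le> 4 * k" "\<bar>v\<bar> \<le> 4 * k" for x y v k :: real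
        using that by linarith
      have 2: "\<bar>- 2 * p r + 2 * (w r * p1 r) + bump r * p2 r\<bar> \<le> 16 * ?q"
        by (intro lin m pb[OF r] Bb[OF r])
      have "\<bar>u1 r\<bar> \<le> (16 * ?q) * ?q + (4 * ?q + 4 * ?q) * ?q"
        unfolding u1_def mult.assoc[of 2 "w r"]
        by (rule order_trans[OF abs_triangle_ineq add_mono[OF m[OF 2 pb(1)[OF r]] m[OF 1 pb(2)[OF r]]]])
      also have "\<dots> = 24 * Q\<^sup>2 / z\<^sup>2" by (simp add: power2_eq_square)
      finally show ?thesis .
    qed
    have Fb: "cmod (F r) \<le> 4 * Q\<^sup>2 / z\<^sup>2" if "r = 1/2 \<or> r = 3" for r
    proof -
      have r: "r \<in> ?S" and b: "bump r = 0" using that by (auto simp: bump_def)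
      have "F r = cis (\<phi> r) * of_real (u r)" by (simp add: F_def q_def b complex_of_real_def)
      then have "cmod (F r) = \<bar>w r\<bar> * (\<bar>p r\<bar> * \<bar>p r\<bar>)"
        by (simp only: norm_mult norm_of_real norm_cis u_def b abs_mult) (simp add: abs_mult)
      also have "\<dots> \<le> 4 * ((Q / \<bar>z\<bar>) * (Q / \<bar>z\<bar>))"
      proof (rule mult_mono[OF Bb(2)[OF r]])
        show "\<bar>p r\<bar> * \<bar>p r\<bar> \<le> (Q / \<bar>z\<bar>) * (Q / \<bar>z\<bar>)"
          by (rule mult_mono[OF pb(1)[OF r] pb(1)[OF r]]) (use Q in simp_all)
      qed simp_all
      also have "\<dots> = 4 * Q\<^sup>2 / z\<^sup>2" by (simp add: power2_eq_square)
      finally show ?thesis .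
    qed
    have "unit_kernel a z t = F 3 - F (1/2) - integral ?S (\<lambda>r. of_real (u1 r) * cis (\<phi> r))"
      using integral_add[OF i1 i2] I by (simp add: integral_unique unit_kernel_def \<phi>_def algebra_simps)
    also have "cmod \<dots> \<le> cmod (F 3) + cmod (F (1/2)) + cmod (integral ?S (\<lambda>r. of_real (u1 r) * cis (\<phi> r)))"
      by (rule order_trans[OF norm_triangle_ineq4 add_right_mono[OF norm_triangle_ineq4]])
    also have "cmod (integral ?S (\<lambda>r. of_real (u1 r) * cis (\<phi> r))) \<le> integral ?S (\<lambda>r. 24 * Q\<^sup>2 / z\<^sup>2)"
      by (rule integral_norm_bound_integral[OF i2]) (use u1b in \<open>auto simp: norm_mult\<close>)
    also have "cmod (F 3) + cmod (F (1/2)) + integral ?S (\<lambda>r. 24 * Q\<^sup>2 / z\<^sup>2) \<le>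
        4 * Q\<^sup>2 / z\<^sup>2 + 4 * Q\<^sup>2 / z\<^sup>2 + 60 * Q\<^sup>2 / z\<^sup>2"
      by (intro add_mono Fb) auto
    finally show ?thesis by (simp add: add_divide_distrib[symmetric])
  qed
  have "68 * Q\<^sup>2 > 0" using Q by simp
  with main show ?thesis by blast
qed

end

text \<open>For \<open>\<bar>z\<bar>\<close> at most a multiple of \<open>T\<close> the second bound follows from the first, because there
\<open>\<bar>z\<bar> powr (3/2)\<close> is at most a multiple of \<open>T powr (3/2)\<close>.\<close>

theorem unit_kernel_bounds:
  fixes a :: real
  assumes a: "a > 0" "a \<noteq> 1"
  shows "\<exists>C>0. \<forall>T\<ge>1. \<forall>z t. z \<noteq> 0 \<longrightarrow> \<bar>t\<bar> \<le> T \<longrightarrow>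
     cmod (unit_kernel a z t) \<le> C * \<bar>z\<bar> powr (-1/2) \<and>
     cmod (unit_kernel a z t) \<le> C * T powr (3/2) * \<bar>z\<bar> powr (-2)"
proof -
  define L :: real where "L = 3 powr (a + 3)"
  have L: "L > 0" by (simp add: L_def)
  obtain C1 where C1: "C1 > 0" "\<And>z t. z \<noteq> 0 \<Longrightarrow> cmod (unit_kernel a z t) \<le> C1 / sqrt \<bar>z\<bar>"
    using unit_kernel_bound_sqrt[OF a] by blast
  obtain C2 where C2: "C2 > 0" "\<And>z t. z \<noteq> 0 \<Longrightarrow> a * \<bar>t\<bar> * L \<le> \<bar>z\<bar> / 2 \<Longrightarrow> cmod (unit_kernel a z t) \<le> C2 / z\<^sup>2"
    using unit_kernel_decay[OF a] unfolding L_def by blast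
  define D where "D = (2 * a * L) powr (3/2)"
  define C where "C = C1 + C2 + C1 * D"
  have D: "D > 0" using a L by (simp add: D_def)
  have C: "C > 0" using C1 C2 D by (simp add: C_def add_pos_pos)
  have "cmod (unit_kernel a z t) \<le> C * \<bar>z\<bar> powr (-1/2) \<and>
     cmod (unit_kernel a z t) \<le> C * T powr (3/2) * \<bar>z\<bar> powr (-2)"
    if T: "T \<ge> 1" and z: "z \<noteq> 0" and t: "\<bar>t\<bar> \<le> T" for T z t :: real
  proof
    have s: "C1 / sqrt \<bar>z\<bar> = C1 * \<bar>z\<bar> powr (-1/2)"
      by (simp add: powr_minus_divide powr_half_sqrt)
    have B1: "cmod (unit_kernel a z t) \<le> C1 * \<bar>z\<bar> powr (-1/2)"
      using C1(2)[OF z, of t] by (simp only: s)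
    also have "\<dots> \<le> C * \<bar>z\<bar> powr (-1/2)"
      using C1 C2 D by (intro mult_right_mono) (auto simp: C_def)
    finally show "cmod (unit_kernel a z t) \<le> C * \<bar>z\<bar> powr (-1/2)" .
    have T1: "T powr (3/2) \<ge> 1" using T by (simp add: ge_one_powr_ge_zero)
    show "cmod (unit_kernel a z t) \<le> C * T powr (3/2) * \<bar>z\<bar> powr (-2)"
    proof (cases "a * \<bar>t\<bar> * L \<le> \<bar>z\<bar> / 2")
      case True
      have "cmod (unit_kernel a z t) \<le> C2 / z\<^sup>2" by (rule C2(2)[OF z True])
      also have "\<dots> = C2 * 1 * \<bar>z\<bar> powr (-2)" using z by (simp add: powr_minus_divide)
      also have "\<dots> \<le> C * T powr (3/2) * \<bar>z\<bar> powr (-2)"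
        using C1 C2 D T1 by (intro mult_right_mono mult_mono) (auto simp: C_def)
      finally show ?thesis .
    next
      case False
      have "a * \<bar>t\<bar> * L \<le> a * T * L" using t a L by (intro mult_right_mono mult_left_mono) auto
      then have zT: "\<bar>z\<bar> \<le> 2 * a * L * T" using False by (simp add: mult_ac)
      have "\<bar>z\<bar> powr (-1/2) = \<bar>z\<bar> powr (3/2) * \<bar>z\<bar> powr (-2)" by (simp flip: powr_add)
      also have "\<dots> \<le> (2 * a * L * T) powr (3/2) * \<bar>z\<bar> powr (-2)"
        using zT by (intro mult_right_mono powr_mono2) auto
      also have "(2 * a * L * T) powr (3/2) = D * T powr (3/2)"
        using a L T by (simp add: D_def powr_mult)
      finally have "C1 * \<bar>z\<bar> powr (-1/2) \<le> C1 * (D * T powr (3/2) * \<bar>z\<bar> powr (-2))"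
        using C1 by (intro mult_left_mono) auto
      also have "\<dots> = (C1 * D) * T powr (3/2) * \<bar>z\<bar> powr (-2)" by simp
      also have "\<dots> \<le> C * T powr (3/2) * \<bar>z\<bar> powr (-2)"
        using C1 C2 D by (intro mult_right_mono) (auto simp: C_def)
      finally show ?thesis using B1 by linarith
    qed
  qed
  then show ?thesis using C by blast
qed

section \<open>The dual operator on a dyadic frequency interval\<close>

abbreviation sq_mass :: "(real \<Rightarrow> complex) \<Rightarrow> ennreal" where
  "sq_mass h \<equiv> \<integral>\<^sup>+ \<rho>. ennreal ((cmod (h \<rho>))\<^sup>2) \<partial>lborel"

abbreviation sobolev_mass :: "real \<Rightarrow> (real \<Rightarrow> complex) \<Rightarrow> ennreal" where
  "sobolev_mass s g \<equiv> \<integral>\<^sup>+ r. ennreal ((1 + r\<^sup>2) powr s * (cmod (g r))\<^sup>2) \<partial>lborel"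

lemma borel_measurable_cis [measurable]: "cis \<in> borel_measurable borel"
  by (intro borel_measurable_continuous_onI continuous_intros)

lemma borel_measurable_cnj [measurable]: "cnj \<in> borel_measurable borel"
  by (intro borel_measurable_continuous_onI continuous_intros)

lemma nn_integral_powr_near_0:
  fixes c e :: real
  assumes "e > -1" "c \<ge> 0"
  shows "(\<integral>\<^sup>+ y. ennreal (y powr e) * indicator {0..c} y \<partial>lborel) = ennreal (c powr (e + 1) / (e + 1))"
  by (rule nn_integral_has_integral_lebesgue'[OF _ has_integral_powr_from_0]) (use assms in auto)

lemma nn_integral_powr_near_top:
  fixes c e :: real
  assumes "e < -1" "c > 0"
  shows "(\<integral>\<^sup>+ y. ennreal (y powr e) * indicator {c..} y \<partial>lborel) = ennreal (- (c powr (e + 1)) / (e + 1))"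
  by (rule nn_integral_has_integral_lebesgue'[OF _ has_integral_powr_to_inf]) (use assms in auto)

lemma norm_integral_le_nn_integral:
  fixes f :: "'a \<Rightarrow> 'b :: {banach, second_countable_topology}"
  shows "ennreal (norm (integral\<^sup>L M f)) \<le> (\<integral>\<^sup>+ x. ennreal (norm (f x)) \<partial>M)"
  by (cases "integrable M f") (auto intro: integral_norm_bound_ennreal simp: not_integrable_integral_eq)

lemma integrable_pair_lborel_bounded:
  fixes f :: "real \<Rightarrow> real \<Rightarrow> complex" and A B :: "real \<Rightarrow> real"
  assumes [measurable]: "case_prod f \<in> borel_measurable (lborel \<Otimes>\<^sub>M lborel)"
    and A: "integrable lborel A" and B: "integrable lborel B"
    and le: "\<And>x y. cmod (f x y) \<le> A x * B y"
  shows "integrable (lborel \<Otimes>\<^sub>M lborel) (case_prod f)"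
proof -
  note [measurable] = borel_measurable_integrable[OF A] borel_measurable_integrable[OF B]
  have fin: "(\<integral>\<^sup>+ x. ennreal \<bar>A x\<bar> \<partial>lborel) < \<infinity>" "(\<integral>\<^sup>+ x. ennreal \<bar>B x\<bar> \<partial>lborel) < \<infinity>"
    using A B by (auto simp: integrable_iff_bounded)
  have le': "cmod (f x y) \<le> \<bar>A x\<bar> * \<bar>B y\<bar>" for x y
    using le[of x y] by (simp flip: abs_mult)
  show ?thesis
  proof (rule integrableI_bounded)
    have "(\<integral>\<^sup>+ z. ennreal (cmod (case_prod f z)) \<partial>(lborel \<Otimes>\<^sub>M lborel))
        = (\<integral>\<^sup>+ x. \<integral>\<^sup>+ y. ennreal (cmod (f x y)) \<partial>lborel \<partial>lborel)"
      by (subst lborel.nn_integral_fst[symmetric]) auto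
    also have "\<dots> \<le> (\<integral>\<^sup>+ x. \<integral>\<^sup>+ y. ennreal \<bar>A x\<bar> * ennreal \<bar>B y\<bar> \<partial>lborel \<partial>lborel)"
      using le' by (intro nn_integral_mono) (simp flip: ennreal_mult)
    also have "\<dots> = (\<integral>\<^sup>+ x. ennreal \<bar>A x\<bar> \<partial>lborel) * (\<integral>\<^sup>+ x. ennreal \<bar>B x\<bar> \<partial>lborel)"
      by (simp add: nn_integral_cmult nn_integral_multc)
    also have "\<dots> < \<infinity>" using fin by (simp add: ennreal_mult_less_top)
    finally show "(\<integral>\<^sup>+ z. ennreal (norm (case_prod f z)) \<partial>(lborel \<Otimes>\<^sub>M lborel)) < \<infinity>" .
  qed simp
qed

lemma Fubini_lborel_bounded:
  fixes f :: "real \<Rightarrow> real \<Rightarrow> complex" and A B :: "real \<Rightarrow> real"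
  assumes "case_prod f \<in> borel_measurable (lborel \<Otimes>\<^sub>M lborel)"
    and "integrable lborel A" and "integrable lborel B"
    and "\<And>x y. cmod (f x y) \<le> A x * B y"
  shows "(LINT x|lborel. LINT y|lborel. f x y) = (LINT y|lborel. LINT x|lborel. f x y)"
  using lborel_pair.Fubini_integral[OF integrable_pair_lborel_bounded[OF assms]] by simp

text \<open>By \<open>u x * u y \<le> (u x)\<^sup>2 + (u y)\<^sup>2\<close> and the translation and reflection invariance of Lebesgue measure.\<close>

lemma schur_convolution:
  fixes u :: "real \<Rightarrow> real" and \<Phi> :: "real \<Rightarrow> ennreal"
  assumes [measurable]: "u \<in> borel_measurable borel" "\<Phi> \<in> borel_measurable borel"
    and u: "\<And>x. 0 \<le> u x"
  shows "(\<integral>\<^sup>+ x. \<integral>\<^sup>+ y. ennreal (u x) * ennreal (u y) * \<Phi> (y - x) \<partial>lborel \<partial>lborel)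
     \<le> 2 * (\<integral>\<^sup>+ z. \<Phi> z \<partial>lborel) * (\<integral>\<^sup>+ x. ennreal ((u x)\<^sup>2) \<partial>lborel)"
proof -
  have pt: "ennreal (u x) * ennreal (u y) * k \<le> ennreal ((u x)\<^sup>2) * k + ennreal ((u y)\<^sup>2) * k" for x y k
  proof -
    have "u x * u y \<le> (u x)\<^sup>2 + (u y)\<^sup>2"
    proof -
      have "0 \<le> (u x - u y)\<^sup>2" "0 \<le> u x * u y" using u[of x] u[of y] by auto
      then show ?thesis by (simp add: power2_eq_square algebra_simps)
    qed
    then have "ennreal (u x) * ennreal (u y) \<le> ennreal ((u x)\<^sup>2) + ennreal ((u y)\<^sup>2)"
      using u[of x] u[of y] by (simp flip: ennreal_mult ennreal_plus)
    then have "ennreal (u x) * ennreal (u y) * k \<le> (ennreal ((u x)\<^sup>2) + ennreal ((u y)\<^sup>2)) * k"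
      by (rule mult_right_mono) simp
    then show ?thesis by (simp add: distrib_right)
  qed
  have sh: "(\<integral>\<^sup>+ y. \<Phi> (y - x) \<partial>lborel) = (\<integral>\<^sup>+ z. \<Phi> z \<partial>lborel)" for x
    using nn_integral_real_affine[of \<Phi> 1 "-x"] by simp
  have sh': "(\<integral>\<^sup>+ x. \<Phi> (y - x) \<partial>lborel) = (\<integral>\<^sup>+ z. \<Phi> z \<partial>lborel)" for y
    using nn_integral_real_affine[of \<Phi> "-1" y] by simp
  have "(\<integral>\<^sup>+ x. \<integral>\<^sup>+ y. ennreal (u x) * ennreal (u y) * \<Phi> (y - x) \<partial>lborel \<partial>lborel)
    \<le> (\<integral>\<^sup>+ x. \<integral>\<^sup>+ y. (ennreal ((u x)\<^sup>2) * \<Phi> (y - x) + ennreal ((u y)\<^sup>2) * \<Phi> (y - x)) \<partial>lborel \<partial>lborel)"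
    by (intro nn_integral_mono pt)
  also have "\<dots> = (\<integral>\<^sup>+ x. \<integral>\<^sup>+ y. ennreal ((u x)\<^sup>2) * \<Phi> (y - x) \<partial>lborel \<partial>lborel)
      + (\<integral>\<^sup>+ x. \<integral>\<^sup>+ y. ennreal ((u y)\<^sup>2) * \<Phi> (y - x) \<partial>lborel \<partial>lborel)"
    by (simp add: nn_integral_add)
  also have "(\<integral>\<^sup>+ x. \<integral>\<^sup>+ y. ennreal ((u y)\<^sup>2) * \<Phi> (y - x) \<partial>lborel \<partial>lborel)
     = (\<integral>\<^sup>+ y. \<integral>\<^sup>+ x. ennreal ((u y)\<^sup>2) * \<Phi> (y - x) \<partial>lborel \<partial>lborel)"
    by (rule lborel_pair.Fubini') measurable
  also have "(\<integral>\<^sup>+ x. \<integral>\<^sup>+ y. ennreal ((u x)\<^sup>2) * \<Phi> (y - x) \<partial>lborel \<partial>lborel)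
      + (\<integral>\<^sup>+ y. \<integral>\<^sup>+ x. ennreal ((u y)\<^sup>2) * \<Phi> (y - x) \<partial>lborel \<partial>lborel)
     = 2 * (\<integral>\<^sup>+ z. \<Phi> z \<partial>lborel) * (\<integral>\<^sup>+ x. ennreal ((u x)\<^sup>2) \<partial>lborel)"
    by (simp add: nn_integral_cmult nn_integral_multc sh sh')
       (simp add: mult_2 mult_2_right distrib_left distrib_right mult_ac)
  finally show ?thesis .
qed

text \<open>The kernel bound at unit frequency and times up to \<open>T\<close>. Its two branches meet at \<open>\<bar>z\<bar> = T\<close>, so its
integral has the size of \<open>sqrt T\<close>: the square of the loss \<open>T powr (1/4)\<close> in the maximal estimate.\<close>

definition kernel_majorant :: "real \<Rightarrow> real \<Rightarrow> real" where
  "kernel_majorant T z = min (\<bar>z\<bar> powr (-1/2)) (T powr (3/2) * \<bar>z\<bar> powr (-2))"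

lemma kernel_majorant_nonneg: "kernel_majorant T z \<ge> 0"
  by (simp add: kernel_majorant_def)

lemma kernel_majorant_measurable [measurable]: "kernel_majorant T \<in> borel_measurable borel"
  unfolding kernel_majorant_def[abs_def] by measurable

lemma nn_integral_kernel_majorant:
  assumes T: "T > 0"
  shows "(\<integral>\<^sup>+ z. ennreal (kernel_majorant T z) \<partial>lborel) \<le> ennreal (6 * sqrt T)"
proof -
  let ?P = "\<lambda>z. ennreal (kernel_majorant T z) * indicator {0..} z"
  have pos: "(\<integral>\<^sup>+ z. ?P z \<partial>lborel) \<le> ennreal (3 * sqrt T)"
  proof -
    have "(\<integral>\<^sup>+ z. ?P z \<partial>lborel) \<le>
       (\<integral>\<^sup>+ z. ennreal (z powr (-1/2)) * indicator {0..T} z +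
             ennreal (T powr (3/2)) * (ennreal (z powr (-2)) * indicator {T..} z) \<partial>lborel)"
      using T by (intro nn_integral_mono)
        (auto simp: kernel_majorant_def min_def indicator_def ennreal_mult[symmetric] intro!: ennreal_leI)
    also have "\<dots> = ennreal (T powr (1/2) / (1/2)) + ennreal (T powr (3/2)) * ennreal (T powr (-1))"
      using T nn_integral_powr_near_0[of "-1/2" T] nn_integral_powr_near_top[of "-2" T]
      by (subst nn_integral_add) (auto simp: nn_integral_cmult)
    also have "\<dots> = ennreal (3 * sqrt T)"
    proof -
      have "T powr (3/2) * T powr (-1) = T powr (3/2 + (-1))" by (rule powr_add[symmetric])
      then have e: "T powr (3/2) * T powr (-1) = sqrt T" using T by (simp add: powr_half_sqrt)
      show ?thesis
        unfolding ennreal_mult[OF powr_ge_zero powr_ge_zero, symmetric] e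
        using T by (simp add: powr_half_sqrt flip: ennreal_plus)
    qed
    finally show ?thesis .
  qed
  have "(\<integral>\<^sup>+ z. ennreal (kernel_majorant T z) \<partial>lborel) \<le> (\<integral>\<^sup>+ z. ?P z + ?P (- z) \<partial>lborel)"
    by (intro nn_integral_mono) (auto simp: indicator_def kernel_majorant_def)
  also have "\<dots> = (\<integral>\<^sup>+ z. ?P z \<partial>lborel) + (\<integral>\<^sup>+ z. ?P (- z) \<partial>lborel)"
    by (rule nn_integral_add) measurable
  also have "(\<integral>\<^sup>+ z. ?P (- z) \<partial>lborel) = (\<integral>\<^sup>+ z. ?P z \<partial>lborel)"
    using nn_integral_real_affine[of ?P "-1" 0] by simp
  also have "(\<integral>\<^sup>+ z. ?P z \<partial>lborel) + (\<integral>\<^sup>+ z. ?P z \<partial>lborel) \<le> ennreal (3 * sqrt T) + ennreal (3 * sqrt T)"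
    by (intro add_mono pos)
  also have "\<dots> = ennreal (6 * sqrt T)"
    using T by (simp flip: ennreal_plus)
  finally show ?thesis .
qed

definition cutoff :: "real \<Rightarrow> real \<Rightarrow> real" where
  "cutoff N r = bump (r / N) * indicator {1/2..3} (r / N)"

lemma cutoff_measurable [measurable]: "cutoff N \<in> borel_measurable borel"
  unfolding cutoff_def[abs_def] bump_def by measurable

lemma cutoff_nonneg: "cutoff N r \<ge> 0"
  by (auto simp: cutoff_def bump_def indicator_def intro!: mult_nonneg_nonneg)

lemma cutoff_ge_1:
  assumes "N > 0" "r \<in> {N..2*N}"
  shows "cutoff N r \<ge> 1"
proof -
  define x where "x = r / N"
  have x: "1 \<le> x" "x \<le> 2" using assms by (auto simp: x_def field_simps)
  have "0 \<le> (x - 1) * (5/2 - x)" using x by (intro mult_nonneg_nonneg) auto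
  then have "1 \<le> bump x" by (simp add: bump_def field_simps)
  then show ?thesis using x by (simp add: cutoff_def x_def[symmetric] indicator_def)
qed

lemma integrable_unit_cutoff: "integrable lborel (cutoff 1)"
proof -
  have "set_integrable lborel {1/2..3} bump"
    unfolding bump_def[abs_def] by (intro borel_integrable_atLeastAtMost' continuous_intros)
  then show ?thesis by (simp add: set_integrable_def cutoff_def[abs_def] mult.commute)
qed

lemma integrable_cutoff:
  assumes "N > 0" shows "integrable lborel (cutoff N)"
  using lborel_integrable_real_affine[OF integrable_unit_cutoff, of "1/N" 0] assms
  by (simp add: cutoff_def[abs_def])

text \<open>Rescaling frequency \<open>N\<close> to frequency 1 turns position \<open>z\<close> into \<open>N * z\<close> and time \<open>t\<close> into \<open>t * N powr a\<close>.\<close>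

lemma cutoff_kernel_eq:
  assumes N: "N > 0"
  shows "(LINT r|lborel. of_real (cutoff N r) * cis (r * z + t * r powr a))
     = of_real N * unit_kernel a (N * z) (t * N powr a)"
proof -
  have c: "continuous_on {1/2..3} (\<lambda>r. of_real (bump r) * cis (r * (N * z) + t * N powr a * r powr a))"
    unfolding bump_def by (intro continuous_intros) auto
  have "(LINT r|lborel. of_real (cutoff N r) * cis (r * z + t * r powr a))
     = \<bar>N\<bar> *\<^sub>R (LINT r|lborel. of_real (cutoff N (0 + N * r)) * cis ((0 + N * r) * z + t * (0 + N * r) powr a))"
    using N by (intro lborel_integral_real_affine) auto
  also have "(LINT r|lborel. of_real (cutoff N (0 + N * r)) * cis ((0 + N * r) * z + t * (0 + N * r) powr a))
     = (LINT r:{1/2..3}|lborel. of_real (bump r) * cis (r * (N * z) + t * N powr a * r powr a))"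
    unfolding set_lebesgue_integral_def using N
    by (intro Bochner_Integration.integral_cong) (auto simp: cutoff_def indicator_def powr_mult mult_ac)
  also have "\<dots> = unit_kernel a (N * z) (t * N powr a)"
    unfolding unit_kernel_def
    by (rule set_borel_integral_eq_integral(2)[OF borel_integrable_atLeastAtMost'[OF c]])
  finally show ?thesis using N by (simp add: scaleR_conv_of_real)
qed

text \<open>The transpose of the operator that evaluates the solution with data \<open>g\<close> at the points
\<open>(\<rho>, \<tau> \<rho>)\<close>.\<close>

definition dual_transform :: "real \<Rightarrow> (real \<Rightarrow> real) \<Rightarrow> (real \<Rightarrow> complex) \<Rightarrow> real \<Rightarrow> complex" where
  "dual_transform a \<tau> h r = (LINT \<rho>|lborel. cis (- (r * \<rho> + \<tau> \<rho> * r powr a)) * h \<rho>)"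

lemma dual_transform_measurable [measurable]:
  assumes [measurable]: "\<tau> \<in> borel_measurable borel" "h \<in> borel_measurable borel"
  shows "dual_transform a \<tau> h \<in> borel_measurable borel"
  unfolding dual_transform_def[abs_def] by measurable

lemma dual_transform_bounded:
  "cmod (dual_transform a \<tau> h r) \<le> (LINT \<rho>|lborel. cmod (h \<rho>))"
  unfolding dual_transform_def
  by (rule order_trans[OF integral_norm_bound]) (simp add: norm_mult)

text \<open>The \<open>T T*\<close> step: expand the square as a double integral over \<open>\<rho>\<close> and \<open>\<sigma>\<close> and do the integral over
\<open>r\<close> first. The unknown function \<open>\<tau>\<close> then enters only through the time argument of the kernel.\<close>

lemma dual_transform_weighted_square:
  fixes \<psi> :: "real \<Rightarrow> real"
  assumes [measurable]: "\<tau> \<in> borel_measurable borel" and h: "integrable lborel h"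
    and psi: "integrable lborel \<psi>" "\<And>r. \<psi> r \<ge> 0"
  shows "ennreal (LINT r|lborel. \<psi> r * (cmod (dual_transform a \<tau> h r))\<^sup>2) \<le>
    (\<integral>\<^sup>+ \<rho>. \<integral>\<^sup>+ \<sigma>. ennreal (cmod (h \<rho>)) * ennreal (cmod (h \<sigma>)) *
       ennreal (cmod (LINT r|lborel. of_real (\<psi> r) * cis (r * (\<sigma> - \<rho>) + (\<tau> \<sigma> - \<tau> \<rho>) * r powr a))) \<partial>lborel \<partial>lborel)"
proof -
  note [measurable] = borel_measurable_integrable[OF h] borel_measurable_integrable[OF psi(1)]
  define H where "H = dual_transform a \<tau> h"
  define e where "e r \<rho> = cis (- (r * \<rho> + \<tau> \<rho> * r powr a))" for r \<rho>
  define M where "M = (LINT \<rho>|lborel. cmod (h \<rho>))"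
  have [measurable]: "case_prod e \<in> borel_measurable (borel \<Otimes>\<^sub>M borel)"
    unfolding e_def by measurable
  have [measurable]: "H \<in> borel_measurable borel" unfolding H_def by measurable
  have Hb: "cmod (H r) \<le> M" for r unfolding H_def M_def by (rule dual_transform_bounded)
  have He: "H r = (LINT \<rho>|lborel. e r \<rho> * h \<rho>)" for r by (simp add: H_def dual_transform_def e_def)
  have e1: "cmod (e r \<rho>) = 1" for r \<rho> by (simp add: e_def)
  define Q where "Q \<rho> = (LINT r|lborel. of_real (\<psi> r) * e r \<rho> * cnj (H r))" for \<rho>
  have "complex_of_real (LINT r|lborel. \<psi> r * (cmod (H r))\<^sup>2) = (LINT r|lborel. of_real (\<psi> r * (cmod (H r))\<^sup>2))"
    by (rule integral_complex_of_real[symmetric])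
  also have "\<dots> = (LINT r|lborel. LINT \<rho>|lborel. h \<rho> * (of_real (\<psi> r) * e r \<rho> * cnj (H r)))"
  proof (rule Bochner_Integration.integral_cong[OF refl])
    fix r
    have "complex_of_real (\<psi> r * (cmod (H r))\<^sup>2) = (of_real (\<psi> r) * cnj (H r)) * H r"
      by (simp only: of_real_mult complex_norm_square mult_ac)
    also have "\<dots> = (LINT \<rho>|lborel. (of_real (\<psi> r) * cnj (H r)) * (e r \<rho> * h \<rho>))"
      unfolding He[of r] by simp
    finally show "complex_of_real (\<psi> r * (cmod (H r))\<^sup>2) = (LINT \<rho>|lborel. h \<rho> * (of_real (\<psi> r) * e r \<rho> * cnj (H r)))"
      by (simp add: mult_ac)
  qed
  also have "\<dots> = (LINT \<rho>|lborel. LINT r|lborel. h \<rho> * (of_real (\<psi> r) * e r \<rho> * cnj (H r)))"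
  proof (rule Fubini_lborel_bounded[where A = "\<lambda>r. M * \<psi> r" and B = "\<lambda>\<rho>. cmod (h \<rho>)"])
    show "cmod (h \<rho> * (of_real (\<psi> r) * e r \<rho> * cnj (H r))) \<le> M * \<psi> r * cmod (h \<rho>)" for r \<rho>
    proof -
      have "cmod (h \<rho>) * (\<psi> r * cmod (H r)) \<le> cmod (h \<rho>) * (\<psi> r * M)"
        by (intro mult_left_mono Hb psi) auto
      then show ?thesis using psi(2)[of r] by (simp add: norm_mult e1 mult_ac)
    qed
    show "(\<lambda>(r, \<rho>). h \<rho> * (of_real (\<psi> r) * e r \<rho> * cnj (H r))) \<in> borel_measurable (lborel \<Otimes>\<^sub>M lborel)"
      unfolding e_def by measurable
  qed (use h psi in \<open>auto intro!: integrable_mult_right\<close>)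
  also have "\<dots> = (LINT \<rho>|lborel. h \<rho> * Q \<rho>)" by (simp add: Q_def)
  finally have eq: "complex_of_real (LINT r|lborel. \<psi> r * (cmod (H r))\<^sup>2) = (LINT \<rho>|lborel. h \<rho> * Q \<rho>)" .
  have Qe: "Q \<rho> = (LINT \<sigma>|lborel. cnj (h \<sigma>) * (LINT r|lborel. of_real (\<psi> r) * cis (r * (\<sigma> - \<rho>) + (\<tau> \<sigma> - \<tau> \<rho>) * r powr a)))" for \<rho>
  proof -
    have "Q \<rho> = (LINT r|lborel. LINT \<sigma>|lborel. of_real (\<psi> r) * e r \<rho> * cnj (e r \<sigma> * h \<sigma>))"
      unfolding Q_def He by (simp only: integral_mult_right_zero Bochner_Integration.integral_cnj)
    also have "\<dots> = (LINT \<sigma>|lborel. LINT r|lborel. of_real (\<psi> r) * e r \<rho> * cnj (e r \<sigma> * h \<sigma>))"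
      by (rule Fubini_lborel_bounded[where A = \<psi> and B = "\<lambda>\<rho>. cmod (h \<rho>)"])
        (use h psi in \<open>auto simp: norm_mult e1\<close>)
    also have "\<dots> = (LINT \<sigma>|lborel. LINT r|lborel. cnj (h \<sigma>) * (of_real (\<psi> r) * cis (r * (\<sigma> - \<rho>) + (\<tau> \<sigma> - \<tau> \<rho>) * r powr a)))"
    proof (intro Bochner_Integration.integral_cong refl)
      fix \<sigma> r
      have ee: "e r \<rho> * cnj (e r \<sigma>) = cis (r * (\<sigma> - \<rho>) + (\<tau> \<sigma> - \<tau> \<rho>) * r powr a)"
        by (simp add: e_def cis_cnj cis_mult algebra_simps)
      show "of_real (\<psi> r) * e r \<rho> * cnj (e r \<sigma> * h \<sigma>) = cnj (h \<sigma>) * (of_real (\<psi> r) * cis (r * (\<sigma> - \<rho>) + (\<tau> \<sigma> - \<tau> \<rho>) * r powr a))"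
        unfolding ee[symmetric] by (simp add: mult_ac)
    qed
    finally show ?thesis by simp
  qed
  have "ennreal (LINT r|lborel. \<psi> r * (cmod (H r))\<^sup>2) = ennreal (cmod (complex_of_real (LINT r|lborel. \<psi> r * (cmod (H r))\<^sup>2)))"
    using psi(2) by (simp add: integral_nonneg_AE)
  also have "\<dots> \<le> (\<integral>\<^sup>+ \<rho>. ennreal (cmod (h \<rho> * Q \<rho>)) \<partial>lborel)"
    unfolding eq by (rule norm_integral_le_nn_integral)
  also have "\<dots> \<le> (\<integral>\<^sup>+ \<rho>. \<integral>\<^sup>+ \<sigma>. ennreal (cmod (h \<rho>)) * ennreal (cmod (h \<sigma>)) *
       ennreal (cmod (LINT r|lborel. of_real (\<psi> r) * cis (r * (\<sigma> - \<rho>) + (\<tau> \<sigma> - \<tau> \<rho>) * r powr a))) \<partial>lborel \<partial>lborel)"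
  proof (intro nn_integral_mono)
    fix \<rho>
    let ?K = "\<lambda>\<sigma>. LINT r|lborel. of_real (\<psi> r) * cis (r * (\<sigma> - \<rho>) + (\<tau> \<sigma> - \<tau> \<rho>) * r powr a)"
    have "ennreal (cmod (Q \<rho>)) \<le> (\<integral>\<^sup>+ \<sigma>. ennreal (cmod (cnj (h \<sigma>) * ?K \<sigma>)) \<partial>lborel)"
      unfolding Qe by (rule norm_integral_le_nn_integral)
    also have "\<dots> = (\<integral>\<^sup>+ \<sigma>. ennreal (cmod (h \<sigma>)) * ennreal (cmod (?K \<sigma>)) \<partial>lborel)"
      by (simp add: norm_mult ennreal_mult)
    finally have "ennreal (cmod (h \<rho>)) * ennreal (cmod (Q \<rho>)) \<le>
        ennreal (cmod (h \<rho>)) * (\<integral>\<^sup>+ \<sigma>. ennreal (cmod (h \<sigma>)) * ennreal (cmod (?K \<sigma>)) \<partial>lborel)"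
      by (intro mult_left_mono) auto
    also have "\<dots> = (\<integral>\<^sup>+ \<sigma>. ennreal (cmod (h \<rho>)) * (ennreal (cmod (h \<sigma>)) * ennreal (cmod (?K \<sigma>))) \<partial>lborel)"
      by (rule nn_integral_cmult[symmetric]) measurable
    finally show "ennreal (cmod (h \<rho> * Q \<rho>)) \<le> (\<integral>\<^sup>+ \<sigma>. ennreal (cmod (h \<rho>)) * ennreal (cmod (h \<sigma>)) *
       ennreal (cmod (?K \<sigma>)) \<partial>lborel)"
      by (simp add: norm_mult ennreal_mult mult.assoc)
  qed
  finally show ?thesis unfolding H_def .
qed

text \<open>Time differences are at most 2, hence at most \<open>T = 2 * N powr a\<close> after rescaling to frequency 1. The
kernel bound does not depend on the time, so Schur's test for a convolution applies.\<close>

theorem dual_transform_dyadic: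
  fixes a :: real
  assumes a: "a > 0" "a \<noteq> 1"
  shows "\<exists>C>0. \<forall>N\<ge>1. \<forall>\<tau> h. \<tau> \<in> borel_measurable borel \<longrightarrow> (\<forall>\<rho>. \<bar>\<tau> \<rho>\<bar> \<le> 1) \<longrightarrow> integrable lborel h \<longrightarrow>
     (\<integral>\<^sup>+ r. ennreal ((cmod (dual_transform a \<tau> h r))\<^sup>2) * indicator {N..2*N} r \<partial>lborel)
       \<le> ennreal (C * N powr (a/2)) * sq_mass h"
proof -
  obtain C where C: "C > 0" and K: "\<And>T z t. T \<ge> 1 \<Longrightarrow> z \<noteq> 0 \<Longrightarrow> \<bar>t\<bar> \<le> T \<Longrightarrow>
     cmod (unit_kernel a z t) \<le> C * \<bar>z\<bar> powr (-1/2) \<and>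
     cmod (unit_kernel a z t) \<le> C * T powr (3/2) * \<bar>z\<bar> powr (-2)"
    using unit_kernel_bounds[OF a] by blast
  have main: "(\<integral>\<^sup>+ r. ennreal ((cmod (dual_transform a \<tau> h r))\<^sup>2) * indicator {N..2*N} r \<partial>lborel)
       \<le> ennreal (12 * sqrt 2 * C * N powr (a/2)) * sq_mass h"
    if N: "N \<ge> 1" and [measurable]: "\<tau> \<in> borel_measurable borel" and \<tau>: "\<And>\<rho>. \<bar>\<tau> \<rho>\<bar> \<le> 1" and h: "integrable lborel h"
    for N \<tau> h
  proof -
    note [measurable] = borel_measurable_integrable[OF h]
    define T where "T = 2 * N powr a"
    have Na: "N powr a \<ge> 1" using N a by (simp add: ge_one_powr_ge_zero)
    have T: "T \<ge> 1" using Na by (simp add: T_def)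
    let ?k = "\<lambda>\<rho> \<sigma>. cmod (LINT r|lborel. of_real (cutoff N r) * cis (r * (\<sigma> - \<rho>) + (\<tau> \<sigma> - \<tau> \<rho>) * r powr a))"
    have kb: "?k \<rho> \<sigma> \<le> N * C * kernel_majorant T (N * (\<sigma> - \<rho>))" if "\<sigma> \<noteq> \<rho>" for \<rho> \<sigma>
    proof -
      have "\<bar>(\<tau> \<sigma> - \<tau> \<rho>) * N powr a\<bar> \<le> T"
        using \<tau>[of \<sigma>] \<tau>[of \<rho>] Na unfolding abs_mult T_def by (intro mult_mono) auto
      moreover have "N * (\<sigma> - \<rho>) \<noteq> 0" using that N by auto
      ultimately have "cmod (unit_kernel a (N * (\<sigma> - \<rho>)) ((\<tau> \<sigma> - \<tau> \<rho>) * N powr a)) \<le> C * kernel_majorant T (N * (\<sigma> - \<rho>))"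
        using K[OF T] C unfolding kernel_majorant_def min_mult_distrib_left by (simp add: mult.assoc)
      then have "N * cmod (unit_kernel a (N * (\<sigma> - \<rho>)) ((\<tau> \<sigma> - \<tau> \<rho>) * N powr a)) \<le> N * (C * kernel_majorant T (N * (\<sigma> - \<rho>)))"
        using N by (intro mult_left_mono) auto
      then show ?thesis using N by (simp add: cutoff_kernel_eq norm_mult mult.assoc)
    qed
    define \<Phi> where "\<Phi> z = ennreal (N * C * kernel_majorant T (N * z))" for z
    have [measurable]: "\<Phi> \<in> borel_measurable borel" unfolding \<Phi>_def by measurable
    have "(\<integral>\<^sup>+ z. \<Phi> z \<partial>lborel) = ennreal C * (ennreal N * (\<integral>\<^sup>+ z. ennreal (kernel_majorant T (N * z)) \<partial>lborel))"
      unfolding \<Phi>_def using N C kernel_majorant_nonneg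
      by (simp add: ennreal_mult' nn_integral_cmult mult_ac)
    also have "ennreal N * (\<integral>\<^sup>+ z. ennreal (kernel_majorant T (N * z)) \<partial>lborel) = (\<integral>\<^sup>+ z. ennreal (kernel_majorant T z) \<partial>lborel)"
      using nn_integral_real_affine[of "\<lambda>z. ennreal (kernel_majorant T z)" N 0] N by simp
    also have "ennreal C * \<dots> \<le> ennreal C * ennreal (6 * sqrt T)"
      using T by (intro mult_left_mono nn_integral_kernel_majorant) auto
    also have "\<dots> = ennreal (6 * sqrt 2 * C * N powr (a/2))"
    proof -
      have "sqrt (N powr a) = N powr (a/2)" using N by (simp add: powr_half_sqrt[symmetric] powr_powr)
      then show ?thesis using C by (simp add: T_def real_sqrt_mult mult_ac flip: ennreal_mult)
    qed
    finally have \<Phi>: "(\<integral>\<^sup>+ z. \<Phi> z \<partial>lborel) \<le> ennreal (6 * sqrt 2 * C * N powr (a/2))" .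
    let ?H = "dual_transform a \<tau> h"
    have int: "integrable lborel (\<lambda>r. cutoff N r * (cmod (?H r))\<^sup>2)"
    proof (rule Bochner_Integration.integrable_bound)
      show "integrable lborel (\<lambda>r. cutoff N r * (LINT \<rho>|lborel. cmod (h \<rho>))\<^sup>2)"
        using N by (intro integrable_mult_left integrable_cutoff) auto
      show "AE r in lborel. norm (cutoff N r * (cmod (?H r))\<^sup>2) \<le> norm (cutoff N r * (LINT \<rho>|lborel. cmod (h \<rho>))\<^sup>2)"
        using cutoff_nonneg by (auto simp: abs_mult intro!: mult_left_mono power_mono dual_transform_bounded)
    qed measurable
    have "(\<integral>\<^sup>+ r. ennreal ((cmod (?H r))\<^sup>2) * indicator {N..2*N} r \<partial>lborel)
       \<le> (\<integral>\<^sup>+ r. ennreal (cutoff N r * (cmod (?H r))\<^sup>2) \<partial>lborel)"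
    proof (intro nn_integral_mono)
      fix r
      show "ennreal ((cmod (?H r))\<^sup>2) * indicator {N..2*N} r \<le> ennreal (cutoff N r * (cmod (?H r))\<^sup>2)"
      proof (cases "r \<in> {N..2*N}")
        case True
        then have "1 * (cmod (?H r))\<^sup>2 \<le> cutoff N r * (cmod (?H r))\<^sup>2"
          using cutoff_ge_1[of N r] N by (intro mult_right_mono) auto
        then show ?thesis using True by (simp add: ennreal_leI)
      qed simp
    qed
    also have "\<dots> = ennreal (LINT r|lborel. cutoff N r * (cmod (?H r))\<^sup>2)"
      by (rule nn_integral_eq_integral[OF int]) (simp add: cutoff_nonneg)
    also have "\<dots> \<le> (\<integral>\<^sup>+ \<rho>. \<integral>\<^sup>+ \<sigma>. ennreal (cmod (h \<rho>)) * ennreal (cmod (h \<sigma>)) * ennreal (?k \<rho> \<sigma>) \<partial>lborel \<partial>lborel)"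
      using N by (intro dual_transform_weighted_square h integrable_cutoff cutoff_nonneg) auto
    also have "\<dots> \<le> (\<integral>\<^sup>+ \<rho>. \<integral>\<^sup>+ \<sigma>. ennreal (cmod (h \<rho>)) * ennreal (cmod (h \<sigma>)) * \<Phi> (\<sigma> - \<rho>) \<partial>lborel \<partial>lborel)"
    proof (rule nn_integral_mono, rule nn_integral_mono_AE)
      fix \<rho>
      show "AE \<sigma> in lborel. ennreal (cmod (h \<rho>)) * ennreal (cmod (h \<sigma>)) * ennreal (?k \<rho> \<sigma>)
         \<le> ennreal (cmod (h \<rho>)) * ennreal (cmod (h \<sigma>)) * \<Phi> (\<sigma> - \<rho>)"
        using AE_lborel_singleton[of \<rho>]
        by eventually_elim (auto simp: \<Phi>_def intro!: mult_left_mono ennreal_leI kb)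
    qed
    also have "\<dots> \<le> 2 * (\<integral>\<^sup>+ z. \<Phi> z \<partial>lborel) * sq_mass h"
      by (rule schur_convolution) auto
    also have "\<dots> \<le> 2 * ennreal (6 * sqrt 2 * C * N powr (a/2)) * sq_mass h"
      by (intro mult_right_mono mult_left_mono \<Phi>) auto
    also have "2 * ennreal (6 * sqrt 2 * C * N powr (a/2)) = ennreal (12 * sqrt 2 * C * N powr (a/2))"
      using C by (subst ennreal_numeral[symmetric], subst ennreal_mult[symmetric]) (auto simp: mult_ac)
    finally show ?thesis .
  qed
  show ?thesis
    using C main by (intro exI[of _ "12 * sqrt 2 * C"]) auto
qed

section \<open>The dual operator in weighted norms\<close>

lemma suminf_cauchy_schwarz:
  fixes c b :: "nat \<Rightarrow> real"
  assumes c: "\<And>k. c k \<ge> 0" and b: "\<And>k. b k \<ge> 0"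
  shows "(\<Sum>k. ennreal (c k * b k))\<^sup>2 \<le> (\<Sum>k. ennreal (c k)) * (\<Sum>k. ennreal (c k * (b k)\<^sup>2))"
proof -
  have "(\<integral>\<^sup>+ k. ennreal (sqrt (c k)) * ennreal (sqrt (c k) * b k) \<partial>count_space UNIV)\<^sup>2 \<le>
    (\<integral>\<^sup>+ k. (ennreal (sqrt (c k)))\<^sup>2 \<partial>count_space UNIV) * (\<integral>\<^sup>+ k. (ennreal (sqrt (c k) * b k))\<^sup>2 \<partial>count_space UNIV)"
    by (rule Cauchy_Schwarz_nn_integral) auto
  moreover have "ennreal (sqrt (c k)) * ennreal (sqrt (c k) * b k) = ennreal (c k * b k)" for k
    using c[of k] b[of k] by (simp flip: ennreal_mult mult.assoc)
  moreover have "(ennreal (sqrt (c k)))\<^sup>2 = ennreal (c k)" for k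
    using c[of k] by (simp add: ennreal_power)
  moreover have "(ennreal (sqrt (c k) * b k))\<^sup>2 = ennreal (c k * (b k)\<^sup>2)" for k
    using c[of k] b[of k] by (simp add: ennreal_power power_mult_distrib)
  ultimately show ?thesis by (simp add: nn_integral_count_space_nat)
qed

text \<open>For \<open>r \<le> 1\<close> expand \<open>cis (- (\<tau> \<rho> * r powr a))\<close> in its exponential series. Each term is a plain Fourier
transform of \<open>(\<tau> \<rho>) ^ k * h \<rho>\<close>, with no oscillation in time left, and the factor \<open>1 / k!\<close> sums.\<close>

lemma dual_transform_series:
  assumes [measurable]: "\<tau> \<in> borel_measurable borel" and \<tau>: "\<And>\<rho>. \<bar>\<tau> \<rho>\<bar> \<le> 1"
    and h: "integrable lborel h" and r: "0 \<le> r" "r \<le> 1" and a: "a > 0"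
  shows "ennreal ((cmod (dual_transform a \<tau> h r))\<^sup>2) \<le>
    ennreal (exp 1) * (\<Sum>k. ennreal (inverse (fact k) * (cmod (dual_transform a (\<lambda>_. 0) (\<lambda>\<rho>. of_real (\<tau> \<rho> ^ k) * h \<rho>) r))\<^sup>2))"
proof -
  note [measurable] = borel_measurable_integrable[OF h]
  define E where "E k = dual_transform a (\<lambda>_. 0) (\<lambda>\<rho>. of_real (\<tau> \<rho> ^ k) * h \<rho>) r" for k
  define z where "z \<rho> = - \<i> * of_real (\<tau> \<rho> * r powr a)" for \<rho>
  define f where "f k \<rho> = (z \<rho> ^ k /\<^sub>R fact k) * (cis (- (r * \<rho>)) * h \<rho>)" for k \<rho>
  have ra: "r powr a \<le> 1" using r a by (simp add: powr_le1)
  have [measurable]: "z \<in> borel_measurable borel" unfolding z_def by measurable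
  have z1: "cmod (z \<rho>) \<le> 1" for \<rho>
  proof -
    have "\<bar>\<tau> \<rho>\<bar> * r powr a \<le> 1 * 1" by (intro mult_mono \<tau> ra) auto
    then show ?thesis by (simp add: z_def norm_mult)
  qed
  have zk: "cmod (z \<rho>) ^ k \<le> 1" for \<rho> k by (rule power_le_one) (use z1 in auto)
  have tk: "\<bar>\<tau> \<rho>\<bar> ^ k \<le> 1" for \<rho> k by (rule power_le_one) (use \<tau> in auto)
  have fb: "norm (f k \<rho>) \<le> inverse (fact k) * cmod (h \<rho>)" for k \<rho>
  proof -
    have "norm (f k \<rho>) = cmod (z \<rho>) ^ k * (inverse (fact k) * cmod (h \<rho>))"
      by (simp add: f_def norm_mult norm_power)
    also have "\<dots> \<le> 1 * (inverse (fact k) * cmod (h \<rho>))"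
      by (intro mult_right_mono zk) auto
    finally show ?thesis by simp
  qed
  have sm: "summable (\<lambda>k. inverse (fact k) * c)" for c :: real
    using summable_mult2[OF summable_exp[of "1::real"], of c] by simp
  have fi: "integrable lborel (f k)" for k
    by (rule Bochner_Integration.integrable_bound[where f = "\<lambda>\<rho>. inverse (fact k) * cmod (h \<rho>)"])
       (use h fb in \<open>auto simp: f_def[abs_def]\<close>)
  have s1: "AE \<rho> in lborel. summable (\<lambda>k. norm (f k \<rho>))"
    by (intro AE_I2 summable_comparison_test'[OF sm]) (use fb in auto)
  have s2: "summable (\<lambda>k. LINT \<rho>|lborel. norm (f k \<rho>))"
  proof (rule summable_comparison_test'[OF sm])
    fix k :: nat
    have "(LINT \<rho>|lborel. norm (f k \<rho>)) \<le> (LINT \<rho>|lborel. inverse (fact k) * cmod (h \<rho>))"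
      by (rule integral_mono) (use fi h fb in auto)
    then show "norm (LINT \<rho>|lborel. norm (f k \<rho>)) \<le> inverse (fact k) * (LINT \<rho>|lborel. cmod (h \<rho>))"
      by simp
  qed
  have fE: "(LINT \<rho>|lborel. f k \<rho>) = ((- \<i> * of_real (r powr a)) ^ k /\<^sub>R fact k) * E k" for k
  proof -
    have zp: "z \<rho> ^ k = of_real (\<tau> \<rho> ^ k) * (- \<i> * of_real (r powr a)) ^ k" for \<rho>
    proof -
      have "z \<rho> = of_real (\<tau> \<rho>) * (- \<i> * of_real (r powr a))" by (simp add: z_def)
      then show ?thesis by (simp only: power_mult_distrib of_real_power)
    qed
    have "f k \<rho> = ((- \<i> * of_real (r powr a)) ^ k /\<^sub>R fact k) * (cis (- (r * \<rho> + 0 * r powr a)) * (of_real (\<tau> \<rho> ^ k) * h \<rho>))" for \<rho>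
      unfolding f_def zp by (simp add: scaleR_conv_of_real mult_ac)
    then show ?thesis unfolding E_def dual_transform_def by (simp only: integral_mult_right_zero)
  qed
  have sums: "(\<Sum>k. f k \<rho>) = cis (- (r * \<rho> + \<tau> \<rho> * r powr a)) * h \<rho>" for \<rho>
  proof -
    have "(\<lambda>k. f k \<rho>) sums (exp (z \<rho>) * (cis (- (r * \<rho>)) * h \<rho>))"
      unfolding f_def by (intro sums_mult2 exp_converges)
    moreover have "exp (z \<rho>) = cis (- (\<tau> \<rho> * r powr a))" by (simp add: z_def cis_conv_exp)
    ultimately show ?thesis by (simp add: sums_iff cis_mult mult.assoc[symmetric] add.commute)
  qed
  have H: "dual_transform a \<tau> h r = (\<Sum>k. (LINT \<rho>|lborel. f k \<rho>))"
    using integral_suminf[OF fi s1 s2] by (simp add: dual_transform_def sums)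
  have n: "cmod (LINT \<rho>|lborel. f k \<rho>) \<le> inverse (fact k) * cmod (E k)" for k
  proof -
    have "cmod (LINT \<rho>|lborel. f k \<rho>) = (r powr a) ^ k * (inverse (fact k) * cmod (E k))"
      unfolding fE by (simp add: norm_mult norm_power)
    also have "\<dots> \<le> 1 * (inverse (fact k) * cmod (E k))"
      by (intro mult_right_mono power_le_one ra) auto
    finally show ?thesis by simp
  qed
  have Eb: "cmod (E k) \<le> (LINT \<rho>|lborel. cmod (h \<rho>))" for k
    unfolding E_def
  proof (rule order_trans[OF dual_transform_bounded integral_mono])
    show "cmod (of_real (\<tau> \<rho> ^ k) * h \<rho>) \<le> cmod (h \<rho>)" for \<rho>
      using mult_right_mono[OF tk[of \<rho> k], of "cmod (h \<rho>)"] by (simp add: norm_mult norm_power power_abs)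
    then show "integrable lborel (\<lambda>\<rho>. cmod (of_real (\<tau> \<rho> ^ k) * h \<rho>))"
      by (intro integrable_norm Bochner_Integration.integrable_bound[OF h]) auto
  qed (use h in auto)
  have sE: "summable (\<lambda>k. inverse (fact k) * cmod (E k))"
    by (rule summable_comparison_test'[OF sm[of "LINT \<rho>|lborel. cmod (h \<rho>)"]]) (use Eb in \<open>auto intro!: mult_left_mono\<close>)
  have sN: "summable (\<lambda>k. cmod (LINT \<rho>|lborel. f k \<rho>))"
    by (rule summable_comparison_test'[OF sE]) (use n in auto)
  have "cmod (dual_transform a \<tau> h r) \<le> (\<Sum>k. inverse (fact k) * cmod (E k))"
    unfolding H by (rule order_trans[OF summable_norm[OF sN] suminf_le[OF n sN sE]])
  then have "ennreal (cmod (dual_transform a \<tau> h r)) \<le> (\<Sum>k. ennreal (inverse (fact k) * cmod (E k)))"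
    using sE by (subst suminf_ennreal2) (auto intro: ennreal_leI)
  then have "ennreal (cmod (dual_transform a \<tau> h r)) ^ 2 \<le> (\<Sum>k. ennreal (inverse (fact k) * cmod (E k))) ^ 2"
    by (intro power_mono) auto
  also have "\<dots> \<le> (\<Sum>k. ennreal (inverse (fact k))) * (\<Sum>k. ennreal (inverse (fact k) * (cmod (E k))\<^sup>2))"
    by (rule suminf_cauchy_schwarz) auto
  also have "(\<Sum>k. ennreal (inverse (fact k))) = ennreal (exp 1)"
    using summable_exp[of "1::real"] by (subst suminf_ennreal2) (auto simp: exp_def)
  finally show ?thesis by (simp add: E_def ennreal_power)
qed

text \<open>The transforms in the series have \<open>\<tau> = 0\<close>, so a modulation moves the frequency interval \<open>{0..1}\<close> to
\<open>{1..2}\<close>, where the dyadic estimate with \<open>N = 1\<close> serves as a substitute for Plancherel's theorem.\<close>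

lemma dual_transform_low:
  fixes a :: real
  assumes a: "a > 0" "a \<noteq> 1"
  shows "\<exists>C>0. \<forall>\<tau> h. \<tau> \<in> borel_measurable borel \<longrightarrow> (\<forall>\<rho>. \<bar>\<tau> \<rho>\<bar> \<le> 1) \<longrightarrow> integrable lborel h \<longrightarrow>
     (\<integral>\<^sup>+ r. ennreal ((cmod (dual_transform a \<tau> h r))\<^sup>2) * indicator {0..1} r \<partial>lborel)
       \<le> ennreal C * sq_mass h"
proof -
  obtain C where C: "C > 0" and dy0: "\<And>N \<tau> h. N \<ge> 1 \<Longrightarrow> \<tau> \<in> borel_measurable borel \<Longrightarrow> (\<And>\<rho>. \<bar>\<tau> \<rho>\<bar> \<le> 1) \<Longrightarrow> integrable lborel h \<Longrightarrow>
     (\<integral>\<^sup>+ r. ennreal ((cmod (dual_transform a \<tau> h r))\<^sup>2) * indicator {N..2*N} r \<partial>lborel)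
       \<le> ennreal (C * N powr (a/2)) * sq_mass h"
    using dual_transform_dyadic[OF a] by blast
  have dy: "(\<integral>\<^sup>+ r. ennreal ((cmod (dual_transform a (\<lambda>_. 0) h r))\<^sup>2) * indicator {1..2} r \<partial>lborel)
       \<le> ennreal C * sq_mass h" if "integrable lborel h" for h
    using dy0[of 1 "\<lambda>_. 0" h] that by simp
  have shift: "(\<integral>\<^sup>+ r. ennreal ((cmod (dual_transform a (\<lambda>_. 0) h r))\<^sup>2) * indicator {0..1} r \<partial>lborel)
     \<le> ennreal C * sq_mass h" if h: "integrable lborel h" for h
  proof -
    note [measurable] = borel_measurable_integrable[OF h]
    let ?h = "\<lambda>\<rho>. cis \<rho> * h \<rho>"
    have hi: "integrable lborel ?h"
      by (rule Bochner_Integration.integrable_bound[OF h]) (auto simp: norm_mult)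
    note [measurable] = borel_measurable_integrable[OF hi]
    have e: "dual_transform a (\<lambda>_. 0) ?h (1 + 1 * r) = dual_transform a (\<lambda>_. 0) h r" for r
      unfolding dual_transform_def
      by (intro Bochner_Integration.integral_cong) (auto simp: cis_mult algebra_simps simp flip: mult.assoc)
    have "(\<integral>\<^sup>+ r. ennreal ((cmod (dual_transform a (\<lambda>_. 0) ?h r))\<^sup>2) * indicator {1..2} r \<partial>lborel) =
       (\<integral>\<^sup>+ r. ennreal ((cmod (dual_transform a (\<lambda>_. 0) ?h (1 + 1 * r)))\<^sup>2) * indicator {1..2} (1 + 1 * r) \<partial>lborel)"
      using nn_integral_real_affine[of "\<lambda>r. ennreal ((cmod (dual_transform a (\<lambda>_. 0) ?h r))\<^sup>2) * indicator {1..2} r" 1 1] by simp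
    also have "\<dots> = (\<integral>\<^sup>+ r. ennreal ((cmod (dual_transform a (\<lambda>_. 0) h r))\<^sup>2) * indicator {0..1} r \<partial>lborel)"
      unfolding e by (intro nn_integral_cong) (auto simp: indicator_def)
    finally show ?thesis using dy[of ?h] hi by (simp add: norm_mult)
  qed
  have main: "(\<integral>\<^sup>+ r. ennreal ((cmod (dual_transform a \<tau> h r))\<^sup>2) * indicator {0..1} r \<partial>lborel)
       \<le> ennreal (exp 1 * (exp 1 * C)) * sq_mass h"
    if [measurable]: "\<tau> \<in> borel_measurable borel" and \<tau>: "\<And>\<rho>. \<bar>\<tau> \<rho>\<bar> \<le> 1" and h: "integrable lborel h" for \<tau> h
  proof -
    note [measurable] = borel_measurable_integrable[OF h]
    define hk where "hk k \<rho> = of_real (\<tau> \<rho> ^ k) * h \<rho>" for k \<rho>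
    have [measurable]: "hk k \<in> borel_measurable borel" for k unfolding hk_def[abs_def] by measurable
    have tk: "\<bar>\<tau> \<rho>\<bar> ^ k \<le> 1" for \<rho> k by (rule power_le_one) (use \<tau> in auto)
    have hkb: "cmod (hk k \<rho>) \<le> cmod (h \<rho>)" for k \<rho>
      using mult_right_mono[OF tk[of \<rho> k], of "cmod (h \<rho>)"] by (simp add: hk_def norm_mult norm_power power_abs)
    have hki: "integrable lborel (hk k)" for k
      by (rule Bochner_Integration.integrable_bound[OF h]) (use hkb in auto)
    let ?E = "\<lambda>k r. dual_transform a (\<lambda>_. 0) (hk k) r"
    let ?h2 = "sq_mass h"
    have "(\<integral>\<^sup>+ r. ennreal ((cmod (dual_transform a \<tau> h r))\<^sup>2) * indicator {0..1} r \<partial>lborel) \<le>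
       (\<integral>\<^sup>+ r. ennreal (exp 1) * (\<Sum>k. ennreal (inverse (fact k)) * (ennreal ((cmod (?E k r))\<^sup>2) * indicator {0..1} r)) \<partial>lborel)"
    proof (rule nn_integral_mono)
      fix r
      show "ennreal ((cmod (dual_transform a \<tau> h r))\<^sup>2) * indicator {0..1} r \<le>
        ennreal (exp 1) * (\<Sum>k. ennreal (inverse (fact k)) * (ennreal ((cmod (?E k r))\<^sup>2) * indicator {0..1} r))"
        using dual_transform_series[OF that(1) \<tau> h, of r a] a
        by (cases "r \<in> {0..1}") (auto simp: hk_def[abs_def] ennreal_mult)
    qed
    also have "\<dots> = ennreal (exp 1) * (\<Sum>k. ennreal (inverse (fact k)) * (\<integral>\<^sup>+ r. ennreal ((cmod (?E k r))\<^sup>2) * indicator {0..1} r \<partial>lborel))"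
      by (simp add: nn_integral_cmult nn_integral_suminf)
    also have "\<dots> \<le> ennreal (exp 1) * (\<Sum>k. ennreal (inverse (fact k)) * (ennreal C * ?h2))"
    proof (intro mult_left_mono suminf_le summableI)
      fix k
      have e: "sq_mass (hk k) \<le> ?h2"
        by (intro nn_integral_mono ennreal_leI power_mono hkb) auto
      show "(\<integral>\<^sup>+ r. ennreal ((cmod (?E k r))\<^sup>2) * indicator {0..1} r \<partial>lborel) \<le> ennreal C * ?h2"
        by (rule order_trans[OF shift[OF hki] mult_left_mono[OF e]]) simp
    qed auto
    also have "(\<Sum>k. ennreal (inverse (fact k)) * (ennreal C * ?h2)) = (\<Sum>k. ennreal (inverse (fact k))) * (ennreal C * ?h2)"
      by (rule ennreal_suminf_multc)
    also have "(\<Sum>k. ennreal (inverse (fact k))) = ennreal (exp 1)"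
      using summable_exp[of "1::real"] by (subst suminf_ennreal2) (auto simp: exp_def)
    also have "ennreal (exp 1) * (ennreal (exp 1) * (ennreal C * ?h2)) = ennreal (exp 1 * (exp 1 * C)) * ?h2"
      using C by (simp add: ennreal_mult mult.assoc)
    finally show ?thesis .
  qed
  have "exp 1 * (exp 1 * C) > 0" using C by simp
  then show ?thesis using main by blast
qed

lemma dyadic_cover:
  fixes r :: real
  assumes "r \<ge> 1" shows "\<exists>j::nat. r \<in> {2 ^ j..2 * 2 ^ j}"
proof -
  obtain k where k: "r < 2 ^ k" using real_arch_pow[of 2 r] by auto
  define m where "m = (LEAST k. r < 2 ^ k)"
  have m: "r < 2 ^ m" "\<And>j. j < m \<Longrightarrow> 2 ^ j \<le> r"
    unfolding m_def using LeastI[of "\<lambda>k. r < 2 ^ k", OF k] not_less_Least[of _ "\<lambda>k. r < 2 ^ k"] by (auto simp: not_less)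
  have "m \<noteq> 0" using m(1) assms by (auto intro: ccontr)
  then obtain j where "m = Suc j" by (cases m) auto
  then show ?thesis using m(1) m(2)[of j] by (intro exI[of _ j]) auto
qed

text \<open>On \<open>{2 ^ j..2 * 2 ^ j}\<close> the weight is at most \<open>(2 ^ j) powr (- 2 * s)\<close>, against a squared
norm of order \<open>(2 ^ j) powr (a / 2)\<close>; the ratio \<open>q\<close> of the resulting geometric series is less than 1.\<close>

theorem dual_transform_weighted:
  fixes a s :: real
  assumes a: "a > 0" "a \<noteq> 1" and s: "s > a / 4"
  shows "\<exists>C>0. \<forall>\<tau> h. \<tau> \<in> borel_measurable borel \<longrightarrow> (\<forall>\<rho>. \<bar>\<tau> \<rho>\<bar> \<le> 1) \<longrightarrow> integrable lborel h \<longrightarrow>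
     (\<integral>\<^sup>+ r. ennreal ((1 + r\<^sup>2) powr (-s) * (cmod (dual_transform a \<tau> h r))\<^sup>2) * indicator {0..} r \<partial>lborel)
       \<le> ennreal C * sq_mass h"
proof -
  obtain C1 where C1: "C1 > 0" and low: "\<And>\<tau> h. \<tau> \<in> borel_measurable borel \<Longrightarrow> (\<And>\<rho>. \<bar>\<tau> \<rho>\<bar> \<le> 1) \<Longrightarrow> integrable lborel h \<Longrightarrow>
     (\<integral>\<^sup>+ r. ennreal ((cmod (dual_transform a \<tau> h r))\<^sup>2) * indicator {0..1} r \<partial>lborel)
       \<le> ennreal C1 * sq_mass h"
    using dual_transform_low[OF a] by blast
  obtain C2 where C2: "C2 > 0" and dy: "\<And>N \<tau> h. N \<ge> 1 \<Longrightarrow> \<tau> \<in> borel_measurable borel \<Longrightarrow> (\<And>\<rho>. \<bar>\<tau> \<rho>\<bar> \<le> 1) \<Longrightarrow> integrable lborel h \<Longrightarrow>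
     (\<integral>\<^sup>+ r. ennreal ((cmod (dual_transform a \<tau> h r))\<^sup>2) * indicator {N..2*N} r \<partial>lborel)
       \<le> ennreal (C2 * N powr (a/2)) * sq_mass h"
    using dual_transform_dyadic[OF a] by blast
  have s0: "s > 0" using s a by simp
  define q :: real where "q = 2 powr (a/2 - 2 * s)"
  have q: "0 < q" "q < 1" using s by (auto simp: q_def powr_less_one)
  have main: "(\<integral>\<^sup>+ r. ennreal ((1 + r\<^sup>2) powr (-s) * (cmod (dual_transform a \<tau> h r))\<^sup>2) * indicator {0..} r \<partial>lborel)
       \<le> ennreal (C1 + C2 * (1 / (1 - q))) * sq_mass h"
    if [measurable]: "\<tau> \<in> borel_measurable borel" and \<tau>: "\<And>\<rho>. \<bar>\<tau> \<rho>\<bar> \<le> 1" and h: "integrable lborel h" for \<tau> h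
  proof -
    note [measurable] = borel_measurable_integrable[OF h]
    let ?H = "\<lambda>r. ennreal ((cmod (dual_transform a \<tau> h r))\<^sup>2)"
    let ?h2 = "sq_mass h"
    have pt: "ennreal ((1 + r\<^sup>2) powr (-s) * (cmod (dual_transform a \<tau> h r))\<^sup>2) * indicator {0..} r \<le>
       ?H r * indicator {0..1} r + (\<Sum>j. ennreal ((2 ^ j) powr (-2 * s)) * (?H r * indicator {2 ^ j..2 * 2 ^ j} r))" for r
    proof (cases "r \<ge> 1")
      case True
      then obtain j :: nat where j: "r \<in> {2 ^ j..2 * 2 ^ j}" using dyadic_cover by blast
      have "(1 + r\<^sup>2) powr (-s) \<le> ((2 ^ j)\<^sup>2) powr (-s)"
      proof (rule powr_mono2')
        have "(2 ^ j)\<^sup>2 \<le> r\<^sup>2" using j by (intro power_mono) auto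
        then show "(2 ^ j)\<^sup>2 \<le> 1 + r\<^sup>2" by simp
      qed (use s0 in auto)
      also have "((2 ^ j)\<^sup>2) powr (-s) = (2 ^ j :: real) powr (-2 * s)"
        by (simp add: powr_powr mult_ac flip: powr_realpow powr_numeral)
      finally have "ennreal ((1 + r\<^sup>2) powr (-s) * (cmod (dual_transform a \<tau> h r))\<^sup>2) \<le>
          ennreal ((2 ^ j) powr (-2 * s) * (cmod (dual_transform a \<tau> h r))\<^sup>2)"
        by (intro ennreal_leI mult_right_mono) auto
      also have "\<dots> = ennreal ((2 ^ j) powr (-2 * s)) * (?H r * indicator {2 ^ j..2 * 2 ^ j} r)"
        using j by (simp add: ennreal_mult)
      also have "\<dots> \<le> (\<Sum>j. ennreal ((2 ^ j) powr (-2 * s)) * (?H r * indicator {2 ^ j..2 * 2 ^ j} r))"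
        using sum_le_suminf[of "\<lambda>j. ennreal ((2 ^ j) powr (-2 * s)) * (?H r * indicator {2 ^ j..2 * 2 ^ j} r)" "{j}"] by simp
      finally show ?thesis using True by (simp add: add_increasing)
    next
      case False
      have "(1 + r\<^sup>2) powr (-s) \<le> 1 powr (-s)" using s0 by (intro powr_mono2') auto
      then have "(1 + r\<^sup>2) powr (-s) * (cmod (dual_transform a \<tau> h r))\<^sup>2 \<le> 1 * (cmod (dual_transform a \<tau> h r))\<^sup>2"
        by (intro mult_right_mono) auto
      then have "ennreal ((1 + r\<^sup>2) powr (-s) * (cmod (dual_transform a \<tau> h r))\<^sup>2) \<le> ?H r"
        by (intro ennreal_leI) simp
      then show ?thesis using False
        by (intro add_increasing2) (auto simp: indicator_def)
    qed
    have "(\<integral>\<^sup>+ r. ennreal ((1 + r\<^sup>2) powr (-s) * (cmod (dual_transform a \<tau> h r))\<^sup>2) * indicator {0..} r \<partial>lborel) \<le>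
       (\<integral>\<^sup>+ r. ?H r * indicator {0..1} r + (\<Sum>j. ennreal ((2 ^ j) powr (-2 * s)) * (?H r * indicator {2 ^ j..2 * 2 ^ j} r)) \<partial>lborel)"
      by (rule nn_integral_mono) (rule pt)
    also have "\<dots> = (\<integral>\<^sup>+ r. ?H r * indicator {0..1} r \<partial>lborel) +
        (\<Sum>j. ennreal ((2 ^ j) powr (-2 * s)) * (\<integral>\<^sup>+ r. ?H r * indicator {2 ^ j..2 * 2 ^ j} r \<partial>lborel))"
      by (simp add: nn_integral_add nn_integral_suminf nn_integral_cmult)
    also have "\<dots> \<le> ennreal C1 * ?h2 + (\<Sum>j. ennreal (C2 * q ^ j) * ?h2)"
    proof (intro add_mono low[OF that] suminf_le summableI)
      fix j :: nat
      have "ennreal ((2 ^ j) powr (-2 * s)) * (\<integral>\<^sup>+ r. ?H r * indicator {2 ^ j..2 * 2 ^ j} r \<partial>lborel) \<le>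
        ennreal ((2 ^ j) powr (-2 * s)) * (ennreal (C2 * (2 ^ j) powr (a/2)) * ?h2)"
        by (intro mult_left_mono dy[OF _ that]) auto
      also have "\<dots> = ennreal ((2 ^ j) powr (-2 * s) * (C2 * (2 ^ j) powr (a/2))) * ?h2"
        using C2 by (simp add: ennreal_mult mult.assoc)
      also have "(2 ^ j) powr (-2 * s) * (C2 * (2 ^ j) powr (a/2)) = C2 * ((2 ^ j) powr (-2 * s) * (2 ^ j) powr (a/2))"
        by simp
      also have "(2 ^ j :: real) powr (-2 * s) * (2 ^ j) powr (a/2) = (2 ^ j) powr (a/2 - 2 * s)"
        by (simp add: powr_add[symmetric])
      also have "\<dots> = q ^ j"
        unfolding q_def by (simp add: powr_powr mult.commute flip: powr_realpow)
      finally show "ennreal ((2 ^ j) powr (-2 * s)) * (\<integral>\<^sup>+ r. ?H r * indicator {2 ^ j..2 * 2 ^ j} r \<partial>lborel) \<le> ennreal (C2 * q ^ j) * ?h2" .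
    qed
    also have "(\<Sum>j. ennreal (C2 * q ^ j) * ?h2) = (\<Sum>j. ennreal (C2 * q ^ j)) * ?h2"
      by (rule ennreal_suminf_multc)
    also have "(\<Sum>j. ennreal (C2 * q ^ j)) = ennreal (C2 * (1 / (1 - q)))"
      using C2 q by (subst suminf_ennreal2) (auto simp: suminf_mult suminf_geometric intro!: summable_mult summable_geometric)
    also have "ennreal C1 * ?h2 + ennreal (C2 * (1 / (1 - q))) * ?h2 = ennreal (C1 + C2 * (1 / (1 - q))) * ?h2"
      using C1 C2 q by (simp add: ennreal_plus distrib_right)
    finally show ?thesis .
  qed
  have "C1 + C2 * (1 / (1 - q)) > 0" using C1 C2 q by (intro add_pos_pos mult_pos_pos) auto
  then show ?thesis using main by blast
qed

section \<open>The maximal function on the line\<close>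

text \<open>The one-dimensional solution at position \<open>\<rho>\<close> and time \<open>t\<close>, for data with Fourier transform \<open>g\<close>. In
the application \<open>g\<close> is the radial profile of a function on \<open>\<real>\<^sup>n\<close> and vanishes on the negative axis.\<close>

definition osc_transform :: "real \<Rightarrow> real \<Rightarrow> (real \<Rightarrow> complex) \<Rightarrow> real \<Rightarrow> complex" where
  "osc_transform a t g \<rho> = (LINT r|lborel. cis (r * \<rho> + t * r powr a) * g r)"

lemma osc_transform_measurable [measurable]:
  assumes [measurable]: "\<tau> \<in> borel_measurable borel" "g \<in> borel_measurable borel"
  shows "(\<lambda>\<rho>. osc_transform a (\<tau> \<rho>) g \<rho>) \<in> borel_measurable borel"
  unfolding osc_transform_def[abs_def] by measurable

lemma osc_transform_bounded: "cmod (osc_transform a t g \<rho>) \<le> (LINT r|lborel. cmod (g r))"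
  unfolding osc_transform_def
  by (rule order_trans[OF integral_norm_bound]) (simp add: norm_mult)

lemma nn_integral_le_if_truncations_le:
  fixes f :: "real \<Rightarrow> ennreal"
  assumes [measurable]: "f \<in> borel_measurable borel"
    and le: "\<And>n::nat. (\<integral>\<^sup>+ x. f x * indicator {- real n..real n} x \<partial>lborel) \<le> B"
  shows "(\<integral>\<^sup>+ x. f x \<partial>lborel) \<le> B"
proof -
  have "f x = (SUP n::nat. f x * indicator {- real n..real n} x)" for x
  proof (rule antisym)
    obtain n :: nat where "\<bar>x\<bar> \<le> real n" using real_arch_simple by blast
    then have "x \<in> {- real n..real n}" by auto
    then have "f x = f x * indicator {- real n..real n} x" by simp
    also have "\<dots> \<le> (SUP n::nat. f x * indicator {- real n..real n} x)" by (rule SUP_upper) simp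
    finally show "f x \<le> \<dots>" .
  qed (auto intro!: SUP_least simp: indicator_def)
  then have "(\<integral>\<^sup>+ x. f x \<partial>lborel) = (\<integral>\<^sup>+ x. (SUP n::nat. f x * indicator {- real n..real n} x) \<partial>lborel)" by simp
  also have "\<dots> = (SUP n::nat. \<integral>\<^sup>+ x. f x * indicator {- real n..real n} x \<partial>lborel)"
    by (rule nn_integral_monotone_convergence_SUP)
       (auto simp: incseq_def le_fun_def indicator_def)
  also have "\<dots> \<le> B" by (intro SUP_least le)
  finally show ?thesis .
qed

lemma ennreal_le_if_square_le:
  fixes X Y :: ennreal
  assumes "X < top" "X\<^sup>2 \<le> Y * X"
  shows "X \<le> Y"
proof (cases "X = 0")
  case False
  have "X * X \<le> X * Y" using assms by (simp add: power2_eq_square mult.commute)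
  then show ?thesis using False assms by (simp add: ennreal_mult_le_mult_iff)
qed simp

text \<open>Duality: on a bounded interval, test the operator against its own output \<open>h\<close>. This gives
\<open>\<parallel>h\<parallel>\<^sup>2 = \<langle>g, H\<rangle>\<close> with \<open>H\<close> the dual transform of \<open>h\<close>, and Cauchy-Schwarz with the weight
\<open>(1 + r\<^sup>2) powr s\<close> bounds the right side by a multiple of \<open>\<parallel>h\<parallel>\<close>. The truncation makes \<open>\<parallel>h\<parallel>\<close> finite, so
that it can be cancelled.\<close>

theorem linearized_maximal_bound:
  fixes a s :: real
  assumes a: "a > 0" "a \<noteq> 1" and s: "s > a / 4"
  shows "\<exists>C>0. \<forall>\<tau> g. \<tau> \<in> borel_measurable borel \<longrightarrow> (\<forall>\<rho>. \<bar>\<tau> \<rho>\<bar> \<le> 1) \<longrightarrow> integrable lborel g \<longrightarrow> (\<forall>r<0. g r = 0) \<longrightarrow>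
     (\<integral>\<^sup>+ \<rho>. ennreal ((cmod (osc_transform a (\<tau> \<rho>) g \<rho>))\<^sup>2) \<partial>lborel)
       \<le> ennreal C * sobolev_mass s g"
proof -
  obtain C where C: "C > 0" and dw: "\<And>\<tau> h. \<tau> \<in> borel_measurable borel \<Longrightarrow> (\<And>\<rho>. \<bar>\<tau> \<rho>\<bar> \<le> 1) \<Longrightarrow> integrable lborel h \<Longrightarrow>
     (\<integral>\<^sup>+ r. ennreal ((1 + r\<^sup>2) powr (-s) * (cmod (dual_transform a \<tau> h r))\<^sup>2) * indicator {0..} r \<partial>lborel)
       \<le> ennreal C * sq_mass h"
    using dual_transform_weighted[OF a s] by blast
  have main: "(\<integral>\<^sup>+ \<rho>. ennreal ((cmod (osc_transform a (\<tau> \<rho>) g \<rho>))\<^sup>2) \<partial>lborel)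
       \<le> ennreal C * sobolev_mass s g"
    if [measurable]: "\<tau> \<in> borel_measurable borel" and \<tau>: "\<And>\<rho>. \<bar>\<tau> \<rho>\<bar> \<le> 1" and g: "integrable lborel g" and g0: "\<And>r. r < 0 \<Longrightarrow> g r = 0"
    for \<tau> g
  proof (rule nn_integral_le_if_truncations_le)
    note [measurable] = borel_measurable_integrable[OF g]
    show "(\<lambda>\<rho>. ennreal ((cmod (osc_transform a (\<tau> \<rho>) g \<rho>))\<^sup>2)) \<in> borel_measurable borel" by measurable
    fix n :: nat
    define u where "u \<rho> = osc_transform a (\<tau> \<rho>) g \<rho>" for \<rho>
    have [measurable]: "u \<in> borel_measurable borel" unfolding u_def[abs_def] by measurable
    define M where "M = (LINT r|lborel. cmod (g r))"
    have ub: "cmod (u \<rho>) \<le> M" for \<rho> unfolding u_def M_def by (rule osc_transform_bounded)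
    have M0: "M \<ge> 0" by (simp add: M_def)
    define I where "I = {- real n..real n}"
    have [measurable]: "I \<in> sets borel" by (simp add: I_def)
    define h where "h \<rho> = indicator I \<rho> *\<^sub>R u \<rho>" for \<rho>
    have [measurable]: "h \<in> borel_measurable borel" unfolding h_def[abs_def] by measurable
    have Ii: "integrable lborel (indicator I :: real \<Rightarrow> real)" by (simp add: I_def)
    have hi: "integrable lborel h"
      by (rule Bochner_Integration.integrable_bound[OF integrable_mult_right[OF Ii, of M]])
         (use ub M0 in \<open>auto simp: h_def indicator_def\<close>)
    have h2i: "integrable lborel (\<lambda>\<rho>. (cmod (h \<rho>))\<^sup>2)"
      by (rule Bochner_Integration.integrable_bound[OF integrable_mult_right[OF Ii, of "M\<^sup>2"]])
         (use ub M0 in \<open>auto simp: h_def indicator_def intro!: power_mono\<close>)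
    define X where "X = sq_mass h"
    have Xe: "X = ennreal (LINT \<rho>|lborel. (cmod (h \<rho>))\<^sup>2)"
      unfolding X_def by (rule nn_integral_eq_integral[OF h2i]) auto
    define G where "G = sobolev_mass s g"
    let ?H = "dual_transform a \<tau> h"
    have "complex_of_real (LINT \<rho>|lborel. (cmod (h \<rho>))\<^sup>2) = (LINT \<rho>|lborel. of_real ((cmod (h \<rho>))\<^sup>2))"
      by (rule integral_complex_of_real[symmetric])
    also have "\<dots> = (LINT \<rho>|lborel. LINT r|lborel. h \<rho> * cnj (cis (r * \<rho> + \<tau> \<rho> * r powr a) * g r))"
    proof (rule Bochner_Integration.integral_cong[OF refl])
      fix \<rho>
      have "complex_of_real ((cmod (h \<rho>))\<^sup>2) = h \<rho> * cnj (u \<rho>)"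
        unfolding complex_norm_square by (simp add: h_def indicator_def)
      also have "\<dots> = (LINT r|lborel. h \<rho> * cnj (cis (r * \<rho> + \<tau> \<rho> * r powr a) * g r))"
        unfolding u_def osc_transform_def by (simp only: integral_mult_right_zero Bochner_Integration.integral_cnj)
      finally show "complex_of_real ((cmod (h \<rho>))\<^sup>2) = (LINT r|lborel. h \<rho> * cnj (cis (r * \<rho> + \<tau> \<rho> * r powr a) * g r))" .
    qed
    also have "\<dots> = (LINT r|lborel. LINT \<rho>|lborel. h \<rho> * cnj (cis (r * \<rho> + \<tau> \<rho> * r powr a) * g r))"
      by (rule Fubini_lborel_bounded[where A = "\<lambda>\<rho>. cmod (h \<rho>)" and B = "\<lambda>r. cmod (g r)"])
         (use hi g in \<open>auto simp: norm_mult\<close>)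
    also have "\<dots> = (LINT r|lborel. cnj (g r) * ?H r)"
    proof (rule Bochner_Integration.integral_cong[OF refl])
      fix r
      have "h \<rho> * cnj (cis (r * \<rho> + \<tau> \<rho> * r powr a) * g r) = cnj (g r) * (cis (- (r * \<rho> + \<tau> \<rho> * r powr a)) * h \<rho>)" for \<rho>
        by (simp only: complex_cnj_mult cis_cnj mult_ac)
      then show "(LINT \<rho>|lborel. h \<rho> * cnj (cis (r * \<rho> + \<tau> \<rho> * r powr a) * g r)) = cnj (g r) * ?H r"
        unfolding dual_transform_def by (simp only: integral_mult_right_zero)
    qed
    finally have eq: "complex_of_real (LINT \<rho>|lborel. (cmod (h \<rho>))\<^sup>2) = (LINT r|lborel. cnj (g r) * ?H r)" .
    have "X = ennreal (cmod (complex_of_real (LINT \<rho>|lborel. (cmod (h \<rho>))\<^sup>2)))"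
      unfolding Xe norm_of_real by (simp add: integral_nonneg_AE)
    also have "\<dots> \<le> (\<integral>\<^sup>+ r. ennreal (cmod (cnj (g r) * ?H r)) \<partial>lborel)"
      unfolding eq by (rule norm_integral_le_nn_integral)
    also have "\<dots> = (\<integral>\<^sup>+ r. ennreal ((1 + r\<^sup>2) powr (s/2) * cmod (g r)) * (ennreal ((1 + r\<^sup>2) powr (-s/2) * cmod (?H r)) * indicator {0..} r) \<partial>lborel)"
    proof (intro nn_integral_cong)
      fix r :: real
      have "0 < 1 + r\<^sup>2" by (simp add: add_pos_nonneg)
      then have "(1 + r\<^sup>2) powr (s/2) * (1 + r\<^sup>2) powr (-s/2) = 1" by (simp flip: powr_add)
      then have "cmod (g r) * cmod (?H r) = ((1 + r\<^sup>2) powr (s/2) * (1 + r\<^sup>2) powr (-s/2)) * (cmod (g r) * cmod (?H r))" by simp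
      also have "\<dots> = ((1 + r\<^sup>2) powr (s/2) * cmod (g r)) * ((1 + r\<^sup>2) powr (-s/2) * cmod (?H r))" by (simp only: mult_ac)
      finally have e: "cmod (g r) * cmod (?H r) = ((1 + r\<^sup>2) powr (s/2) * cmod (g r)) * ((1 + r\<^sup>2) powr (-s/2) * cmod (?H r))" .
      show "ennreal (cmod (cnj (g r) * ?H r)) = ennreal ((1 + r\<^sup>2) powr (s/2) * cmod (g r)) * (ennreal ((1 + r\<^sup>2) powr (-s/2) * cmod (?H r)) * indicator {0..} r)"
      proof (cases "r < 0")
        case True
        then show ?thesis by (simp add: g0)
      next
        case False
        have "ennreal (cmod (cnj (g r) * ?H r)) = ennreal (((1 + r\<^sup>2) powr (s/2) * cmod (g r)) * ((1 + r\<^sup>2) powr (-s/2) * cmod (?H r)))"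
          unfolding norm_mult complex_mod_cnj e ..
        also have "\<dots> = ennreal ((1 + r\<^sup>2) powr (s/2) * cmod (g r)) * ennreal ((1 + r\<^sup>2) powr (-s/2) * cmod (?H r))"
          by (rule ennreal_mult) auto
        finally show ?thesis using False by simp
      qed
    qed
    finally have X1: "X \<le> (\<integral>\<^sup>+ r. ennreal ((1 + r\<^sup>2) powr (s/2) * cmod (g r)) * (ennreal ((1 + r\<^sup>2) powr (-s/2) * cmod (?H r)) * indicator {0..} r) \<partial>lborel)" .
    have "X\<^sup>2 \<le> (\<integral>\<^sup>+ r. ennreal ((1 + r\<^sup>2) powr (s/2) * cmod (g r)) * (ennreal ((1 + r\<^sup>2) powr (-s/2) * cmod (?H r)) * indicator {0..} r) \<partial>lborel)\<^sup>2"
      by (rule power_mono[OF X1]) simp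
    also have "\<dots> \<le> (\<integral>\<^sup>+ r. (ennreal ((1 + r\<^sup>2) powr (s/2) * cmod (g r)))\<^sup>2 \<partial>lborel) * (\<integral>\<^sup>+ r. (ennreal ((1 + r\<^sup>2) powr (-s/2) * cmod (?H r)) * indicator {0..} r)\<^sup>2 \<partial>lborel)"
      by (rule Cauchy_Schwarz_nn_integral) measurable
    also have "(\<integral>\<^sup>+ r. (ennreal ((1 + r\<^sup>2) powr (s/2) * cmod (g r)))\<^sup>2 \<partial>lborel) = G"
      unfolding G_def
    proof (intro nn_integral_cong)
      fix r :: real
      have "((1 + r\<^sup>2) powr (s/2))\<^sup>2 = (1 + r\<^sup>2) powr s"
        by (simp add: power2_eq_square flip: powr_add)
      then show "(ennreal ((1 + r\<^sup>2) powr (s/2) * cmod (g r)))\<^sup>2 = ennreal ((1 + r\<^sup>2) powr s * (cmod (g r))\<^sup>2)"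
        by (simp add: ennreal_power power_mult_distrib)
    qed
    also have "(\<integral>\<^sup>+ r. (ennreal ((1 + r\<^sup>2) powr (-s/2) * cmod (?H r)) * indicator {0..} r)\<^sup>2 \<partial>lborel) =
        (\<integral>\<^sup>+ r. ennreal ((1 + r\<^sup>2) powr (-s) * (cmod (?H r))\<^sup>2) * indicator {0..} r \<partial>lborel)"
    proof (intro nn_integral_cong)
      fix r :: real
      have "((1 + r\<^sup>2) powr (-s/2))\<^sup>2 = (1 + r\<^sup>2) powr (-s)"
        by (simp add: power2_eq_square flip: powr_add)
      then show "(ennreal ((1 + r\<^sup>2) powr (-s/2) * cmod (?H r)) * indicator {0..} r)\<^sup>2 = ennreal ((1 + r\<^sup>2) powr (-s) * (cmod (?H r))\<^sup>2) * indicator {0..} r"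
        by (simp add: ennreal_power power_mult_distrib indicator_def)
    qed
    also have "G * \<dots> \<le> G * (ennreal C * X)"
      unfolding X_def by (intro mult_left_mono dw[OF that(1) \<tau> hi]) auto
    finally have "X\<^sup>2 \<le> (ennreal C * G) * X" by (simp only: mult_ac)
    moreover have "X < top" by (simp add: Xe)
    ultimately have "X \<le> ennreal C * G" by (rule ennreal_le_if_square_le[rotated])
    moreover have "(\<integral>\<^sup>+ \<rho>. ennreal ((cmod (osc_transform a (\<tau> \<rho>) g \<rho>))\<^sup>2) * indicator {- real n..real n} \<rho> \<partial>lborel) = X"
      unfolding X_def h_def u_def I_def by (intro nn_integral_cong) (auto simp: indicator_def)
    ultimately show "(\<integral>\<^sup>+ \<rho>. ennreal ((cmod (osc_transform a (\<tau> \<rho>) g \<rho>))\<^sup>2) * indicator {- real n..real n} \<rho> \<partial>lborel) \<le> ennreal C * sobolev_mass s g"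
      by (simp only: G_def)
  qed
  show ?thesis using C main by blast
qed

lemma osc_transform_continuous:
  assumes g: "integrable lborel g" and x: "x \<longlonglongrightarrow> t"
  shows "(\<lambda>n. osc_transform a (x n) g \<rho>) \<longlonglongrightarrow> osc_transform a t g \<rho>"
proof -
  note [measurable] = borel_measurable_integrable[OF g]
  show ?thesis
    unfolding osc_transform_def
  proof (rule integral_dominated_convergence[where w = "\<lambda>r. cmod (g r)"])
    show "AE r in lborel. (\<lambda>n. cis (r * \<rho> + x n * r powr a) * g r) \<longlonglongrightarrow> cis (r * \<rho> + t * r powr a) * g r"
      unfolding cis_conv_exp by (intro AE_I2 tendsto_intros x)
  qed (use g in \<open>auto simp: norm_mult\<close>)
qed

lemma dense_times:
  obtains q :: "nat \<Rightarrow> real" where "\<And>j. \<bar>q j\<bar> < 1"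
    and "\<And>t. \<bar>t\<bar> < 1 \<Longrightarrow> \<exists>x. (\<forall>n. x n \<in> range q) \<and> x \<longlonglongrightarrow> t"
proof -
  obtain D :: "real set" where D: "countable D" "\<And>X. open X \<Longrightarrow> X \<noteq> {} \<Longrightarrow> \<exists>d\<in>D. d \<in> X"
    using countable_dense_exists by blast
  define E where "E = D \<inter> {-1<..<1}"
  have E: "countable E" "E \<noteq> {}" using D(1) D(2)[of "{-1<..<1}"] by (auto simp: E_def)
  define q where "q = from_nat_into E"
  have rq: "range q = E" unfolding q_def using E by (simp add: range_from_nat_into)
  have "\<exists>x. (\<forall>n. x n \<in> range q) \<and> x \<longlonglongrightarrow> t" if t: "\<bar>t\<bar> < 1" for t
  proof -
    have "t \<in> closure E"
      unfolding closure_iff_nhds_not_empty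
    proof (intro allI impI)
      fix A S :: "real set" assume S: "S \<subseteq> A" "open S" "t \<in> S"
      have "t \<in> S \<inter> {-1<..<1}" using S t by auto
      then have "\<exists>d\<in>D. d \<in> S \<inter> {-1<..<1}" using S by (intro D(2)) auto
      then show "E \<inter> A \<noteq> {}" using S by (auto simp: E_def)
    qed
    then show ?thesis unfolding rq closure_sequential by simp
  qed
  moreover have "\<bar>q j\<bar> < 1" for j
    using rq by (auto simp: E_def abs_less_iff dest: eqset_imp_iff[of _ _ "q j"])
  ultimately show ?thesis using that by blast
qed

text \<open>By continuity in \<open>t\<close> the supremum runs over a countable dense set of times. For finitely many times a
maximising time can be chosen measurably in \<open>\<rho>\<close>, so the linearised bound applies; then let the finite
sets increase. The bound is stated with a measurable majorant \<open>W\<close> so that it can later be added to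
other terms under the integral.\<close>

theorem maximal_oscillatory_bound:
  fixes a s :: real
  assumes a: "a > 0" "a \<noteq> 1" and s: "s > a / 4"
  shows "\<exists>C>0. \<forall>g. integrable lborel g \<longrightarrow> (\<forall>r<0. g r = 0) \<longrightarrow>
     (\<exists>W \<in> borel_measurable borel.
        (\<forall>\<rho> t. \<bar>t\<bar> < 1 \<longrightarrow> ennreal ((cmod (osc_transform a t g \<rho>))\<^sup>2) \<le> W \<rho>) \<and>
        (\<integral>\<^sup>+ \<rho>. W \<rho> \<partial>lborel) \<le> ennreal C * sobolev_mass s g)"
proof -
  obtain C where C: "C > 0" and lin: "\<And>\<tau> g. \<tau> \<in> borel_measurable borel \<Longrightarrow> (\<And>\<rho>. \<bar>\<tau> \<rho>\<bar> \<le> 1) \<Longrightarrow> integrable lborel g \<Longrightarrow> (\<And>r. r < 0 \<Longrightarrow> g r = 0) \<Longrightarrow>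
     (\<integral>\<^sup>+ \<rho>. ennreal ((cmod (osc_transform a (\<tau> \<rho>) g \<rho>))\<^sup>2) \<partial>lborel)
       \<le> ennreal C * sobolev_mass s g"
    using linearized_maximal_bound[OF a s] by blast
  obtain q :: "nat \<Rightarrow> real" where q: "\<And>j. \<bar>q j\<bar> < 1"
    and qd: "\<And>t. \<bar>t\<bar> < 1 \<Longrightarrow> \<exists>x. (\<forall>n. x n \<in> range q) \<and> x \<longlonglongrightarrow> t"
    using dense_times by blast
  have main: "\<exists>W \<in> borel_measurable borel.
        (\<forall>\<rho> t. \<bar>t\<bar> < 1 \<longrightarrow> ennreal ((cmod (osc_transform a t g \<rho>))\<^sup>2) \<le> W \<rho>) \<and>
        (\<integral>\<^sup>+ \<rho>. W \<rho> \<partial>lborel) \<le> ennreal C * sobolev_mass s g"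
    if g: "integrable lborel g" and g0: "\<And>r. r < 0 \<Longrightarrow> g r = 0" for g
  proof -
    note [measurable] = borel_measurable_integrable[OF g]
    define U where "U t \<rho> = cmod (osc_transform a t g \<rho>)" for t \<rho>
    have U0: "U t \<rho> \<ge> 0" for t \<rho> by (simp add: U_def)
    have Um [measurable]: "(\<lambda>\<rho>. U (\<tau> \<rho>) \<rho>) \<in> borel_measurable borel" if [measurable]: "\<tau> \<in> borel_measurable borel" for \<tau>
      unfolding U_def by measurable
    \<comment> \<open>\<open>\<sigma> k \<rho>\<close> is a time among \<open>q 0, \<dots>, q k\<close> at which \<open>U\<close> is largest.\<close>
    define \<sigma> where "\<sigma> = rec_nat (\<lambda>_::real. q 0) (\<lambda>k \<tau> \<rho>. if U (\<tau> \<rho>) \<rho> < U (q (Suc k)) \<rho> then q (Suc k) else \<tau> \<rho>)"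
    have \<sigma>0: "\<sigma> 0 = (\<lambda>_. q 0)" and \<sigma>S: "\<sigma> (Suc k) = (\<lambda>\<rho>. if U (\<sigma> k \<rho>) \<rho> < U (q (Suc k)) \<rho> then q (Suc k) else \<sigma> k \<rho>)" for k
      by (simp_all only: \<sigma>_def nat.rec)
    have \<sigma>m [measurable]: "\<sigma> k \<in> borel_measurable borel" for k
    proof (induction k)
      case (Suc k)
      note [measurable] = Suc
      have [measurable]: "(\<lambda>\<rho>. U (\<sigma> k \<rho>) \<rho>) \<in> borel_measurable borel" by (rule Um) measurable
      have [measurable]: "(\<lambda>\<rho>. U (q (Suc k)) \<rho>) \<in> borel_measurable borel" by (rule Um) measurable
      show ?case unfolding \<sigma>S by measurable
    qed (simp add: \<sigma>0)
    have \<sigma>b: "\<bar>\<sigma> k \<rho>\<bar> \<le> 1" for k \<rho>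
      by (induction k) (auto simp: \<sigma>0 \<sigma>S less_imp_le[OF q])
    have step: "U (\<sigma> k \<rho>) \<rho> \<le> U (\<sigma> (Suc k) \<rho>) \<rho>" "U (q (Suc k)) \<rho> \<le> U (\<sigma> (Suc k) \<rho>) \<rho>" for k \<rho>
      by (auto simp: \<sigma>S)
    have mono: "U (\<sigma> k \<rho>) \<rho> \<le> U (\<sigma> l \<rho>) \<rho>" if "k \<le> l" for k l \<rho>
      using lift_Suc_mono_le[of "\<lambda>k. U (\<sigma> k \<rho>) \<rho>", OF step(1) that] .
    have qle: "U (q k) \<rho> \<le> U (\<sigma> k \<rho>) \<rho>" for k \<rho>
      using step(2) by (cases k) (auto simp: \<sigma>0)
    have sup: "ennreal ((U t \<rho>)\<^sup>2) \<le> (SUP k. ennreal ((U (\<sigma> k \<rho>) \<rho>)\<^sup>2))" if t: "\<bar>t\<bar> < 1" for t \<rho>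
    proof -
      from t obtain x where x: "\<And>n. x n \<in> range q" "x \<longlonglongrightarrow> t" using qd by blast
      have lim: "(\<lambda>n. ennreal ((U (x n) \<rho>)\<^sup>2)) \<longlonglongrightarrow> ennreal ((U t \<rho>)\<^sup>2)"
        unfolding U_def by (intro tendsto_ennrealI tendsto_intros osc_transform_continuous[OF g x(2)])
      have le: "ennreal ((U (x n) \<rho>)\<^sup>2) \<le> (SUP k. ennreal ((U (\<sigma> k \<rho>) \<rho>)\<^sup>2))" for n
      proof -
        obtain j where "x n = q j" using x(1)[of n] by blast
        then have "ennreal ((U (x n) \<rho>)\<^sup>2) \<le> ennreal ((U (\<sigma> j \<rho>) \<rho>)\<^sup>2)"
          using qle[of j \<rho>] U0 by (simp add: ennreal_leI power_mono)
        also have "\<dots> \<le> (SUP k. ennreal ((U (\<sigma> k \<rho>) \<rho>)\<^sup>2))" by (rule SUP_upper) simp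
        finally show ?thesis .
      qed
      show "ennreal ((U t \<rho>)\<^sup>2) \<le> (SUP k. ennreal ((U (\<sigma> k \<rho>) \<rho>)\<^sup>2))"
        by (rule LIMSEQ_le_const2[OF lim]) (intro exI[of _ 0] allI impI le)
    qed
    define W where "W \<rho> = (SUP k. ennreal ((U (\<sigma> k \<rho>) \<rho>)\<^sup>2))" for \<rho>
    have Wm: "W \<in> borel_measurable borel"
      unfolding W_def[abs_def]
    proof (rule borel_measurable_SUP)
      fix k
      have [measurable]: "(\<lambda>\<rho>. U (\<sigma> k \<rho>) \<rho>) \<in> borel_measurable borel" by (rule Um) measurable
      show "(\<lambda>\<rho>. ennreal ((U (\<sigma> k \<rho>) \<rho>)\<^sup>2)) \<in> borel_measurable borel" by measurable
    qed simp
    have "(\<integral>\<^sup>+ \<rho>. W \<rho> \<partial>lborel) = (SUP k. \<integral>\<^sup>+ \<rho>. ennreal ((U (\<sigma> k \<rho>) \<rho>)\<^sup>2) \<partial>lborel)"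
      unfolding W_def
    proof (rule nn_integral_monotone_convergence_SUP)
      show "incseq (\<lambda>k \<rho>. ennreal ((U (\<sigma> k \<rho>) \<rho>)\<^sup>2))"
        using mono U0 by (auto simp: incseq_def le_fun_def intro!: ennreal_leI power_mono)
      fix k
      have [measurable]: "(\<lambda>\<rho>. U (\<sigma> k \<rho>) \<rho>) \<in> borel_measurable borel" by (rule Um) measurable
      show "(\<lambda>\<rho>. ennreal ((U (\<sigma> k \<rho>) \<rho>)\<^sup>2)) \<in> borel_measurable lborel" by measurable
    qed
    also have "\<dots> \<le> ennreal C * sobolev_mass s g"
      unfolding U_def by (intro SUP_least lin \<sigma>m \<sigma>b g g0)
    finally have "(\<integral>\<^sup>+ \<rho>. W \<rho> \<partial>lborel) \<le> ennreal C * sobolev_mass s g" .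
    moreover have "\<forall>\<rho> t. \<bar>t\<bar> < 1 \<longrightarrow> ennreal ((cmod (osc_transform a t g \<rho>))\<^sup>2) \<le> W \<rho>"
      using sup unfolding U_def W_def by blast
    ultimately show ?thesis using Wm by (intro bexI[of _ W] conjI)
  qed
  show ?thesis using C main by blast
qed

section \<open>A Hardy type integral operator\<close>

text \<open>Under \<open>r = u / \<rho>\<close> the integral is \<open>\<rho> powr (- 1/2)\<close> times a constant, namely 2 from either side of
\<open>u = 1\<close>.\<close>

lemma hardy_kernel_moment:
  assumes \<rho>: "\<rho> > 0"
  shows "(\<integral>\<^sup>+ r. ennreal (min 1 (1 / (r * \<rho>)) * r powr (-1/2)) * indicator {0<..} r \<partial>lborel) \<le> ennreal (4 * \<rho> powr (-1/2))"
proof -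
  let ?c = "1 / \<rho>"
  have "(\<integral>\<^sup>+ r. ennreal (min 1 (1 / (r * \<rho>)) * r powr (-1/2)) * indicator {0<..} r \<partial>lborel) \<le>
    (\<integral>\<^sup>+ r. ennreal (r powr (-1/2)) * indicator {0..?c} r +
        ennreal ?c * (ennreal (r powr (-3/2)) * indicator {?c..} r) \<partial>lborel)"
  proof (intro nn_integral_mono)
    fix r :: real
    show "ennreal (min 1 (1 / (r * \<rho>)) * r powr (-1/2)) * indicator {0<..} r \<le>
      ennreal (r powr (-1/2)) * indicator {0..?c} r + ennreal ?c * (ennreal (r powr (-3/2)) * indicator {?c..} r)"
    proof (cases "r > 0")
      case r: True
      show ?thesis
      proof (cases "r \<le> ?c")
        case True
        have "min 1 (1 / (r * \<rho>)) * r powr (-1/2) \<le> 1 * r powr (-1/2)"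
          by (intro mult_right_mono) auto
        then have "ennreal (min 1 (1 / (r * \<rho>)) * r powr (-1/2)) \<le> ennreal (r powr (-1/2))"
          by (intro ennreal_leI) simp
        then show ?thesis using r True by (intro add_increasing2) auto
      next
        case False
        have "r powr (-3/2) = r powr (-1) * r powr (-1/2)" using powr_add[of r "-1" "-1/2"] by simp
        then have e: "?c * r powr (-3/2) = (1 / (r * \<rho>)) * r powr (-1/2)"
          using r \<rho> by (simp add: powr_minus_divide)
        have "min 1 (1 / (r * \<rho>)) * r powr (-1/2) \<le> ?c * r powr (-3/2)"
          unfolding e by (intro mult_right_mono) auto
        then have "ennreal (min 1 (1 / (r * \<rho>)) * r powr (-1/2)) \<le> ennreal ?c * ennreal (r powr (-3/2))"
          using \<rho> by (simp add: ennreal_leI flip: ennreal_mult)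
        then show ?thesis using r False by (intro add_increasing) auto
      qed
    qed simp
  qed
  also have "\<dots> = ennreal (?c powr (1/2) / (1/2)) + ennreal ?c * ennreal (- (?c powr (-1/2)) / (-1/2))"
    using \<rho> nn_integral_powr_near_0[of "-1/2" ?c] nn_integral_powr_near_top[of "-3/2" ?c]
    by (subst nn_integral_add) (auto simp: nn_integral_cmult)
  also have "\<dots> = ennreal (?c powr (1/2) / (1/2) + ?c * (- (?c powr (-1/2)) / (-1/2)))"
    using \<rho> by (subst ennreal_mult[symmetric]) (auto simp flip: ennreal_plus)
  also have "?c powr (1/2) / (1/2) + ?c * (- (?c powr (-1/2)) / (-1/2)) = 4 * \<rho> powr (-1/2)"
  proof -
    have c: "?c powr (1/2) = \<rho> powr (-1/2)" using \<rho> by (simp add: powr_divide powr_minus_divide)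
    have "?c * ?c powr (-1/2) = ?c powr (1 + (-1/2))" unfolding powr_add using \<rho> by simp
    then have d: "?c * ?c powr (-1/2) = \<rho> powr (-1/2)" by (simp add: c)
    have "?c * (- x / (-1/2)) = 2 * (?c * x)" for x by simp
    then show ?thesis by (simp only: c d) simp
  qed
  finally show ?thesis .
qed

text \<open>Schur's test with the function \<open>r powr (- 1/2)\<close>, which the kernel reproduces up to the factor 4; the
kernel is symmetric, so the factor occurs twice.\<close>

theorem hardy_kernel_bound:
  fixes g :: "real \<Rightarrow> ennreal"
  assumes [measurable]: "g \<in> borel_measurable borel"
  shows "(\<integral>\<^sup>+ \<rho>. (\<integral>\<^sup>+ r. ennreal (min 1 (1 / (r * \<rho>))) * g r * indicator {0<..} r \<partial>lborel)\<^sup>2 * indicator {0<..} \<rho> \<partial>lborel)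
    \<le> 16 * (\<integral>\<^sup>+ r. (g r)\<^sup>2 * indicator {0<..} r \<partial>lborel)"
proof -
  define K where "K r \<rho> = ennreal (min 1 (1 / (r * \<rho>)))" for r \<rho> :: real
  have [measurable]: "case_prod K \<in> borel_measurable (borel \<Otimes>\<^sub>M borel)" unfolding K_def by measurable
  have Ksym: "K r \<rho> = K \<rho> r" for r \<rho> by (simp add: K_def mult.commute)
  have mom: "(\<integral>\<^sup>+ r. K r \<rho> * ennreal (r powr (-1/2)) * indicator {0<..} r \<partial>lborel) \<le> 4 * ennreal (\<rho> powr (-1/2))"
    if "\<rho> > 0" for \<rho>
  proof -
    have "(\<integral>\<^sup>+ r. K r \<rho> * ennreal (r powr (-1/2)) * indicator {0<..} r \<partial>lborel) =
       (\<integral>\<^sup>+ r. ennreal (min 1 (1 / (r * \<rho>)) * r powr (-1/2)) * indicator {0<..} r \<partial>lborel)"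
      using that by (intro nn_integral_cong) (auto simp: K_def indicator_def ennreal_mult)
    also have "\<dots> \<le> ennreal (4 * \<rho> powr (-1/2))" by (rule hardy_kernel_moment[OF that])
    finally show ?thesis by (simp add: ennreal_mult)
  qed
  let ?S = "\<lambda>\<rho>. \<integral>\<^sup>+ r. K r \<rho> * ennreal (r powr (1/2)) * (g r)\<^sup>2 * indicator {0<..} r \<partial>lborel"
  have cs: "(\<integral>\<^sup>+ r. K r \<rho> * g r * indicator {0<..} r \<partial>lborel)\<^sup>2 \<le> 4 * ennreal (\<rho> powr (-1/2)) * ?S \<rho>" if \<rho>: "\<rho> > 0" for \<rho>
  proof -
    let ?k = "\<lambda>r. ennreal (sqrt (min 1 (1 / (r * \<rho>))))"
    let ?f = "\<lambda>r. ?k r * ennreal (r powr (-1/4)) * indicator {0<..} r"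
    let ?h = "\<lambda>r. ?k r * ennreal (r powr (1/4)) * g r * indicator {0<..} r"
    have kk: "?k r * ?k r = K r \<rho>" if "r > 0" for r
      using that \<rho> by (simp add: K_def flip: ennreal_mult)
    have "(\<integral>\<^sup>+ r. ?f r * ?h r \<partial>lborel)\<^sup>2 \<le> (\<integral>\<^sup>+ r. (?f r)\<^sup>2 \<partial>lborel) * (\<integral>\<^sup>+ r. (?h r)\<^sup>2 \<partial>lborel)"
      by (rule Cauchy_Schwarz_nn_integral) measurable
    also have "(\<integral>\<^sup>+ r. ?f r * ?h r \<partial>lborel) = (\<integral>\<^sup>+ r. K r \<rho> * g r * indicator {0<..} r \<partial>lborel)"
    proof (intro nn_integral_cong)
      fix r :: real
      have one: "ennreal (r powr (-1/4)) * ennreal (r powr (1/4)) = 1" if "r > 0"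
        using that powr_add[of r "-1/4" "1/4"] by (simp add: ennreal_mult[symmetric])
      have "?k r * ennreal (r powr (-1/4)) * (?k r * ennreal (r powr (1/4)) * g r) = K r \<rho> * g r" if "r > 0"
      proof -
        have "?k r * ennreal (r powr (-1/4)) * (?k r * ennreal (r powr (1/4)) * g r) =
            (?k r * ?k r) * (ennreal (r powr (-1/4)) * ennreal (r powr (1/4))) * g r"
          by (simp only: mult_ac)
        also have "\<dots> = K r \<rho> * 1 * g r"
          by (simp only: kk[OF that] one[OF that])
        finally show ?thesis by simp
      qed
      then show "?f r * ?h r = K r \<rho> * g r * indicator {0<..} r"
        by (cases "r > 0") auto
    qed
    also have "(\<integral>\<^sup>+ r. (?f r)\<^sup>2 \<partial>lborel) = (\<integral>\<^sup>+ r. K r \<rho> * ennreal (r powr (-1/2)) * indicator {0<..} r \<partial>lborel)"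
    proof (intro nn_integral_cong)
      fix r :: real
      have "ennreal (r powr (-1/4)) * ennreal (r powr (-1/4)) = ennreal (r powr (-1/2))"
        using powr_add[of r "-1/4" "-1/4"] by (simp add: ennreal_mult[symmetric])
      moreover have "(x * y)\<^sup>2 = (x * x) * (y * y)" for x y :: ennreal
        by (simp only: power2_eq_square mult_ac)
      ultimately have "(?k r * ennreal (r powr (-1/4)))\<^sup>2 = K r \<rho> * ennreal (r powr (-1/2))" if "r > 0"
        by (simp only: kk[OF that])
      then show "(?f r)\<^sup>2 = K r \<rho> * ennreal (r powr (-1/2)) * indicator {0<..} r"
        by (cases "r > 0") auto
    qed
    also have "(\<integral>\<^sup>+ r. (?h r)\<^sup>2 \<partial>lborel) = ?S \<rho>"
    proof (intro nn_integral_cong)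
      fix r :: real
      have e: "ennreal (r powr (1/4)) * ennreal (r powr (1/4)) = ennreal (r powr (1/2))"
        using powr_add[of r "1/4" "1/4"] by (simp add: ennreal_mult[symmetric])
      have "(x * y * z)\<^sup>2 = (x * x) * (y * y) * z\<^sup>2" for x y z :: ennreal
        by (simp only: power2_eq_square mult_ac)
      then show "(?h r)\<^sup>2 = K r \<rho> * ennreal (r powr (1/2)) * (g r)\<^sup>2 * indicator {0<..} r"
        using kk[of r] e by (cases "r > 0") auto
    qed
    also have "(\<integral>\<^sup>+ r. K r \<rho> * ennreal (r powr (-1/2)) * indicator {0<..} r \<partial>lborel) * ?S \<rho> \<le> 4 * ennreal (\<rho> powr (-1/2)) * ?S \<rho>"
      by (intro mult_right_mono mom \<rho>) auto
    finally show ?thesis .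
  qed
  have "(\<integral>\<^sup>+ \<rho>. (\<integral>\<^sup>+ r. K r \<rho> * g r * indicator {0<..} r \<partial>lborel)\<^sup>2 * indicator {0<..} \<rho> \<partial>lborel)
    \<le> (\<integral>\<^sup>+ \<rho>. 4 * ennreal (\<rho> powr (-1/2)) * ?S \<rho> * indicator {0<..} \<rho> \<partial>lborel)"
    using cs by (intro nn_integral_mono) (auto simp: indicator_def)
  also have "\<dots> = (\<integral>\<^sup>+ \<rho>. \<integral>\<^sup>+ r. 4 * ennreal (\<rho> powr (-1/2)) * indicator {0<..} \<rho> * (K r \<rho> * ennreal (r powr (1/2)) * (g r)\<^sup>2 * indicator {0<..} r) \<partial>lborel \<partial>lborel)"
    by (intro nn_integral_cong) (subst nn_integral_cmult, auto simp: mult_ac)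
  also have "\<dots> = (\<integral>\<^sup>+ r. \<integral>\<^sup>+ \<rho>. 4 * ennreal (\<rho> powr (-1/2)) * indicator {0<..} \<rho> * (K r \<rho> * ennreal (r powr (1/2)) * (g r)\<^sup>2 * indicator {0<..} r) \<partial>lborel \<partial>lborel)"
    by (rule lborel_pair.Fubini') measurable
  also have "\<dots> = (\<integral>\<^sup>+ r. (4 * ennreal (r powr (1/2)) * (g r)\<^sup>2 * indicator {0<..} r) * (\<integral>\<^sup>+ \<rho>. K \<rho> r * ennreal (\<rho> powr (-1/2)) * indicator {0<..} \<rho> \<partial>lborel) \<partial>lborel)"
    by (intro nn_integral_cong) (subst nn_integral_cmult[symmetric], auto simp: mult_ac Ksym)
  also have "\<dots> \<le> (\<integral>\<^sup>+ r. 16 * ((g r)\<^sup>2 * indicator {0<..} r) \<partial>lborel)"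
  proof (intro nn_integral_mono)
    fix r :: real
    show "(4 * ennreal (r powr (1/2)) * (g r)\<^sup>2 * indicator {0<..} r) * (\<integral>\<^sup>+ \<rho>. K \<rho> r * ennreal (\<rho> powr (-1/2)) * indicator {0<..} \<rho> \<partial>lborel)
      \<le> 16 * ((g r)\<^sup>2 * indicator {0<..} r)"
    proof (cases "r > 0")
      case True
      have "(4 * ennreal (r powr (1/2)) * (g r)\<^sup>2) * (\<integral>\<^sup>+ \<rho>. K \<rho> r * ennreal (\<rho> powr (-1/2)) * indicator {0<..} \<rho> \<partial>lborel)
        \<le> (4 * ennreal (r powr (1/2)) * (g r)\<^sup>2) * (4 * ennreal (r powr (-1/2)))"
        by (intro mult_left_mono mom True) auto
      also have "\<dots> = (4 * 4) * (ennreal (r powr (1/2)) * ennreal (r powr (-1/2))) * (g r)\<^sup>2"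
        by (simp only: mult_ac)
      also have "ennreal (r powr (1/2)) * ennreal (r powr (-1/2)) = 1"
        using True powr_add[of r "1/2" "-1/2"] by (simp add: ennreal_mult[symmetric])
      finally show ?thesis using True by simp
    qed simp
  qed
  also have "\<dots> = 16 * (\<integral>\<^sup>+ r. (g r)\<^sup>2 * indicator {0<..} r \<partial>lborel)"
    by (rule nn_integral_cmult) measurable
  finally show ?thesis unfolding K_def .
qed

section \<open>The Fourier transforms of ball and sphere\<close>

text \<open>For \<open>k = (n - 1) / 2\<close> this is, up to the volume of the unit ball of dimension \<open>n - 1\<close>, the measure of
the slice at height \<open>y\<close> of the unit ball of dimension \<open>n\<close>.\<close>

definition slice_weight :: "real \<Rightarrow> real \<Rightarrow> real" where
  "slice_weight k y = (1 - y\<^sup>2) powr k"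

definition ball_transform :: "real \<Rightarrow> real \<Rightarrow> real" where
  "ball_transform k s = integral {-1..1} (\<lambda>y. cos (s * y) * slice_weight k y)"

definition ball_transform_deriv :: "real \<Rightarrow> real \<Rightarrow> real" where
  "ball_transform_deriv k s = integral {-1..1} (\<lambda>y. - (y * sin (s * y)) * slice_weight k y)"

text \<open>The derivative with respect to \<open>R\<close> at \<open>R = 1\<close> of \<open>R ^ n * ball_transform k (s * R)\<close>, with
\<open>n = 2 * k + 1\<close>: the sphere is the derivative of the ball with respect to the radius.\<close>

definition sphere_transform :: "real \<Rightarrow> real \<Rightarrow> real" where
  "sphere_transform k s = (2 * k + 1) * ball_transform k s + s * ball_transform_deriv k s"

context
  fixes k :: real
  assumes k: "k > 0"
begin

lemma slice_weight_continuous: "continuous_on {-1..1} (slice_weight k)"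
  unfolding slice_weight_def[abs_def] using k
  by (intro continuous_on_powr' continuous_intros) (auto simp: abs_square_le_1)

lemma slice_weight_continuous2: "continuous_on (UNIV \<times> {-1..1}) (\<lambda>z. slice_weight k (snd z))"
  by (rule continuous_on_compose2[OF slice_weight_continuous continuous_on_snd[OF continuous_on_id]]) auto

lemma ball_transform_has_derivative:
  "(ball_transform k has_real_derivative ball_transform_deriv k s) (at s)"
proof -
  have "((\<lambda>s. integral (cbox (-1) 1) (\<lambda>y. cos (s * y) * slice_weight k y)) has_field_derivative
      integral (cbox (-1) 1) (\<lambda>y. - (y * sin (s * y)) * slice_weight k y)) (at s within UNIV)"
  proof (rule leibniz_rule_field_derivative)
    show "((\<lambda>x. cos (x * t) * slice_weight k t) has_real_derivative - (t * sin (x * t)) * slice_weight k t) (at x within UNIV)" for x t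
      by (auto intro!: derivative_eq_intros)
    show "(\<lambda>y. cos (x * y) * slice_weight k y) integrable_on cbox (-1) 1" for x
      unfolding cbox_interval by (intro integrable_continuous_real continuous_intros slice_weight_continuous)
    show "continuous_on (UNIV \<times> cbox (-1) 1) (\<lambda>(x, t). - (t * sin (x * t)) * slice_weight k t)"
      unfolding case_prod_beta cbox_interval by (intro continuous_intros slice_weight_continuous2)
  qed auto
  then show ?thesis by (simp add: ball_transform_def[abs_def] ball_transform_deriv_def cbox_interval)
qed

lemma ball_transform_deriv_has_derivative:
  "(ball_transform_deriv k has_real_derivative integral {-1..1} (\<lambda>y. - (y\<^sup>2 * cos (s * y)) * slice_weight k y)) (at s)"
proof -
  have "((\<lambda>s. integral (cbox (-1) 1) (\<lambda>y. - (y * sin (s * y)) * slice_weight k y)) has_field_derivative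
      integral (cbox (-1) 1) (\<lambda>y. - (y\<^sup>2 * cos (s * y)) * slice_weight k y)) (at s within UNIV)"
  proof (rule leibniz_rule_field_derivative)
    show "((\<lambda>x. - (t * sin (x * t)) * slice_weight k t) has_real_derivative - (t\<^sup>2 * cos (x * t)) * slice_weight k t) (at x within UNIV)" for x t
      by (auto intro!: derivative_eq_intros simp: power2_eq_square)
    show "(\<lambda>y. - (y * sin (x * y)) * slice_weight k y) integrable_on cbox (-1) 1" for x
      unfolding cbox_interval by (intro integrable_continuous_real continuous_intros slice_weight_continuous)
    show "continuous_on (UNIV \<times> cbox (-1) 1) (\<lambda>(x, t). - (t\<^sup>2 * cos (x * t)) * slice_weight k t)"
      unfolding case_prod_beta cbox_interval by (intro continuous_intros slice_weight_continuous2)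
  qed auto
  then show ?thesis by (simp add: ball_transform_deriv_def[abs_def] cbox_interval)
qed

text \<open>The left side is the integral of the derivative of \<open>slice_weight (k + 1) y * sin (s * y)\<close>, and the
weight vanishes at \<open>y = 1\<close> and \<open>y = - 1\<close>.\<close>

lemma ball_transform_ode:
  "s * (ball_transform k s + integral {-1..1} (\<lambda>y. - (y\<^sup>2 * cos (s * y)) * slice_weight k y))
     + (2 * k + 2) * ball_transform_deriv k s = 0"
proof -
  let ?F = "\<lambda>y. slice_weight (k + 1) y * sin (s * y)"
  let ?f = "\<lambda>y. (2 * k + 2) * (- (y * sin (s * y)) * slice_weight k y) + s * (cos (s * y) * slice_weight k y + - (y\<^sup>2 * cos (s * y)) * slice_weight k y)"
  have "(?f has_integral (?F 1 - ?F (-1))) {-1..1}"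
  proof (rule fundamental_theorem_of_calculus_interior)
    have "continuous_on {-1..1} (slice_weight (k + 1))"
      unfolding slice_weight_def[abs_def] using k
      by (intro continuous_on_powr' continuous_intros) (auto simp: abs_square_le_1)
    then show "continuous_on {-1..1} ?F" by (intro continuous_intros)
    fix y :: real assume y: "y \<in> {-1<..<1}"
    then have p: "1 - y\<^sup>2 > 0" by (simp add: abs_square_less_1 abs_less_iff)
    have w1: "slice_weight (k + 1) y = (1 - y\<^sup>2) * slice_weight k y"
      using p by (simp add: slice_weight_def powr_add mult.commute)
    have "(slice_weight (k + 1) has_real_derivative (k + 1) * (1 - y\<^sup>2) powr (k + 1 - 1) * (- 2 * y)) (at y)"
      unfolding slice_weight_def[abs_def]
    proof -
      have "((\<lambda>y. 1 - y\<^sup>2) has_real_derivative - 2 * y) (at y)" by (auto intro!: derivative_eq_intros)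
      from DERIV_fun_powr[OF this p, of "k + 1"] show "((\<lambda>y. (1 - y\<^sup>2) powr (k + 1)) has_real_derivative (k + 1) * (1 - y\<^sup>2) powr (k + 1 - 1) * (- 2 * y)) (at y)"
        by simp
    qed
    then have d: "(slice_weight (k + 1) has_real_derivative - (2 * k + 2) * y * slice_weight k y) (at y)"
      by (simp add: slice_weight_def algebra_simps)
    have "(?F has_real_derivative ?f y) (at y)"
      by (rule derivative_eq_intros d refl)+ (simp only: w1, simp add: algebra_simps)
    then show "(?F has_vector_derivative ?f y) (at y)"
      by (simp add: has_real_derivative_iff_has_vector_derivative)
  qed simp
  then have z: "(?f has_integral 0) {-1..1}" by (simp add: slice_weight_def)
  have i: "(\<lambda>y. - (y * sin (s * y)) * slice_weight k y) integrable_on {-1..1}"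
    "(\<lambda>y. cos (s * y) * slice_weight k y) integrable_on {-1..1}"
    "(\<lambda>y. - (y\<^sup>2 * cos (s * y)) * slice_weight k y) integrable_on {-1..1}"
    by (intro integrable_continuous_real continuous_intros slice_weight_continuous)+
  have "(?f has_integral (2 * k + 2) * ball_transform_deriv k s + s * (ball_transform k s + integral {-1..1} (\<lambda>y. - (y\<^sup>2 * cos (s * y)) * slice_weight k y))) {-1..1}"
    unfolding ball_transform_def ball_transform_deriv_def
    by (intro has_integral_add has_integral_mult_right integrable_integral i)
  from has_integral_unique[OF this z] show ?thesis by simp
qed

lemma sphere_transform_has_derivative:
  "(sphere_transform k has_real_derivative - (s * ball_transform k s)) (at s)"
proof -
  let ?G2 = "integral {-1..1} (\<lambda>y. - (y\<^sup>2 * cos (s * y)) * slice_weight k y)"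
  have "(sphere_transform k has_real_derivative ((2 * k + 1) * ball_transform_deriv k s + (ball_transform_deriv k s + s * ?G2))) (at s)"
    unfolding sphere_transform_def[abs_def]
    by (rule derivative_eq_intros ball_transform_has_derivative ball_transform_deriv_has_derivative refl)+ simp
  also have "(2 * k + 1) * ball_transform_deriv k s + (ball_transform_deriv k s + s * ?G2) = - (s * ball_transform k s)"
    using ball_transform_ode[of s] by (simp add: algebra_simps)
  finally show ?thesis .
qed

lemma sphere_transform_continuous: "continuous_on S (sphere_transform k)"
  by (rule DERIV_continuous_on[OF has_field_derivative_at_within[OF sphere_transform_has_derivative]])

end

text \<open>For solutions of \<open>v'' + v = c v / s\<^sup>2\<close> the energy \<open>v\<^sup>2 + v'\<^sup>2\<close> grows by a bounded factor only, since its
logarithmic derivative is at most \<open>\<bar>c\<bar> / s\<^sup>2\<close>. So \<open>v\<close> is bounded, and \<open>P s = cis (- s) (v' + \<i> v)\<close>,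
which would be constant for \<open>c = 0\<close>, has derivative of size \<open>1 / s\<^sup>2\<close>. Hence \<open>P\<close> converges at rate
\<open>1 / s\<close>, and \<open>v\<close> is the imaginary part of \<open>cis s * P s\<close>.\<close>

lemma oscillator_asymptotics:
  fixes v v1 :: "real \<Rightarrow> real" and c :: real
  assumes D: "\<And>s. s > 0 \<Longrightarrow> (v has_real_derivative v1 s) (at s)"
    "\<And>s. s > 0 \<Longrightarrow> (v1 has_real_derivative (c / s\<^sup>2 - 1) * v s) (at s)"
  shows "\<exists>(A::complex) B M. \<forall>s\<ge>1. cmod (of_real (v s) - (A * cis s + B * cis (- s))) \<le> M / s"
proof -
  define E where "E s = (v s)\<^sup>2 + (v1 s)\<^sup>2" for s
  have E0: "E s \<ge> 0" for s by (simp add: E_def)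
  have vv: "\<bar>2 * v s * v1 s\<bar> \<le> E s" for s
  proof -
    have "0 \<le> (v s - v1 s)\<^sup>2" "0 \<le> (v s + v1 s)\<^sup>2" by simp_all
    then show ?thesis by (simp add: E_def abs_le_iff power2_eq_square algebra_simps)
  qed
  define E1 where "E1 s = c / s\<^sup>2 * (2 * v s * v1 s)" for s
  have E': "(E has_real_derivative E1 s) (at s)" if "s > 0" for s
    unfolding E_def[abs_def]
    by (rule derivative_eq_intros D that refl)+ (simp add: E1_def algebra_simps)
  have Edec: "E t * exp (- \<bar>c\<bar> * (- 1 / t)) \<le> E 1 * exp (- \<bar>c\<bar> * (- 1 / 1))" if "t \<ge> 1" for t
  proof (rule DERIV_nonpos_imp_nonincreasing[OF that])
    fix s :: real assume s: "1 \<le> s" "s \<le> t"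
    have "((\<lambda>t. E t * exp (- \<bar>c\<bar> * (- 1 / t))) has_real_derivative
        (E1 s - \<bar>c\<bar> / s\<^sup>2 * E s) * exp (- \<bar>c\<bar> * (- 1 / s))) (at s)"
      using s by (auto intro!: derivative_eq_intros E' simp: power2_eq_square algebra_simps)
    moreover have "E1 s \<le> \<bar>c\<bar> / s\<^sup>2 * E s"
    proof -
      have "E1 s \<le> \<bar>E1 s\<bar>" by simp
      also have "\<dots> = \<bar>c\<bar> / s\<^sup>2 * \<bar>2 * v s * v1 s\<bar>" by (simp add: E1_def abs_mult)
      also have "\<dots> \<le> \<bar>c\<bar> / s\<^sup>2 * E s" by (intro mult_left_mono vv) auto
      finally show ?thesis .
    qed
    then have "(E1 s - \<bar>c\<bar> / s\<^sup>2 * E s) * exp (- \<bar>c\<bar> * (- 1 / s)) \<le> 0"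
      by (intro mult_nonpos_nonneg) auto
    ultimately show "\<exists>y. ((\<lambda>t. E t * exp (- \<bar>c\<bar> * (- 1 / t))) has_real_derivative y) (at s) \<and> y \<le> 0" by blast
  qed
  define Em where "Em = E 1 * exp \<bar>c\<bar>"
  have Eb: "E t \<le> Em" if "t \<ge> 1" for t
  proof -
    have "E t * 1 \<le> E t * exp (- \<bar>c\<bar> * (- 1 / t))"
      using that by (intro mult_left_mono E0) auto
    then show ?thesis using Edec[OF that] by (simp add: Em_def)
  qed
  have vb: "\<bar>v t\<bar> \<le> sqrt Em" if "t \<ge> 1" for t
  proof -
    have "(v t)\<^sup>2 \<le> Em" using Eb[OF that] by (simp add: E_def) (smt (verit) zero_le_power2)
    then show ?thesis by (simp add: real_le_rsqrt abs_le_square_iff flip: real_sqrt_abs)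
  qed
  define K where "K = \<bar>c\<bar> * sqrt Em"
  define P where "P s = cis (- s) * (of_real (v1 s) + \<i> * of_real (v s))" for s
  have P': "(P has_vector_derivative cis (- s) * of_real (c / s\<^sup>2 * v s)) (at s)" if "s > 0" for s
  proof -
    have 1: "((\<lambda>s. cis (- s)) has_vector_derivative (- \<i> * cis (- s))) (at s)"
    proof -
      have "((\<lambda>w. exp (- \<i> * w)) has_field_derivative - \<i> * exp (- \<i> * of_real s)) (at (of_real s))"
        by (auto intro!: derivative_eq_intros)
      from has_vector_derivative_real_field[OF this] show ?thesis
        by (simp add: o_def cis_conv_exp)
    qed
    have 2: "((\<lambda>s. of_real (v1 s) + \<i> * of_real (v s)) has_vector_derivative
        (of_real ((c / s\<^sup>2 - 1) * v s) + \<i> * of_real (v1 s))) (at s)"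
      by (intro derivative_intros has_vector_derivative_of_real has_vector_derivative_mult_right D that)
    show ?thesis
      unfolding P_def
      by (rule has_vector_derivative_eq_rhs[OF has_vector_derivative_mult[OF 1 2]])
         (simp add: algebra_simps)
  qed
  have Pd: "cmod (P t - P s) \<le> K / s" if st: "1 \<le> s" "s \<le> t" for s t
  proof -
    let ?p = "\<lambda>s. cis (- s) * of_real (c / s\<^sup>2 * v s)"
    have I: "(?p has_integral (P t - P s)) {s..t}"
    proof (rule fundamental_theorem_of_calculus[OF st(2)])
      fix u assume "u \<in> {s..t}"
      then have "u > 0" using st by simp
      then show "(P has_vector_derivative ?p u) (at u within {s..t})"
        by (rule has_vector_derivative_at_within[OF P'])
    qed
    have I2: "((\<lambda>u. K / u\<^sup>2) has_integral (- K / t - (- K / s))) {s..t}"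
    proof (rule fundamental_theorem_of_calculus[OF st(2)])
      fix u assume u: "u \<in> {s..t}"
      have "((\<lambda>u. - K / u) has_real_derivative K / u\<^sup>2) (at u within {s..t})"
        using u st by (auto intro!: derivative_eq_intros simp: power2_eq_square)
      then show "((\<lambda>u. - K / u) has_vector_derivative K / u\<^sup>2) (at u within {s..t})"
        by (simp add: has_real_derivative_iff_has_vector_derivative)
    qed
    have "cmod (integral {s..t} ?p) \<le> integral {s..t} (\<lambda>u. K / u\<^sup>2)"
    proof (rule integral_norm_bound_integral[OF has_integral_integrable[OF I] has_integral_integrable[OF I2]])
      fix u assume u: "u \<in> {s..t}"
      have "cmod (?p u) = \<bar>c\<bar> * \<bar>v u\<bar> / u\<^sup>2" by (simp only: norm_mult norm_cis norm_of_real abs_mult abs_divide) simp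
      also have "\<dots> \<le> \<bar>c\<bar> * sqrt Em / u\<^sup>2"
        using u st by (intro divide_right_mono mult_left_mono vb) auto
      finally show "cmod (?p u) \<le> K / u\<^sup>2" by (simp add: K_def)
    qed
    also have "\<dots> = K / s - K / t" using I2 by (simp add: integral_unique)
    also have "\<dots> \<le> K / s"
    proof -
      have "K \<ge> 0" by (simp add: K_def Em_def E0)
      then show ?thesis using st by simp
    qed
    finally show ?thesis using I by (simp add: integral_unique)
  qed
  have "\<exists>L. (\<lambda>n. P (real n)) \<longlonglongrightarrow> L"
  proof -
    have "Cauchy (\<lambda>n. P (real n))"
    proof (rule CauchyI')
      fix e :: real assume e: "e > 0"
      obtain N :: nat where N: "K / e < real N" using reals_Archimedean2 by blast
      show "\<exists>M. \<forall>m\<ge>M. \<forall>n>m. dist (P (real m)) (P (real n)) < e"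
      proof (intro exI[of _ "max 1 N"] allI impI)
        fix m n assume m: "max 1 N \<le> m" "m < n"
        have "cmod (P (real n) - P (real m)) \<le> K / real m" using m by (intro Pd) auto
        also have "K / real m < e"
        proof -
          have "K / e < real m" using N m by linarith
          then show ?thesis using e m by (simp add: field_simps)
        qed
        finally show "dist (P (real m)) (P (real n)) < e" by (simp add: dist_norm norm_minus_commute)
      qed
    qed
    then show ?thesis by (simp add: Cauchy_convergent_iff convergent_def)
  qed
  then obtain L where L: "(\<lambda>n. P (real n)) \<longlonglongrightarrow> L" by blast
  have PL: "cmod (P s - L) \<le> K / s" if s: "s \<ge> 1" for s
  proof -
    have "(\<lambda>n. cmod (P (real n) - P s)) \<longlonglongrightarrow> cmod (L - P s)" by (intro tendsto_intros L)
    then have "cmod (L - P s) \<le> K / s"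
    proof (rule LIMSEQ_le_const2)
      obtain N :: nat where N: "s \<le> real N" using real_arch_simple by blast
      show "\<exists>N. \<forall>n\<ge>N. cmod (P (real n) - P s) \<le> K / s"
        using N by (intro exI[of _ N] allI impI Pd s) auto
    qed
    then show ?thesis by (simp add: norm_minus_commute)
  qed
  have "cmod (of_real (v s) - (- \<i> / 2 * L * cis s + \<i> / 2 * cnj L * cis (- s))) \<le> K / s" if s: "s \<ge> 1" for s
  proof -
    have "cis s * P s = of_real (v1 s) + \<i> * of_real (v s)"
      by (simp add: P_def cis_mult flip: mult.assoc)
    then have "v s = Im (cis s * P s)" by simp
    have im: "of_real (Im z) = - \<i> / 2 * z + \<i> / 2 * cnj z" for z by (simp add: complex_eq_iff)
    have "- \<i> / 2 * L * cis s + \<i> / 2 * cnj L * cis (- s) = - \<i> / 2 * (cis s * L) + \<i> / 2 * cnj (cis s * L)"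
      by (simp add: cis_cnj mult_ac)
    also have "\<dots> = of_real (Im (cis s * L))" by (rule im[symmetric])
    finally have "of_real (v s) - (- \<i> / 2 * L * cis s + \<i> / 2 * cnj L * cis (- s)) = of_real (Im (cis s * (P s - L)))"
      using \<open>v s = Im (cis s * P s)\<close> by (simp add: right_diff_distrib)
    also have "cmod \<dots> \<le> cmod (cis s * (P s - L))" by (simp only: norm_of_real abs_Im_le_cmod)
    also have "\<dots> \<le> K / s" using PL[OF s] by (simp add: norm_mult)
    finally show ?thesis .
  qed
  then show ?thesis by blast
qed

text \<open>The function \<open>s powr k * sphere_transform k s\<close> solves the oscillator equation with \<open>c = k * (k - 1)\<close>;
near 0 all terms are bounded.\<close>

theorem sphere_transform_asymptotics:
  fixes k :: real
  assumes k: "k > 0"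
  shows "\<exists>(A::complex) B M. M > 0 \<and> (\<forall>s>0. cmod (of_real (s powr k * sphere_transform k s) - (A * cis s + B * cis (- s))) \<le> M * min 1 (1 / s))"
proof -
  let ?J = "sphere_transform k" and ?G = "ball_transform k"
  define v where "v s = s powr k * ?J s" for s
  define v1 where "v1 s = k * s powr (k - 1) * ?J s - s powr (k + 1) * ?G s" for s
  have pw: "((\<lambda>s. c * s powr b) has_real_derivative c * b * s powr b') (at s)" if "b' = b - 1" "s > 0" for b b' c s :: real
    using DERIV_cmult[OF has_real_derivative_powr[of s b], of c] that by (simp add: mult_ac)
  have pw1: "((\<lambda>s. s powr b) has_real_derivative b * s powr b') (at s)" if "b' = b - 1" "s > 0" for b b' s :: real
    using pw[of b' b s 1] that by simp
  have D1: "(v has_real_derivative v1 s) (at s)" if s: "s > 0" for s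
  proof -
    have "s powr (k + 1) = s powr k * s" using s by (simp add: powr_add)
    then show ?thesis unfolding v_def[abs_def] v1_def
      by (intro DERIV_cong[OF DERIV_mult[OF pw1[of "k - 1" k s] sphere_transform_has_derivative[OF k, of s]]])
         (use s in \<open>simp_all add: algebra_simps\<close>)
  qed
  have D2: "(v1 has_real_derivative ((k * (k - 1)) / s\<^sup>2 - 1) * v s) (at s)" if s: "s > 0" for s
  proof -
    have e: "s powr (k + 1) = s powr k * s" "s powr (k - 1) = s powr k / s" "s powr (k - 2) = s powr k / s\<^sup>2"
      using s by (simp_all add: powr_add powr_diff)
    have "(v1 has_real_derivative ((k * (k - 1) * s powr (k - 2)) * ?J s + (- (s * ?G s)) * (k * s powr (k - 1))
       - (((k + 1) * s powr k) * ?G s + ball_transform_deriv k s * s powr (k + 1)))) (at s)"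
      unfolding v1_def[abs_def]
      by (intro DERIV_diff DERIV_mult pw pw1 sphere_transform_has_derivative[OF k] ball_transform_has_derivative[OF k])
         (use s in auto)
    also have "((k * (k - 1) * s powr (k - 2)) * ?J s + (- (s * ?G s)) * (k * s powr (k - 1))
       - (((k + 1) * s powr k) * ?G s + ball_transform_deriv k s * s powr (k + 1)))
       = (k * (k - 1)) / s\<^sup>2 * v s - s powr k * ((2 * k + 1) * ?G s + s * ball_transform_deriv k s)"
      unfolding e v_def using s by (simp add: field_simps)
    also have "\<dots> = ((k * (k - 1)) / s\<^sup>2 - 1) * v s"
      by (simp add: v_def sphere_transform_def[of k s] algebra_simps)
    finally show ?thesis .
  qed
  obtain A B :: complex and M where AB: "\<And>s. s \<ge> 1 \<Longrightarrow> cmod (of_real (v s) - (A * cis s + B * cis (- s))) \<le> M / s"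
    using oscillator_asymptotics[of v v1, OF D1 D2] by blast
  have "bounded (?J ` {0..1})"
    by (intro compact_imp_bounded compact_continuous_image sphere_transform_continuous[OF k]) auto
  then obtain Q where Q0: "\<forall>s \<in> {0..1}. \<bar>?J s\<bar> \<le> Q" unfolding bounded_iff by auto
  have Q: "\<bar>?J s\<bar> \<le> Q" if "s \<in> {0..1}" for s using Q0 that by blast
  define M' where "M' = \<bar>M\<bar> + \<bar>Q\<bar> + cmod A + cmod B + 1"
  have M': "M' > 0" by (simp add: M'_def add_nonneg_pos)
  have "cmod (of_real (v s) - (A * cis s + B * cis (- s))) \<le> M' * min 1 (1 / s)" if s: "s > 0" for s
  proof (cases "s \<ge> 1")
    case True
    have mm: "M / s \<le> M' / s" using s by (intro divide_right_mono) (auto simp: M'_def intro: order_trans[OF abs_ge_self])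
    moreover have "min 1 (1 / s) = 1 / s" using True by (simp add: min_def)
    ultimately show ?thesis using AB[OF True] mm by simp
  next
    case False
    have "\<bar>v s\<bar> = s powr k * \<bar>?J s\<bar>" by (simp add: v_def abs_mult)
    also have "\<dots> \<le> 1 * \<bar>Q\<bar>"
      using s False k order_trans[OF Q[of s] abs_ge_self] by (intro mult_mono powr_le1) auto
    finally have "\<bar>v s\<bar> \<le> \<bar>Q\<bar>" by simp
    have "cmod (of_real (v s) - (A * cis s + B * cis (- s))) \<le> cmod (of_real (v s)) + (cmod (A * cis s) + cmod (B * cis (- s)))"
      by (rule order_trans[OF norm_triangle_ineq4 add_left_mono[OF norm_triangle_ineq]])
    also have "\<dots> \<le> M'" using \<open>\<bar>v s\<bar> \<le> \<bar>Q\<bar>\<close> by (simp add: norm_mult M'_def)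
    finally show ?thesis using False s by (simp add: min_def)
  qed
  then show ?thesis using M' unfolding v_def by blast
qed

section \<open>Rotations and slices of balls\<close>

lemma nn_integral_lborel_translate:
  fixes g :: "'a :: euclidean_space \<Rightarrow> ennreal"
  assumes [measurable]: "g \<in> borel_measurable borel"
  shows "(\<integral>\<^sup>+ x. g (w + x) \<partial>lborel) = (\<integral>\<^sup>+ x. g x \<partial>lborel)"
proof -
  have "(\<integral>\<^sup>+ x. g x \<partial>lborel) = (\<integral>\<^sup>+ x. g x \<partial>distr lborel borel ((+) w))"
    by (simp add: lborel_distr_plus)
  then show ?thesis by (simp add: nn_integral_distr)
qed

lemma orthogonal_transformation_measurable:
  fixes T :: "'a :: euclidean_space \<Rightarrow> 'a"
  assumes "orthogonal_transformation T"
  shows "T \<in> borel_measurable borel"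
  using orthogonal_transformation_linear[OF assms]
  by (intro borel_measurable_continuous_onI linear_continuous_on) (simp add: linear_conv_bounded_linear)

text \<open>The image of Lebesgue measure under \<open>T\<close> is again translation invariant. To compare the two measures,
integrate \<open>f x * g (T y + x)\<close> in both orders, \<open>f\<close> being the indicator of the unit ball: one order gives
\<open>V\<close> times the integral of \<open>g \<circ> T\<close>, the other \<open>V\<close> times the integral of \<open>g\<close>, because \<open>T\<close> and the
reflection at the origin preserve the ball.\<close>

lemma nn_integral_lborel_orthogonal:
  fixes T :: "'a :: euclidean_space \<Rightarrow> 'a"
  assumes T: "orthogonal_transformation T" and [measurable]: "g \<in> borel_measurable borel"
  shows "(\<integral>\<^sup>+ x. g (T x) \<partial>lborel) = (\<integral>\<^sup>+ x. g x \<partial>lborel)"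
proof -
  have lin: "linear T" by (rule orthogonal_transformation_linear[OF T])
  note [measurable] = orthogonal_transformation_measurable[OF T]
  define f :: "'a \<Rightarrow> ennreal" where "f = indicator (ball 0 1)"
  have [measurable]: "f \<in> borel_measurable borel" unfolding f_def by (rule borel_measurable_indicator) simp
  define V where "V = (\<integral>\<^sup>+ x. f x \<partial>lborel)"
  have Ve: "V = emeasure lborel (ball (0::'a) 1)" by (simp add: V_def f_def)
  have V: "V \<noteq> 0" "V \<noteq> top"
    unfolding Ve using emeasure_lborel_ball_finite[of "0::'a" 1] unit_ball_vol_pos[of "real DIM('a)"]
    by (auto simp: emeasure_ball simp del: unit_ball_vol_pos)
  have trans: "(\<integral>\<^sup>+ y. \<phi> (T y + z) \<partial>lborel) = (\<integral>\<^sup>+ y. \<phi> (T y) \<partial>lborel)"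
    if [measurable]: "\<phi> \<in> borel_measurable borel" for \<phi> :: "'a \<Rightarrow> ennreal" and z
  proof -
    obtain w where "T w = z" using orthogonal_transformation_surj[OF T] by (metis surjD)
    then have "T y + z = T (w + y)" for y by (simp add: linear_add[OF lin] add.commute)
    then show ?thesis using nn_integral_lborel_translate[of "\<lambda>y. \<phi> (T y)" w] by simp
  qed
  have "V * (\<integral>\<^sup>+ y. g (T y) \<partial>lborel) = (\<integral>\<^sup>+ x. f x * (\<integral>\<^sup>+ y. g (T y + x) \<partial>lborel) \<partial>lborel)"
    unfolding V_def by (simp add: trans nn_integral_multc)
  also have "\<dots> = (\<integral>\<^sup>+ x. \<integral>\<^sup>+ y. f x * g (T y + x) \<partial>lborel \<partial>lborel)"
    by (simp add: nn_integral_cmult)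
  also have "\<dots> = (\<integral>\<^sup>+ y. \<integral>\<^sup>+ x. f x * g (T y + x) \<partial>lborel \<partial>lborel)"
    by (rule lborel_pair.Fubini') measurable
  also have "\<dots> = (\<integral>\<^sup>+ y. \<integral>\<^sup>+ x. f (- T y + x) * g x \<partial>lborel \<partial>lborel)"
  proof (rule nn_integral_cong)
    fix y
    show "(\<integral>\<^sup>+ x. f x * g (T y + x) \<partial>lborel) = (\<integral>\<^sup>+ x. f (- T y + x) * g x \<partial>lborel)"
      using nn_integral_lborel_translate[of "\<lambda>x. f (- T y + x) * g x" "T y"] by simp
  qed
  also have "\<dots> = (\<integral>\<^sup>+ x. \<integral>\<^sup>+ y. f (- T y + x) * g x \<partial>lborel \<partial>lborel)"
    by (rule lborel_pair.Fubini') measurable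
  also have "\<dots> = (\<integral>\<^sup>+ x. V * g x \<partial>lborel)"
  proof (rule nn_integral_cong)
    fix x
    have "f (- T y + x) = f (T y + (- x))" for y
      by (simp add: f_def indicator_def norm_minus_commute)
    then have "(\<integral>\<^sup>+ y. f (- T y + x) \<partial>lborel) = (\<integral>\<^sup>+ y. f (T y + (- x)) \<partial>lborel)" by simp
    also have "\<dots> = (\<integral>\<^sup>+ y. f (T y) \<partial>lborel)" by (rule trans) measurable
    also have "\<dots> = V" by (simp add: V_def f_def indicator_def orthogonal_transformation_norm[OF T])
    finally show "(\<integral>\<^sup>+ y. f (- T y + x) * g x \<partial>lborel) = V * g x" by (simp add: nn_integral_multc)
  qed
  also have "\<dots> = V * (\<integral>\<^sup>+ x. g x \<partial>lborel)" by (rule nn_integral_cmult) measurable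
  finally show ?thesis using V by (simp add: ennreal_mult_cancel_left)
qed

lemma lborel_distr_orthogonal:
  fixes T :: "'a :: euclidean_space \<Rightarrow> 'a"
  assumes T: "orthogonal_transformation T"
  shows "distr lborel borel T = lborel"
proof (rule measure_eqI)
  note [measurable] = orthogonal_transformation_measurable[OF T]
  fix A assume "A \<in> sets (distr lborel borel T)"
  then have [measurable]: "A \<in> sets borel" by simp
  have "emeasure (distr lborel borel T) A = (\<integral>\<^sup>+ x. indicator A x \<partial>distr lborel borel T)" by simp
  also have "\<dots> = (\<integral>\<^sup>+ x. indicator A (T x) \<partial>lborel)" by (rule nn_integral_distr) measurable
  also have "\<dots> = emeasure lborel A" using nn_integral_lborel_orthogonal[OF T, of "indicator A"] by simp
  finally show "emeasure (distr lborel borel T) A = emeasure lborel A" .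
qed simp

lemma nn_integral_rotate:
  fixes x :: "real^'n" and h :: "real \<Rightarrow> real \<Rightarrow> ennreal"
  assumes [measurable]: "case_prod h \<in> borel_measurable (borel \<Otimes>\<^sub>M borel)"
  shows "(\<integral>\<^sup>+ \<xi>. h (x \<bullet> \<xi>) (norm \<xi>) \<partial>lborel) = (\<integral>\<^sup>+ \<xi>. h (norm x * (\<xi> \<bullet> axis k 1)) (norm \<xi>) \<partial>(lborel :: (real^'n) measure))"
proof -
  have "norm (norm x *\<^sub>R axis k 1 :: real^'n) = norm x" by (simp add: norm_axis_1)
  then obtain T :: "real^'n \<Rightarrow> real^'n" where T: "orthogonal_transformation T" "T (norm x *\<^sub>R axis k 1) = x"
    by (rule orthogonal_transformation_exists)
  have lin: "linear T" by (rule orthogonal_transformation_linear[OF T(1)])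
  note [measurable] = orthogonal_transformation_measurable[OF T(1)]
  have "(\<integral>\<^sup>+ \<xi>. h (x \<bullet> \<xi>) (norm \<xi>) \<partial>lborel) = (\<integral>\<^sup>+ \<xi>. h (x \<bullet> \<xi>) (norm \<xi>) \<partial>distr lborel borel T)"
    by (simp add: lborel_distr_orthogonal[OF T(1)])
  also have "\<dots> = (\<integral>\<^sup>+ \<xi>. h (x \<bullet> T \<xi>) (norm (T \<xi>)) \<partial>lborel)"
    by (rule nn_integral_distr) measurable
  also have "\<dots> = (\<integral>\<^sup>+ \<xi>. h (norm x * (\<xi> \<bullet> axis k 1)) (norm \<xi>) \<partial>(lborel :: (real^'n) measure))"
  proof (intro nn_integral_cong)
    fix \<xi> :: "real^'n"
    have "x \<bullet> T \<xi> = T (norm x *\<^sub>R axis k 1) \<bullet> T \<xi>" by (simp add: T(2))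
    also have "\<dots> = (norm x *\<^sub>R axis k 1) \<bullet> \<xi>" using T(1) by (simp only: orthogonal_transformation_def)
    finally show "h (x \<bullet> T \<xi>) (norm (T \<xi>)) = h (norm x * (\<xi> \<bullet> axis k 1)) (norm \<xi>)"
      by (simp add: orthogonal_transformation_norm[OF T(1)] inner_commute)
  qed
  finally show ?thesis .
qed

lemma nn_integral_ball_slices:
  fixes w :: "real \<Rightarrow> ennreal" and b :: "'a :: euclidean_space"
  assumes [measurable]: "w \<in> borel_measurable borel" and b: "b \<in> Basis" and R: "R > 0"
  shows "(\<integral>\<^sup>+ \<xi>. w (\<xi> \<bullet> b) * indicator (cball 0 R) \<xi> \<partial>(lborel :: 'a measure)) =
    (\<integral>\<^sup>+ y. w y * indicator {-R..R} y * ennreal (unit_ball_vol (real (DIM('a) - 1)) * sqrt (R\<^sup>2 - y\<^sup>2) ^ (DIM('a) - 1)) \<partial>lborel)"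
proof -
  interpret product_sigma_finite "\<lambda>_. lborel :: real measure" by standard
  let ?A = "Basis - {b} :: 'a set"
  let ?P = "Pi\<^sub>M ?A (\<lambda>_. lborel :: real measure)"
  let ?s = "\<lambda>f. \<Sum>i\<in>Basis. f i *\<^sub>R i :: 'a"
  have Ai: "insert b ?A = Basis" "b \<notin> ?A" "finite ?A" using b by auto
  have cA: "card ?A = DIM('a) - 1" using b by simp
  have sb: "?s f \<bullet> b = f b" for f using b by simp
  have ns: "norm (?s f) = sqrt ((f b)\<^sup>2 + (\<Sum>i\<in>?A. (f i)\<^sup>2))" for f
  proof -
    have "norm (?s f) = sqrt (\<Sum>i\<in>Basis. (f i)\<^sup>2)"
      by (subst norm_eq_sqrt_inner, subst euclidean_inner) (simp add: power2_eq_square)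
    then show ?thesis using b by (simp add: sum.remove[of Basis b])
  qed
  have "(\<integral>\<^sup>+ \<xi>. w (\<xi> \<bullet> b) * indicator (cball 0 R) \<xi> \<partial>(lborel :: 'a measure)) =
     (\<integral>\<^sup>+ f. w (?s f \<bullet> b) * indicator (cball 0 R) (?s f) \<partial>(Pi\<^sub>M Basis (\<lambda>_. lborel)))"
  proof -
    have [measurable]: "(indicator (cball 0 R) :: 'a \<Rightarrow> ennreal) \<in> borel_measurable borel"
      by (rule borel_measurable_indicator) simp
    show ?thesis unfolding lborel_eq[where 'a = 'a] by (rule nn_integral_distr) measurable
  qed
  also have "\<dots> = (\<integral>\<^sup>+ f. w (f b) * indicator {..R} (sqrt ((f b)\<^sup>2 + (\<Sum>i\<in>?A. (f i)\<^sup>2))) \<partial>(Pi\<^sub>M (insert b ?A) (\<lambda>_. lborel)))"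
    unfolding sb Ai by (intro nn_integral_cong) (auto simp: indicator_def ns)
  also have "\<dots> = (\<integral>\<^sup>+ y. \<integral>\<^sup>+ f. w ((f(b := y)) b) * indicator {..R} (sqrt (((f(b := y)) b)\<^sup>2 + (\<Sum>i\<in>?A. ((f(b := y)) i)\<^sup>2))) \<partial>?P \<partial>lborel)"
    by (rule product_nn_integral_insert_rev) (use b in auto)
  also have "\<dots> = (\<integral>\<^sup>+ y. w y * indicator {-R..R} y * ennreal (unit_ball_vol (real (DIM('a) - 1)) * sqrt (R\<^sup>2 - y\<^sup>2) ^ (DIM('a) - 1)) \<partial>lborel)"
  proof (rule nn_integral_cong_AE)
    have "AE y in lborel. y \<notin> {-R, R}"
      by (intro AE_not_in countable_imp_null_set_lborel) auto
    then show "AE y in lborel. (\<integral>\<^sup>+ f. w ((f(b := y)) b) * indicator {..R} (sqrt (((f(b := y)) b)\<^sup>2 + (\<Sum>i\<in>?A. ((f(b := y)) i)\<^sup>2))) \<partial>?P)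
      = w y * indicator {-R..R} y * ennreal (unit_ball_vol (real (DIM('a) - 1)) * sqrt (R\<^sup>2 - y\<^sup>2) ^ (DIM('a) - 1))"
    proof eventually_elim
      case (elim y)
      have su: "(\<Sum>i\<in>?A. ((f(b := y)) i)\<^sup>2) = (\<Sum>i\<in>?A. (f i)\<^sup>2)" for f :: "'a \<Rightarrow> real"
        by (intro sum.cong) auto
      have sq: "sqrt (y\<^sup>2 + c) \<le> R \<longleftrightarrow> y\<^sup>2 + c \<le> R\<^sup>2" if "c \<ge> 0" for c
        using R that by (simp add: real_sqrt_le_iff')
      show ?case
      proof (cases "y \<in> {-R..R}")
        case True
        then have "\<bar>y\<bar> < R" using elim by auto
        then have "\<bar>y\<bar>\<^sup>2 < R\<^sup>2" by (intro power_strict_mono) auto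
        then have y2: "y\<^sup>2 < R\<^sup>2" by simp
        let ?B = "{f. sqrt (\<Sum>i\<in>?A. (f i)\<^sup>2) \<le> sqrt (R\<^sup>2 - y\<^sup>2)} \<inter> space ?P"
        have Bm: "?B \<in> sets ?P" by measurable
        have "(\<integral>\<^sup>+ f. w ((f(b := y)) b) * indicator {..R} (sqrt (((f(b := y)) b)\<^sup>2 + (\<Sum>i\<in>?A. ((f(b := y)) i)\<^sup>2))) \<partial>?P)
          = (\<integral>\<^sup>+ f. w y * indicator ?B f \<partial>?P)"
          unfolding su by (intro nn_integral_cong) (auto simp: indicator_def sq sum_nonneg algebra_simps)
        also have "\<dots> = w y * emeasure ?P ?B"
          using Bm by (simp add: nn_integral_cmult)
        also have "emeasure ?P ?B = ennreal (unit_ball_vol (real (DIM('a) - 1)) * sqrt (R\<^sup>2 - y\<^sup>2) ^ (DIM('a) - 1))"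
          using emeasure_cball_aux[of ?A "sqrt (R\<^sup>2 - y\<^sup>2)"] y2 unfolding cA by simp
        finally show ?thesis using True by simp
      next
        case False
        then have "R < \<bar>y\<bar>" by auto
        then have "R\<^sup>2 < \<bar>y\<bar>\<^sup>2" using R by (intro power_strict_mono) auto
        then have "R\<^sup>2 < y\<^sup>2" by simp
        then have "\<not> sqrt (y\<^sup>2 + (\<Sum>i\<in>?A. (f i)\<^sup>2)) \<le> R" for f
          using sq[of "\<Sum>i\<in>?A. (f i)\<^sup>2"] sum_nonneg[of ?A "\<lambda>i. (f i)\<^sup>2"] by simp
        then show ?thesis using False unfolding su by simp
      qed
    qed
  qed
  finally show ?thesis .
qed

lemma slice_weight_eq_power:
  assumes "\<bar>y\<bar> \<le> 1" "d > 0"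
  shows "sqrt (1 - y\<^sup>2) ^ d = slice_weight (real d / 2) y"
proof (cases "\<bar>y\<bar> = 1")
  case True
  then have "\<bar>y\<bar>\<^sup>2 = 1" by simp
  then have "y\<^sup>2 = 1" by simp
  then show ?thesis using assms by (simp add: slice_weight_def)
next
  case False
  then have "y\<^sup>2 < 1" using assms by (simp add: abs_square_less_1)
  then have p: "1 - y\<^sup>2 > 0" by simp
  have "sqrt (1 - y\<^sup>2) ^ d = sqrt (1 - y\<^sup>2) powr real d"
    by (rule powr_realpow[symmetric]) (use p in simp)
  also have "\<dots> = ((1 - y\<^sup>2) powr (1/2)) powr real d" using p by (simp add: powr_half_sqrt)
  finally show ?thesis by (simp add: slice_weight_def powr_powr)
qed

text \<open>The density \<open>1 + cos\<close> instead of \<open>cos\<close> keeps the integrand nonnegative, so that the identity can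
be read as an identity of measures.\<close>

lemma ball_cosine_integral:
  fixes x :: "real^'n"
  defines "k \<equiv> (real CARD('n) - 1) / 2" and "\<omega> \<equiv> unit_ball_vol (real (CARD('n) - 1))"
  assumes n: "CARD('n) \<ge> 2" and R: "R > 0"
  shows "(\<integral>\<^sup>+ \<xi>. ennreal (1 + cos (x \<bullet> \<xi>)) * indicator (cball 0 R) \<xi> \<partial>lborel) =
     ennreal (\<omega> * R ^ CARD('n) * (ball_transform k 0 + ball_transform k (norm x * R)))"
proof -
  define \<rho> where "\<rho> = norm x"
  obtain j :: 'n where True by simp
  have b: "axis j (1::real) \<in> Basis" by (simp add: axis_in_Basis_iff)
  have k: "k > 0" using n by (simp add: k_def)
  have kd: "k = real (CARD('n) - 1) / 2" using n by (simp add: k_def of_nat_diff)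
  have d0: "CARD('n) - 1 > 0" using n by simp
  have \<omega>: "\<omega> \<ge> 0" by (simp add: \<omega>_def)
  have "(\<integral>\<^sup>+ \<xi>. ennreal (1 + cos (x \<bullet> \<xi>)) * indicator (cball 0 R) \<xi> \<partial>lborel) =
     (\<integral>\<^sup>+ \<xi>. ennreal (1 + cos (x \<bullet> \<xi>)) * indicator {..R} (norm \<xi>) \<partial>lborel)"
    by (intro nn_integral_cong) (auto simp: indicator_def)
  also have "\<dots> = (\<integral>\<^sup>+ \<xi>. ennreal (1 + cos (\<rho> * (\<xi> \<bullet> axis j 1))) * indicator {..R} (norm \<xi>) \<partial>(lborel :: (real^'n) measure))"
    unfolding \<rho>_def by (rule nn_integral_rotate[where h = "\<lambda>u v. ennreal (1 + cos u) * indicator {..R} v"]) measurable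
  also have "\<dots> = (\<integral>\<^sup>+ \<xi>. ennreal (1 + cos (\<rho> * (\<xi> \<bullet> axis j 1))) * indicator (cball 0 R) \<xi> \<partial>(lborel :: (real^'n) measure))"
    by (intro nn_integral_cong) (auto simp: indicator_def)
  also have "\<dots> = (\<integral>\<^sup>+ y. ennreal (1 + cos (\<rho> * y)) * indicator {-R..R} y * ennreal (\<omega> * sqrt (R\<^sup>2 - y\<^sup>2) ^ (CARD('n) - 1)) \<partial>lborel)"
    using nn_integral_ball_slices[of "\<lambda>y. ennreal (1 + cos (\<rho> * y))" "axis j 1 :: real^'n" R] b R by (simp add: \<omega>_def)
  also have "\<dots> = ennreal R * (\<integral>\<^sup>+ y. ennreal (1 + cos (\<rho> * (R * y))) * indicator {-R..R} (R * y) * ennreal (\<omega> * sqrt (R\<^sup>2 - (R * y)\<^sup>2) ^ (CARD('n) - 1)) \<partial>lborel)"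
    using nn_integral_real_affine[of "\<lambda>y. ennreal (1 + cos (\<rho> * y)) * indicator {-R..R} y * ennreal (\<omega> * sqrt (R\<^sup>2 - y\<^sup>2) ^ (CARD('n) - 1))" R 0] R
    by simp
  also have "(\<integral>\<^sup>+ y. ennreal (1 + cos (\<rho> * (R * y))) * indicator {-R..R} (R * y) * ennreal (\<omega> * sqrt (R\<^sup>2 - (R * y)\<^sup>2) ^ (CARD('n) - 1)) \<partial>lborel)
     = (\<integral>\<^sup>+ y. ennreal (\<omega> * R ^ (CARD('n) - 1)) * (ennreal ((1 + cos (\<rho> * R * y)) * slice_weight k y) * indicator {-1..1} y) \<partial>lborel)"
  proof (intro nn_integral_cong)
    fix y :: real
    show "ennreal (1 + cos (\<rho> * (R * y))) * indicator {-R..R} (R * y) * ennreal (\<omega> * sqrt (R\<^sup>2 - (R * y)\<^sup>2) ^ (CARD('n) - 1))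
      = ennreal (\<omega> * R ^ (CARD('n) - 1)) * (ennreal ((1 + cos (\<rho> * R * y)) * slice_weight k y) * indicator {-1..1} y)"
    proof (cases "y \<in> {-1..1}")
      case True
      have i: "R * y \<in> {-R..R}" using True R mult_left_mono[of y 1 R] mult_left_mono[of "-1" y R] by auto
      have c: "0 \<le> 1 + cos (\<rho> * R * y)" using cos_ge_minus_one[of "\<rho> * R * y"] by linarith
      have s: "sqrt (R\<^sup>2 - (R * y)\<^sup>2) = R * sqrt (1 - y\<^sup>2)"
      proof -
        have "R\<^sup>2 - (R * y)\<^sup>2 = R\<^sup>2 * (1 - y\<^sup>2)" by (simp add: power_mult_distrib algebra_simps)
        then show ?thesis using R by (simp add: real_sqrt_mult)
      qed
      have w: "sqrt (1 - y\<^sup>2) ^ (CARD('n) - 1) = slice_weight k y"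
        unfolding kd by (rule slice_weight_eq_power) (use True d0 in auto)
      have sw: "slice_weight k y \<ge> 0" by (simp add: slice_weight_def)
      have e: "\<omega> * sqrt (R\<^sup>2 - (R * y)\<^sup>2) ^ (CARD('n) - 1) = (\<omega> * R ^ (CARD('n) - 1)) * slice_weight k y"
        unfolding s unfolding power_mult_distrib w by simp
      have swap: "ennreal P * ennreal (S * W) = ennreal S * ennreal (P * W)" if "P \<ge> 0" "S \<ge> 0" "W \<ge> 0" for P S W
        using that by (simp add: ennreal_mult mult_ac)
      have "ennreal (1 + cos (\<rho> * R * y)) * ennreal ((\<omega> * R ^ (CARD('n) - 1)) * slice_weight k y)
          = ennreal (\<omega> * R ^ (CARD('n) - 1)) * ennreal ((1 + cos (\<rho> * R * y)) * slice_weight k y)"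
        by (rule swap) (use c sw \<omega> R in auto)
      then show ?thesis unfolding e using i True by (simp add: mult.assoc)
    next
      case False
      then have "R * y \<notin> {-R..R}"
        using mult_le_cancel_left_pos[OF R, of "-1" y] mult_le_cancel_left_pos[OF R, of y 1] by auto
      then show ?thesis using False by simp
    qed
  qed
  also have "\<dots> = ennreal (\<omega> * R ^ (CARD('n) - 1)) * (\<integral>\<^sup>+ y. ennreal ((1 + cos (\<rho> * R * y)) * slice_weight k y) * indicator {-1..1} y \<partial>lborel)"
    by (rule nn_integral_cmult) (simp add: slice_weight_def)
  also have "(\<integral>\<^sup>+ y. ennreal ((1 + cos (\<rho> * R * y)) * slice_weight k y) * indicator {-1..1} y \<partial>lborel) = ennreal (ball_transform k 0 + ball_transform k (\<rho> * R))"
  proof (rule nn_integral_has_integral_lebesgue')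
    show "0 \<le> (1 + cos (\<rho> * R * y)) * slice_weight k y" for y
    proof -
      have "0 \<le> 1 + cos (\<rho> * R * y)" using cos_ge_minus_one[of "\<rho> * R * y"] by linarith
      then show ?thesis by (intro mult_nonneg_nonneg) (auto simp: slice_weight_def)
    qed
    have "((\<lambda>y. cos (0 * y) * slice_weight k y + cos (\<rho> * R * y) * slice_weight k y) has_integral (ball_transform k 0 + ball_transform k (\<rho> * R))) {-1..1}"
      unfolding ball_transform_def
      by (intro has_integral_add integrable_integral integrable_continuous_real continuous_intros slice_weight_continuous k)
    then show "((\<lambda>y. (1 + cos (\<rho> * R * y)) * slice_weight k y) has_integral (ball_transform k 0 + ball_transform k (\<rho> * R))) {-1..1}"
      by (simp add: distrib_right)
  qed
  also have "ennreal R * (ennreal (\<omega> * R ^ (CARD('n) - 1)) * ennreal (ball_transform k 0 + ball_transform k (\<rho> * R)))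
      = ennreal (\<omega> * R ^ CARD('n) * (ball_transform k 0 + ball_transform k (norm x * R)))"
  proof -
    have "R ^ CARD('n) = R * R ^ (CARD('n) - 1)" using d0 by (simp flip: power_Suc)
    then have e: "R * ((\<omega> * R ^ (CARD('n) - 1)) * b) = \<omega> * R ^ CARD('n) * b" for b by simp
    have "0 \<le> \<omega> * R ^ (CARD('n) - 1)" "0 \<le> R" using R \<omega> by auto
    then show ?thesis by (simp only: ennreal_mult'[symmetric] e \<rho>_def)
  qed
  finally show ?thesis .
qed

section \<open>Polar coordinates for radial functions\<close>

lemma ball_transform_0_pos:
  assumes k: "k > 0" shows "ball_transform k 0 > 0"
proof -
  have i: "slice_weight k integrable_on {-1..1}"
    by (intro integrable_continuous_real slice_weight_continuous k)
  have i2: "slice_weight k integrable_on {-1/2..1/2}"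
    by (rule integrable_on_subinterval[OF i]) auto
  have "0 < (3/4) powr k" by simp
  also have "\<dots> = integral {-1/2..1/2} (\<lambda>y::real. (3/4) powr k)" by simp
  also have "\<dots> \<le> integral {-1/2..1/2} (slice_weight k)"
  proof (rule integral_le)
    fix y :: real assume "y \<in> {-1/2..1/2}"
    then have "\<bar>y\<bar> \<le> 1/2" by auto
    then have "\<bar>y\<bar>\<^sup>2 \<le> (1/2)\<^sup>2" by (intro power_mono) auto
    then have "3/4 \<le> 1 - y\<^sup>2" by (simp add: power2_eq_square)
    then show "(3/4) powr k \<le> slice_weight k y"
      unfolding slice_weight_def using k by (intro powr_mono2) auto
  qed (use i2 in auto)
  also have "\<dots> \<le> integral {-1..1} (slice_weight k)"
    by (rule integral_subset_le) (use i i2 in \<open>auto simp: slice_weight_def\<close>)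
  finally have "0 < integral {-1..1} (slice_weight k)" .
  then show ?thesis by (simp add: ball_transform_def)
qed

lemma ball_transform_abs_le:
  assumes k: "k > 0" shows "\<bar>ball_transform k s\<bar> \<le> ball_transform k 0"
proof -
  have "norm (integral {-1..1} (\<lambda>y. cos (s * y) * slice_weight k y)) \<le> integral {-1..1} (slice_weight k)"
  proof (rule integral_norm_bound_integral)
    show "(\<lambda>y. cos (s * y) * slice_weight k y) integrable_on {-1..1}" "slice_weight k integrable_on {-1..1}"
      by (intro integrable_continuous_real continuous_intros slice_weight_continuous k)+
    show "norm (cos (s * y) * slice_weight k y) \<le> slice_weight k y" for y
      using mult_right_mono[OF abs_cos_le_one, of "slice_weight k y" "s * y"] by (simp add: abs_mult slice_weight_def)
  qed
  then show ?thesis by (simp add: ball_transform_def)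
qed

lemma measure_eqI_atMost:
  fixes M N :: "real measure"
  assumes sets: "sets M = sets borel" "sets N = sets borel"
    and eq: "\<And>R. emeasure M {..R} = emeasure N {..R}" and fin: "\<And>R. emeasure M {..R} \<noteq> \<infinity>"
  shows "M = N"
proof (rule measure_eqI_generator_eq[where E = "range (\<lambda>a. {..a})" and \<Omega> = UNIV and A = "\<lambda>i. {..real i}"])
  have b: "sets (borel :: real measure) = sigma_sets UNIV (range (\<lambda>a. {..a}))"
    by (subst borel_eq_atMost) simp
  show "sets M = sigma_sets UNIV (range (\<lambda>a. {..a}))" "sets N = sigma_sets UNIV (range (\<lambda>a. {..a}))"
    using sets b by simp_all
  show "Int_stable (range (\<lambda>a::real. {..a}))"
    by (auto simp: Int_stable_def)
  show "(\<Union>i. {..real i}) = UNIV" by (auto simp: real_arch_simple)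
qed (use eq fin in auto)

text \<open>The derivative with respect to \<open>R\<close> of the integral of \<open>1 + cos (x \<bullet> \<xi>)\<close> over the ball of radius \<open>R\<close>,
for \<open>norm x = \<rho>\<close>.\<close>

definition radial_density :: "nat \<Rightarrow> real \<Rightarrow> real \<Rightarrow> real" where
  "radial_density n \<rho> r = unit_ball_vol (real (n - 1)) * r ^ (n - 1) *
     (sphere_transform ((real n - 1) / 2) 0 + sphere_transform ((real n - 1) / 2) (\<rho> * r)) * indicator {0..} r"

lemma radial_density_measurable [measurable]:
  assumes "n \<ge> 2" shows "radial_density n \<rho> \<in> borel_measurable borel"
proof -
  have "(real n - 1) / 2 > 0" using assms by simp
  from sphere_transform_continuous[OF this]
  have "sphere_transform ((real n - 1) / 2) \<in> borel_measurable borel" by (rule borel_measurable_continuous_onI)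
  note [measurable] = this
  show ?thesis unfolding radial_density_def[abs_def] by measurable
qed

text \<open>With \<open>2 * k + 1 = n\<close>, the product rule reproduces the definition of \<open>sphere_transform\<close>.\<close>

lemma ball_mass_has_derivative:
  fixes n :: nat
  assumes n: "n \<ge> 2" and k: "k = (real n - 1) / 2"
  shows "((\<lambda>R. \<omega> * R ^ n * (ball_transform k 0 + ball_transform k (\<rho> * R))) has_real_derivative
    \<omega> * R ^ (n - 1) * (sphere_transform k 0 + sphere_transform k (\<rho> * R))) (at R)"
proof -
  have k0: "k > 0" using n k by simp
  have kn: "2 * k + 1 = real n" using k by simp
  have R: "R ^ n = R * R ^ (n - 1)" using n by (simp flip: power_Suc)
  have d: "((\<lambda>R. ball_transform k (\<rho> * R)) has_real_derivative ball_transform_deriv k (\<rho> * R) * \<rho>) (at R)"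
    by (rule DERIV_chain2[OF ball_transform_has_derivative[OF k0]]) (auto intro!: derivative_eq_intros)
  have "((\<lambda>R. \<omega> * R ^ n * (ball_transform k 0 + ball_transform k (\<rho> * R))) has_real_derivative
     (\<omega> * (real n * R ^ (n - 1))) * (ball_transform k 0 + ball_transform k (\<rho> * R)) + ball_transform_deriv k (\<rho> * R) * \<rho> * (\<omega> * R ^ n)) (at R)"
    by (rule derivative_eq_intros d refl)+ simp
  also have "(\<omega> * (real n * R ^ (n - 1))) * (ball_transform k 0 + ball_transform k (\<rho> * R)) + ball_transform_deriv k (\<rho> * R) * \<rho> * (\<omega> * R ^ n)
    = \<omega> * R ^ (n - 1) * (sphere_transform k 0 + sphere_transform k (\<rho> * R))"
    unfolding sphere_transform_def kn R by (simp add: algebra_simps)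
  finally show ?thesis .
qed

text \<open>The integral over a ball increases with the radius, so its derivative is nonnegative.\<close>

lemma radial_density_nonneg:
  fixes x :: "real^'n"
  assumes n: "CARD('n) \<ge> 2"
  shows "radial_density CARD('n) (norm x) r \<ge> 0"
proof (cases "r > 0")
  case True
  define k where "k = (real CARD('n) - 1) / 2"
  define \<omega> where "\<omega> = unit_ball_vol (real (CARD('n) - 1))"
  have k: "k > 0" using n by (simp add: k_def)
  let ?\<Theta> = "\<lambda>R. \<omega> * R ^ CARD('n) * (ball_transform k 0 + ball_transform k (norm x * R))"
  have nn: "?\<Theta> R \<ge> 0" if "R > 0" for R
    using that ball_transform_abs_le[OF k, of "norm x * R"] by (intro mult_nonneg_nonneg) (auto simp: \<omega>_def abs_le_iff)
  have "mono_on {0<..} ?\<Theta>"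
  proof (rule mono_onI)
    fix R S :: real assume RS: "R \<in> {0<..}" "S \<in> {0<..}" "R \<le> S"
    have "ennreal (?\<Theta> R) = (\<integral>\<^sup>+ \<xi>. ennreal (1 + cos (x \<bullet> \<xi>)) * indicator (cball 0 R) \<xi> \<partial>lborel)"
      using ball_cosine_integral[OF n, of R x] RS by (simp add: k_def \<omega>_def)
    also have "\<dots> \<le> (\<integral>\<^sup>+ \<xi>. ennreal (1 + cos (x \<bullet> \<xi>)) * indicator (cball 0 S) \<xi> \<partial>lborel)"
      using RS by (intro nn_integral_mono mult_left_mono) (auto simp: indicator_def)
    also have "\<dots> = ennreal (?\<Theta> S)"
      using ball_cosine_integral[OF n, of S x] RS by (simp add: k_def \<omega>_def)
    finally show "?\<Theta> R \<le> ?\<Theta> S" using nn[of S] RS by (simp add: ennreal_le_iff)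
  qed
  then have "0 \<le> \<omega> * r ^ (CARD('n) - 1) * (sphere_transform k 0 + sphere_transform k (norm x * r))"
    by (rule mono_on_imp_deriv_nonneg[OF _ ball_mass_has_derivative[OF n k_def]])
       (use True in \<open>simp add: interior_open\<close>)
  then show ?thesis using True by (simp add: radial_density_def k_def \<omega>_def)
next
  case False
  have z: "radial_density CARD('n) (norm x) 0 = 0" using n by (simp add: radial_density_def)
  consider "r = 0" | "r < 0" using False by linarith
  then show ?thesis
  proof cases
    case 1
    then show ?thesis by (simp only: z order_refl)
  next
    case 2
    then show ?thesis by (simp add: radial_density_def)
  qed
qed

text \<open>Both measures give the same mass to every half-line \<open>{..R}\<close>, by \<open>ball_cosine_integral\<close> on the left and
the fundamental theorem of calculus on the right.\<close>

theorem norm_pushforward: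
  fixes x :: "real^'n"
  assumes n: "CARD('n) \<ge> 2"
  shows "distr (density lborel (\<lambda>\<xi>. ennreal (1 + cos (x \<bullet> \<xi>)))) borel norm =
    density lborel (\<lambda>r. ennreal (radial_density CARD('n) (norm x) r))"
proof (rule measure_eqI_atMost)
  define k where "k = (real CARD('n) - 1) / 2"
  define \<omega> where "\<omega> = unit_ball_vol (real (CARD('n) - 1))"
  have k: "k > 0" using n by (simp add: k_def)
  let ?\<Theta> = "\<lambda>R. \<omega> * R ^ CARD('n) * (ball_transform k 0 + ball_transform k (norm x * R))"
  let ?M = "distr (density lborel (\<lambda>\<xi>. ennreal (1 + cos (x \<bullet> \<xi>)))) borel norm"
  let ?N = "density lborel (\<lambda>r. ennreal (radial_density CARD('n) (norm x) r))"
  note [measurable] = radial_density_measurable[OF n]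
  have M: "emeasure ?M {..R} = (\<integral>\<^sup>+ \<xi>. ennreal (1 + cos (x \<bullet> \<xi>)) * indicator (cball 0 R) \<xi> \<partial>lborel)" for R
  proof -
    have "emeasure ?M {..R} = emeasure (density lborel (\<lambda>\<xi>. ennreal (1 + cos (x \<bullet> \<xi>)))) (cball 0 R)"
      by (subst emeasure_distr) (auto intro!: arg_cong2[where f = emeasure])
    also have "\<dots> = (\<integral>\<^sup>+ \<xi>. ennreal (1 + cos (x \<bullet> \<xi>)) * indicator (cball 0 R) \<xi> \<partial>lborel)"
      by (rule emeasure_density) auto
    finally show ?thesis .
  qed
  have N: "emeasure ?N {..R} = (\<integral>\<^sup>+ r. ennreal (radial_density CARD('n) (norm x) r) * indicator {..R} r \<partial>lborel)" for R
    by (rule emeasure_density) auto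
  have eq: "emeasure ?M {..R} = emeasure ?N {..R} \<and> emeasure ?M {..R} \<noteq> \<infinity>" for R
  proof (cases "R > 0")
    case True
    have c: "continuous_on UNIV (\<lambda>r. \<omega> * r ^ (CARD('n) - 1) * (sphere_transform k 0 + sphere_transform k (norm x * r)))"
      by (intro continuous_intros continuous_on_compose2[OF sphere_transform_continuous[OF k, of UNIV]]) auto
    have re: "radial_density CARD('n) (norm x) r = \<omega> * r ^ (CARD('n) - 1) * (sphere_transform k 0 + sphere_transform k (norm x * r))" if "r \<ge> 0" for r
      using that by (simp add: radial_density_def k_def \<omega>_def)
    have "emeasure ?N {..R} = (\<integral>\<^sup>+ r. ennreal (\<omega> * r ^ (CARD('n) - 1) * (sphere_transform k 0 + sphere_transform k (norm x * r))) * indicator {0..R} r \<partial>lborel)"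
      unfolding N by (intro nn_integral_cong) (auto simp: radial_density_def k_def \<omega>_def indicator_def)
    also have "\<dots> = ennreal (?\<Theta> R - ?\<Theta> 0)"
    proof (rule nn_integral_FTC_Icc)
      show "(\<lambda>r. \<omega> * r ^ (CARD('n) - 1) * (sphere_transform k 0 + sphere_transform k (norm x * r))) \<in> borel_measurable borel"
        by (rule borel_measurable_continuous_onI[OF c])
      show "(?\<Theta> has_real_derivative \<omega> * r ^ (CARD('n) - 1) * (sphere_transform k 0 + sphere_transform k (norm x * r))) (at r)" for r
        by (rule ball_mass_has_derivative[OF n k_def])
      show "0 \<le> \<omega> * r ^ (CARD('n) - 1) * (sphere_transform k 0 + sphere_transform k (norm x * r))" if "r \<in> {0..R}" for r
        using radial_density_nonneg[OF n, of x r] re[of r] that by simp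
    qed (use True in simp)
    also have "?\<Theta> R - ?\<Theta> 0 = ?\<Theta> R" by simp
    also have "ennreal (?\<Theta> R) = emeasure ?M {..R}"
      unfolding M using ball_cosine_integral[OF n True, of x] by (simp add: k_def \<omega>_def)
    finally have e: "emeasure ?N {..R} = emeasure ?M {..R}" .
    have "emeasure ?M {..R} = ennreal (?\<Theta> R)"
      unfolding M using ball_cosine_integral[OF n True, of x] by (simp add: k_def \<omega>_def)
    then show ?thesis using e by simp
  next
    case False
    have "emeasure ?M {..R} = (\<integral>\<^sup>+ \<xi>. 0 \<partial>(lborel :: (real^'n) measure))"
      unfolding M
    proof (rule nn_integral_cong_AE)
      show "AE \<xi> in lborel. ennreal (1 + cos (x \<bullet> \<xi>)) * indicator (cball 0 R) \<xi> = 0"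
        using AE_lborel_singleton[of "0 :: real^'n"]
      proof eventually_elim
        case (elim \<xi>)
        then have "norm \<xi> > 0" by simp
        then have "\<not> norm \<xi> \<le> R" using False by linarith
        then have "\<xi> \<notin> cball 0 R" by simp
        then show ?case by simp
      qed
    qed
    moreover have "emeasure ?N {..R} = (\<integral>\<^sup>+ r. 0 \<partial>(lborel :: real measure))"
      unfolding N
    proof (rule nn_integral_cong_AE)
      show "AE r in lborel. ennreal (radial_density CARD('n) (norm x) r) * indicator {..R} r = 0"
        using AE_lborel_singleton[of "0 :: real"]
        by eventually_elim (use False in \<open>auto simp: radial_density_def indicator_def\<close>)
    qed
    ultimately show ?thesis by simp
  qed
  show "emeasure ?M {..R} = emeasure ?N {..R}" for R by (rule conjunct1[OF eq])
  show "emeasure ?M {..R} \<noteq> \<infinity>" for R by (rule conjunct2[OF eq])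
qed simp_all

definition radial_weight :: "nat \<Rightarrow> real \<Rightarrow> real" where
  "radial_weight n r = unit_ball_vol (real (n - 1)) * r ^ (n - 1) * indicator {0..} r"

lemma radial_weight_measurable [measurable]: "radial_weight n \<in> borel_measurable borel"
  unfolding radial_weight_def[abs_def] by measurable

lemma radial_weight_nonneg: "radial_weight n r \<ge> 0"
  by (simp add: radial_weight_def indicator_def)

lemma sphere_transform_0_pos: "k > 0 \<Longrightarrow> sphere_transform k 0 > 0"
  using ball_transform_0_pos[of k] by (simp add: sphere_transform_def)

theorem nn_integral_polar:
  fixes \<phi> :: "real \<Rightarrow> ennreal"
  assumes n: "CARD('n) \<ge> 2" and [measurable]: "\<phi> \<in> borel_measurable borel"
  shows "(\<integral>\<^sup>+ \<xi>. \<phi> (norm \<xi>) \<partial>(lborel :: (real^'n) measure)) =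
     ennreal (sphere_transform ((real CARD('n) - 1) / 2) 0) * (\<integral>\<^sup>+ r. ennreal (radial_weight CARD('n) r) * \<phi> r \<partial>lborel)"
proof -
  define k where "k = (real CARD('n) - 1) / 2"
  have k: "k > 0" using n by (simp add: k_def)
  have J: "sphere_transform k 0 > 0" by (rule sphere_transform_0_pos[OF k])
  note [measurable] = radial_density_measurable[OF n]
  have "2 * (\<integral>\<^sup>+ \<xi>. \<phi> (norm \<xi>) \<partial>(lborel :: (real^'n) measure)) = (\<integral>\<^sup>+ \<xi>. ennreal (1 + cos (0 \<bullet> \<xi>)) * \<phi> (norm \<xi>) \<partial>(lborel :: (real^'n) measure))"
    by (simp add: nn_integral_cmult)
  also have "\<dots> = (\<integral>\<^sup>+ r. \<phi> r \<partial>distr (density lborel (\<lambda>\<xi>. ennreal (1 + cos ((0 :: real^'n) \<bullet> \<xi>)))) borel norm)"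
    by (subst nn_integral_distr) (auto simp: nn_integral_density simp del: inner_zero_left)
  also have "\<dots> = (\<integral>\<^sup>+ r. ennreal (radial_density CARD('n) (norm (0 :: real^'n)) r) * \<phi> r \<partial>lborel)"
    unfolding norm_pushforward[OF n] by (rule nn_integral_density) measurable
  also have "\<dots> = (\<integral>\<^sup>+ r. (2 * ennreal (sphere_transform k 0)) * (ennreal (radial_weight CARD('n) r) * \<phi> r) \<partial>lborel)"
  proof (rule nn_integral_cong)
    fix r
    have "radial_density CARD('n) (norm (0 :: real^'n)) r = 2 * sphere_transform k 0 * radial_weight CARD('n) r"
      by (simp add: radial_density_def radial_weight_def k_def)
    then have "ennreal (radial_density CARD('n) (norm (0 :: real^'n)) r) = 2 * ennreal (sphere_transform k 0) * ennreal (radial_weight CARD('n) r)"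
      using J radial_weight_nonneg[of "CARD('n)" r] by (simp add: ennreal_mult)
    then show "ennreal (radial_density CARD('n) (norm (0 :: real^'n)) r) * \<phi> r = (2 * ennreal (sphere_transform k 0)) * (ennreal (radial_weight CARD('n) r) * \<phi> r)"
      by (simp only: mult.assoc)
  qed
  also have "\<dots> = 2 * (ennreal (sphere_transform k 0) * (\<integral>\<^sup>+ r. ennreal (radial_weight CARD('n) r) * \<phi> r \<partial>lborel))"
    by (simp add: nn_integral_cmult mult.assoc)
  finally show ?thesis by (simp add: ennreal_mult_cancel_left k_def)
qed

text \<open>The push-forward formula at \<open>x\<close> minus half of the formula at 0 leaves the cosine part; the sine part
vanishes by the symmetry \<open>\<xi> \<mapsto> - \<xi>\<close>.\<close>

theorem fourier_polar:
  fixes x :: "real^'n" and F0 :: "real \<Rightarrow> complex"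
  assumes n: "CARD('n) \<ge> 2" and F0 [measurable]: "F0 \<in> borel_measurable borel"
    and int: "integrable (lborel :: (real^'n) measure) (\<lambda>\<xi>. F0 (norm \<xi>))"
  shows "(LINT \<xi>|lborel. cis (x \<bullet> \<xi>) * F0 (norm \<xi>)) =
    (LINT r|lborel. of_real (radial_weight CARD('n) r * sphere_transform ((real CARD('n) - 1) / 2) (norm x * r)) * F0 r)"
proof -
  define k where "k = (real CARD('n) - 1) / 2"
  define W where "W = radial_weight CARD('n)"
  let ?J = "sphere_transform k"
  note [measurable] = radial_density_measurable[OF n]
  have c0: "0 \<le> 1 + cos t" for t :: real using cos_ge_minus_one[of t] by linarith
  have ci: "integrable lborel (\<lambda>\<xi>. cos (y \<bullet> \<xi>) *\<^sub>R F0 (norm \<xi>))" for y :: "real^'n"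
    by (rule Bochner_Integration.integrable_bound[OF int]) (auto intro!: mult_left_le_one_le)
  have si: "integrable lborel (\<lambda>\<xi>. sin (y \<bullet> \<xi>) *\<^sub>R F0 (norm \<xi>))" for y :: "real^'n"
    by (rule Bochner_Integration.integrable_bound[OF int]) (auto intro!: mult_left_le_one_le)
  have dens: "radial_density CARD('n) \<rho> r = W r * (?J 0 + ?J (\<rho> * r))" for \<rho> r
    by (simp add: radial_density_def W_def radial_weight_def k_def)
  have P: "(LINT \<xi>|lborel. (1 + cos (y \<bullet> \<xi>)) *\<^sub>R F0 (norm \<xi>)) = (LINT r|lborel. (W r * (?J 0 + ?J (norm y * r))) *\<^sub>R F0 r)"
    and Pi: "integrable lborel (\<lambda>r. (W r * (?J 0 + ?J (norm y * r))) *\<^sub>R F0 r)" for y :: "real^'n"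
  proof -
    let ?M = "density lborel (\<lambda>\<xi>. ennreal (1 + cos (y \<bullet> \<xi>)))"
    have "(LINT \<xi>|lborel. (1 + cos (y \<bullet> \<xi>)) *\<^sub>R F0 (norm \<xi>)) = (LINT \<xi>|?M. F0 (norm \<xi>))"
      by (rule integral_density[symmetric]) (auto simp: c0)
    also have "\<dots> = (LINT r|distr ?M borel norm. F0 r)"
      by (rule integral_distr[symmetric]) auto
    also have "\<dots> = (LINT r|lborel. radial_density CARD('n) (norm y) r *\<^sub>R F0 r)"
      unfolding norm_pushforward[OF n] by (rule integral_density) (auto simp: radial_density_nonneg[OF n])
    finally show "(LINT \<xi>|lborel. (1 + cos (y \<bullet> \<xi>)) *\<^sub>R F0 (norm \<xi>)) = (LINT r|lborel. (W r * (?J 0 + ?J (norm y * r))) *\<^sub>R F0 r)"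
      by (simp only: dens)
    have "integrable lborel (\<lambda>\<xi>. F0 (norm \<xi>) + cos (y \<bullet> \<xi>) *\<^sub>R F0 (norm \<xi>))"
      by (intro Bochner_Integration.integrable_add int ci)
    then have "integrable lborel (\<lambda>\<xi>. (1 + cos (y \<bullet> \<xi>)) *\<^sub>R F0 (norm \<xi>))" by (simp add: scaleR_add_left)
    then have "integrable ?M (\<lambda>\<xi>. F0 (norm \<xi>))" by (subst integrable_density) (auto simp: c0)
    then have "integrable (distr ?M borel norm) F0" by (subst integrable_distr_eq) auto
    then have "integrable lborel (\<lambda>r. radial_density CARD('n) (norm y) r *\<^sub>R F0 r)"
      unfolding norm_pushforward[OF n] by (subst (asm) integrable_density) (auto simp: radial_density_nonneg[OF n])
    then show "integrable lborel (\<lambda>r. (W r * (?J 0 + ?J (norm y * r))) *\<^sub>R F0 r)" by (simp only: dens)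
  qed
  have i0: "integrable lborel (\<lambda>r. (1/2) *\<^sub>R ((W r * (?J 0 + ?J (norm (0 :: real^'n) * r))) *\<^sub>R F0 r))"
    by (intro integrable_scaleR_right Pi)
  have e0: "(1/2) *\<^sub>R ((W r * (?J 0 + ?J (norm (0 :: real^'n) * r))) *\<^sub>R F0 r) = (W r * ?J 0) *\<^sub>R F0 r" for r
    by simp
  have "(LINT \<xi>|(lborel :: (real^'n) measure). F0 (norm \<xi>)) = (1/2) *\<^sub>R (LINT \<xi>|lborel. (1 + cos ((0 :: real^'n) \<bullet> \<xi>)) *\<^sub>R F0 (norm \<xi>))"
    by simp
  also have "\<dots> = (LINT r|lborel. (1/2) *\<^sub>R ((W r * (?J 0 + ?J (norm (0 :: real^'n) * r))) *\<^sub>R F0 r))"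
    unfolding P by (rule integral_scaleR_right[symmetric])
  finally have F: "(LINT \<xi>|(lborel :: (real^'n) measure). F0 (norm \<xi>)) = (LINT r|lborel. (W r * ?J 0) *\<^sub>R F0 r)"
    unfolding e0 .
  have "(LINT \<xi>|lborel. cos (x \<bullet> \<xi>) *\<^sub>R F0 (norm \<xi>)) =
      (LINT \<xi>|lborel. (1 + cos (x \<bullet> \<xi>)) *\<^sub>R F0 (norm \<xi>)) - (LINT \<xi>|(lborel :: (real^'n) measure). F0 (norm \<xi>))"
    using Bochner_Integration.integral_add[OF int ci[of x]] by (simp add: scaleR_add_left)
  also have "\<dots> = (LINT r|lborel. (W r * (?J 0 + ?J (norm x * r))) *\<^sub>R F0 r - (W r * ?J 0) *\<^sub>R F0 r)"
    unfolding P F using Pi[of x] i0 unfolding e0 by (subst Bochner_Integration.integral_diff) auto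
  also have "\<dots> = (LINT r|lborel. of_real (W r * ?J (norm x * r)) * F0 r)"
    by (intro Bochner_Integration.integral_cong) (auto simp: scaleR_conv_of_real algebra_simps)
  finally have cosI: "(LINT \<xi>|lborel. cos (x \<bullet> \<xi>) *\<^sub>R F0 (norm \<xi>)) = (LINT r|lborel. of_real (W r * ?J (norm x * r)) * F0 r)" .
  have "(LINT \<xi>|lborel. sin (x \<bullet> \<xi>) *\<^sub>R F0 (norm \<xi>)) = (LINT \<xi>|distr lborel borel uminus. sin (x \<bullet> \<xi>) *\<^sub>R F0 (norm \<xi>))"
  proof -
    have "orthogonal_transformation (uminus :: real^'n \<Rightarrow> real^'n)"
      by (simp add: orthogonal_transformation_def linear_uminus)
    then show ?thesis by (simp add: lborel_distr_orthogonal)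
  qed
  also have "\<dots> = - (LINT \<xi>|lborel. sin (x \<bullet> \<xi>) *\<^sub>R F0 (norm \<xi>))"
    by (subst integral_distr) auto
  finally have sinI: "(LINT \<xi>|lborel. sin (x \<bullet> \<xi>) *\<^sub>R F0 (norm \<xi>)) = 0" by simp
  have "(LINT \<xi>|lborel. cis (x \<bullet> \<xi>) * F0 (norm \<xi>)) =
     (LINT \<xi>|lborel. cos (x \<bullet> \<xi>) *\<^sub>R F0 (norm \<xi>) + \<i> * (sin (x \<bullet> \<xi>) *\<^sub>R F0 (norm \<xi>)))"
    by (intro Bochner_Integration.integral_cong)
       (auto simp: cis.ctr complex_eq_iff algebra_simps)
  also have "\<dots> = (LINT \<xi>|lborel. cos (x \<bullet> \<xi>) *\<^sub>R F0 (norm \<xi>)) + \<i> * (LINT \<xi>|lborel. sin (x \<bullet> \<xi>) *\<^sub>R F0 (norm \<xi>))"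
    unfolding integral_mult_right_zero[symmetric]
    by (intro Bochner_Integration.integral_add ci integrable_mult_right si)
  finally show ?thesis by (simp add: cosI sinI W_def k_def)
qed

section \<open>The maximal estimate for radial functions\<close>

lemma fourier_cong_norm:
  fixes f :: "real^'n \<Rightarrow> complex"
  assumes f [measurable]: "f \<in> borel_measurable borel" and rad: "radial f" and eq: "norm \<xi> = norm \<eta>"
  shows "fourier f \<xi> = fourier f \<eta>"
proof -
  obtain T :: "real^'n \<Rightarrow> real^'n" where T: "orthogonal_transformation T" "T \<xi> = \<eta>"
    using orthogonal_transformation_exists[OF eq] by blast
  note [measurable] = orthogonal_transformation_measurable[OF T(1)]
  obtain g where g: "\<And>x. f x = g (norm x)" using rad unfolding radial_def by blast
  have fT: "f (T x) = f x" for x by (simp add: g orthogonal_transformation_norm[OF T(1)])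
  have iT: "T x \<bullet> \<eta> = x \<bullet> \<xi>" for x
    unfolding T(2)[symmetric] using T(1) by (simp only: orthogonal_transformation_def)
  have "fourier f \<eta> = (LINT x|distr lborel borel T. exp (- (\<i> * complex_of_real (x \<bullet> \<eta>))) * f x)"
    by (simp add: fourier_def lborel_distr_orthogonal[OF T(1)])
  also have "\<dots> = (LINT x|lborel. exp (- (\<i> * complex_of_real (T x \<bullet> \<eta>))) * f (T x))"
    by (rule integral_distr) measurable
  also have "\<dots> = fourier f \<xi>" by (simp add: fourier_def fT iT)
  finally show ?thesis by simp
qed

lemma norm_sum3_square_le:
  fixes x y z :: complex
  shows "(cmod (x + y + z))\<^sup>2 \<le> 3 * ((cmod x)\<^sup>2 + (cmod y)\<^sup>2 + (cmod z)\<^sup>2)"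
proof -
  have "cmod (x + y + z) \<le> cmod x + cmod y + cmod z"
    by (intro norm_triangle_le add_right_mono norm_triangle_ineq)
  then have "(cmod (x + y + z))\<^sup>2 \<le> (cmod x + cmod y + cmod z)\<^sup>2" by (intro power_mono) auto
  also have "\<dots> \<le> 3 * ((cmod x)\<^sup>2 + (cmod y)\<^sup>2 + (cmod z)\<^sup>2)"
  proof -
    have "0 \<le> (cmod x - cmod y)\<^sup>2 + (cmod y - cmod z)\<^sup>2 + (cmod x - cmod z)\<^sup>2" by simp
    then show ?thesis by (simp add: power2_eq_square algebra_simps)
  qed
  finally show ?thesis .
qed

text \<open>Near 0 the weighted \<open>L\<^sup>2\<close> bound controls \<open>g\<close>; beyond 1 the integrability of \<open>F0\<close> against \<open>r ^ m\<close>
does, since \<open>r powr k \<le> r ^ m\<close> there.\<close>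

lemma radial_profile_integrable:
  fixes g :: "real \<Rightarrow> complex" and F0 :: "real \<Rightarrow> complex"
  assumes [measurable]: "g \<in> borel_measurable borel" "F0 \<in> borel_measurable borel"
    and g: "\<And>r. r > 0 \<Longrightarrow> cmod (g r) = r powr k * cmod (F0 r)" "\<And>r. r \<le> 0 \<Longrightarrow> g r = 0"
    and k: "k > 0" "2 * k = real m" and s: "s > 0"
    and sq: "sobolev_mass s g < top"
    and l1: "(\<integral>\<^sup>+ r. ennreal (r ^ m * indicator {0..} r) * ennreal (cmod (F0 r)) \<partial>lborel) < top"
  shows "integrable lborel g"
proof (rule integrableI_bounded)
  have "(\<integral>\<^sup>+ r. ennreal (cmod (g r)) \<partial>lborel) \<le>
    (\<integral>\<^sup>+ r. indicator {0..1} r + ennreal ((1 + r\<^sup>2) powr s * (cmod (g r))\<^sup>2) + ennreal (r ^ m * indicator {0..} r) * ennreal (cmod (F0 r)) \<partial>lborel)"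
  proof (rule nn_integral_mono)
    fix r :: real
    consider "r \<le> 0" | "0 < r" "r \<le> 1" | "r > 1" by linarith
    then show "ennreal (cmod (g r)) \<le> indicator {0..1} r + ennreal ((1 + r\<^sup>2) powr s * (cmod (g r))\<^sup>2) + ennreal (r ^ m * indicator {0..} r) * ennreal (cmod (F0 r))"
    proof cases
      case 1
      then show ?thesis by (simp add: g(2))
    next
      case 2
      have "1 \<le> (1 + r\<^sup>2) powr s" using s by (intro ge_one_powr_ge_zero) auto
      then have "1 * (cmod (g r))\<^sup>2 \<le> (1 + r\<^sup>2) powr s * (cmod (g r))\<^sup>2" by (intro mult_right_mono) auto
      moreover have "cmod (g r) \<le> 1 + (cmod (g r))\<^sup>2"
      proof -
        have "0 \<le> (cmod (g r) - 1)\<^sup>2" by simp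
        then have "2 * cmod (g r) \<le> 1 + (cmod (g r))\<^sup>2" by (simp add: power2_eq_square algebra_simps)
        then show ?thesis using norm_ge_zero[of "g r"] by linarith
      qed
      ultimately have "ennreal (cmod (g r)) \<le> ennreal (1 + (1 + r\<^sup>2) powr s * (cmod (g r))\<^sup>2)"
        by (intro ennreal_leI) linarith
      then have "ennreal (cmod (g r)) \<le> 1 + ennreal ((1 + r\<^sup>2) powr s * (cmod (g r))\<^sup>2)" by simp
      then have "ennreal (cmod (g r)) \<le> indicator {0..1} r + ennreal ((1 + r\<^sup>2) powr s * (cmod (g r))\<^sup>2)"
        using 2 by simp
      then show ?thesis by (rule add_increasing2[rotated]) simp
    next
      case 3
      have "r powr k \<le> r powr (2 * k)" using 3 k by (intro powr_mono) auto
      also have "\<dots> = r ^ m" using 3 by (simp add: k powr_realpow)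
      finally have "cmod (g r) \<le> r ^ m * cmod (F0 r)" using 3 by (simp add: g(1) mult_right_mono)
      then have "ennreal (cmod (g r)) \<le> ennreal (r ^ m * indicator {0..} r) * ennreal (cmod (F0 r))"
        using 3 by (simp add: ennreal_leI flip: ennreal_mult)
      then show ?thesis by (intro add_increasing) auto
    qed
  qed
  also have "\<dots> = (\<integral>\<^sup>+ r. indicator {0..1::real} r \<partial>lborel) + sobolev_mass s g
     + (\<integral>\<^sup>+ r. ennreal (r ^ m * indicator {0..} r) * ennreal (cmod (F0 r)) \<partial>lborel)"
    by (simp add: nn_integral_add)
  also have "\<dots> < \<infinity>" using sq l1 by simp
  finally show "(\<integral>\<^sup>+ r. ennreal (cmod (g r)) \<partial>lborel) < \<infinity>" .
qed simp

text \<open>The asymptotic formula splits the integral into the one-dimensional solution at \<open>\<rho>\<close> and at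
\<open>- \<rho>\<close>, and an error term that is dominated without regard to \<open>t\<close>.\<close>

lemma sphere_transform_split:
  fixes g :: "real \<Rightarrow> complex"
  assumes k: "k > 0" and g: "integrable lborel g" and g0: "\<And>r. r \<le> 0 \<Longrightarrow> g r = 0"
    and as: "\<And>s. s > 0 \<Longrightarrow> cmod (of_real (s powr k * sphere_transform k s) - (A * cis s + B * cis (- s))) \<le> M * min 1 (1 / s)"
    and M: "M > 0" and \<rho>: "\<rho> > 0"
  shows "ennreal ((cmod (LINT r|lborel. of_real ((r * \<rho>) powr k * sphere_transform k (r * \<rho>)) * (cis (t * r powr a) * g r)))\<^sup>2)
    \<le> 3 * (ennreal ((cmod A)\<^sup>2) * ennreal ((cmod (osc_transform a t g \<rho>))\<^sup>2) +
           ennreal ((cmod B)\<^sup>2) * ennreal ((cmod (osc_transform a t g (- \<rho>)))\<^sup>2) +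
           ennreal (M\<^sup>2) * (\<integral>\<^sup>+ r. ennreal (min 1 (1 / (r * \<rho>))) * ennreal (cmod (g r)) * indicator {0<..} r \<partial>lborel)\<^sup>2)"
proof -
  note [measurable] = borel_measurable_integrable[OF g]
  have [measurable]: "sphere_transform k \<in> borel_measurable borel"
    by (rule borel_measurable_continuous_onI[OF sphere_transform_continuous[OF k]])
  let ?V = "\<lambda>r. complex_of_real ((r * \<rho>) powr k * sphere_transform k (r * \<rho>))"
  let ?p = "\<lambda>r. cis (t * r powr a)"
  define E where "E r = ?V r - (A * cis (r * \<rho>) + B * cis (- (r * \<rho>)))" for r
  have [measurable]: "E \<in> borel_measurable borel" unfolding E_def[abs_def] by measurable
  have Eb: "cmod (E r * (?p r * g r)) \<le> M * min 1 (1 / (r * \<rho>)) * cmod (g r)" if "r > 0" for r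
    using mult_right_mono[OF as[of "r * \<rho>"], of "cmod (g r)"] that \<rho> by (simp add: E_def norm_mult)
  have Ei: "integrable lborel (\<lambda>r. E r * (?p r * g r))"
  proof (rule Bochner_Integration.integrable_bound[where f = "\<lambda>r. M * cmod (g r)"])
    show "AE r in lborel. norm (E r * (?p r * g r)) \<le> norm (M * cmod (g r))"
    proof (rule AE_I2)
      fix r
      show "norm (E r * (?p r * g r)) \<le> norm (M * cmod (g r))"
      proof (cases "r > 0")
        case True
        have "M * min 1 (1 / (r * \<rho>)) * cmod (g r) \<le> M * 1 * cmod (g r)"
          using M by (intro mult_right_mono mult_left_mono) auto
        then show ?thesis using order_trans[OF Eb[OF True]] M by simp
      qed (simp add: g0)
    qed
  qed (use g in auto)
  have oi: "integrable lborel (\<lambda>r. cis (r * y + t * r powr a) * g r)" for y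
    by (rule Bochner_Integration.integrable_bound[OF g]) (auto simp: norm_mult)
  have "(LINT r|lborel. ?V r * (?p r * g r)) =
     (LINT r|lborel. A * (cis (r * \<rho> + t * r powr a) * g r) + B * (cis (r * (- \<rho>) + t * r powr a) * g r) + E r * (?p r * g r))"
  proof (rule Bochner_Integration.integral_cong[OF refl])
    fix r
    have c: "cis (r * \<rho> + t * r powr a) = cis (r * \<rho>) * ?p r" "cis (r * (- \<rho>) + t * r powr a) = cis (- (r * \<rho>)) * ?p r"
      by (simp_all add: cis_mult)
    show "?V r * (?p r * g r) = A * (cis (r * \<rho> + t * r powr a) * g r) + B * (cis (r * (- \<rho>) + t * r powr a) * g r) + E r * (?p r * g r)"
      unfolding c E_def by (simp add: algebra_simps)
  qed
  also have "\<dots> = A * osc_transform a t g \<rho> + B * osc_transform a t g (- \<rho>) + (LINT r|lborel. E r * (?p r * g r))"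
  proof -
    have i: "integrable lborel (\<lambda>r. A * (cis (r * \<rho> + t * r powr a) * g r))"
      "integrable lborel (\<lambda>r. B * (cis (r * (- \<rho>) + t * r powr a) * g r))"
      by (intro integrable_mult_right oi)+
    show ?thesis
      unfolding osc_transform_def integral_mult_right_zero[symmetric]
        Bochner_Integration.integral_add[OF Bochner_Integration.integrable_add[OF i] Ei]
        Bochner_Integration.integral_add[OF i] ..
  qed
  finally have eq: "(LINT r|lborel. ?V r * (?p r * g r)) =
    A * osc_transform a t g \<rho> + B * osc_transform a t g (- \<rho>) + (LINT r|lborel. E r * (?p r * g r))" .
  have "ennreal (cmod (LINT r|lborel. E r * (?p r * g r))) \<le> (\<integral>\<^sup>+ r. ennreal (cmod (E r * (?p r * g r))) \<partial>lborel)"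
    by (rule norm_integral_le_nn_integral)
  also have "\<dots> \<le> (\<integral>\<^sup>+ r. ennreal M * (ennreal (min 1 (1 / (r * \<rho>))) * ennreal (cmod (g r)) * indicator {0<..} r) \<partial>lborel)"
  proof (rule nn_integral_mono)
    fix r
    show "ennreal (cmod (E r * (?p r * g r))) \<le> ennreal M * (ennreal (min 1 (1 / (r * \<rho>))) * ennreal (cmod (g r)) * indicator {0<..} r)"
    proof (cases "r > 0")
      case True
      have "ennreal (cmod (E r * (?p r * g r))) \<le> ennreal (M * min 1 (1 / (r * \<rho>)) * cmod (g r))"
        by (rule ennreal_leI[OF Eb[OF True]])
      also have "\<dots> = ennreal M * (ennreal (min 1 (1 / (r * \<rho>))) * ennreal (cmod (g r)))"
        using M True \<rho> by (simp add: ennreal_mult mult.assoc)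
      finally show ?thesis using True by simp
    qed (simp add: g0)
  qed
  also have "\<dots> = ennreal M * (\<integral>\<^sup>+ r. ennreal (min 1 (1 / (r * \<rho>))) * ennreal (cmod (g r)) * indicator {0<..} r \<partial>lborel)" (is "_ = ennreal M * ?h")
    by (rule nn_integral_cmult) measurable
  finally have "(ennreal (cmod (LINT r|lborel. E r * (?p r * g r))))\<^sup>2 \<le> (ennreal M * ?h)\<^sup>2"
    by (rule power_mono) simp
  then have Eint: "ennreal ((cmod (LINT r|lborel. E r * (?p r * g r)))\<^sup>2) \<le> ennreal (M\<^sup>2) * ?h\<^sup>2"
    using M by (simp add: ennreal_power power_mult_distrib)
  have "ennreal ((cmod (LINT r|lborel. ?V r * (?p r * g r)))\<^sup>2) \<le>
    ennreal (3 * ((cmod (A * osc_transform a t g \<rho>))\<^sup>2 + (cmod (B * osc_transform a t g (- \<rho>)))\<^sup>2 + (cmod (LINT r|lborel. E r * (?p r * g r)))\<^sup>2))"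
    unfolding eq by (rule ennreal_leI[OF norm_sum3_square_le])
  also have "\<dots> = 3 * (ennreal ((cmod A)\<^sup>2) * ennreal ((cmod (osc_transform a t g \<rho>))\<^sup>2) +
           ennreal ((cmod B)\<^sup>2) * ennreal ((cmod (osc_transform a t g (- \<rho>)))\<^sup>2) + ennreal ((cmod (LINT r|lborel. E r * (?p r * g r)))\<^sup>2))"
    by (simp add: ennreal_mult norm_mult power_mult_distrib)
  also have "\<dots> \<le> 3 * (ennreal ((cmod A)\<^sup>2) * ennreal ((cmod (osc_transform a t g \<rho>))\<^sup>2) +
           ennreal ((cmod B)\<^sup>2) * ennreal ((cmod (osc_transform a t g (- \<rho>)))\<^sup>2) + ennreal (M\<^sup>2) * ?h\<^sup>2)"
    by (intro mult_left_mono add_mono Eint order_refl) auto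
  finally show ?thesis .
qed

text \<open>In polar coordinates the density \<open>\<omega> * \<rho> ^ (n - 1)\<close> on the left cancels the factor
\<open>\<rho> powr (- 2 * k)\<close> from the square of the solution, and on the right \<open>r ^ (n - 1)\<close> is absorbed into \<open>g\<close>.
What remains are the one-dimensional maximal estimate and the Hardy type bound. If the Sobolev
integral is infinite, the constant majorant \<open>top\<close> serves.\<close>

theorem radial_maximal_estimate:
  fixes a s :: real
  assumes a: "a > 0" "a \<noteq> 1" and n: "CARD('n::finite) \<ge> 2" and s: "s > a / 4"
  shows "\<exists>C>0. \<forall>F0 \<in> borel_measurable borel. integrable (lborel :: (real^'n) measure) (\<lambda>\<xi>. F0 (norm \<xi>)) \<longrightarrow>
    (\<exists>Z \<in> borel_measurable (borel :: (real^'n) measure).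
       (\<forall>x t. x \<noteq> 0 \<longrightarrow> \<bar>t\<bar> < 1 \<longrightarrow> ennreal ((cmod (LINT \<xi>|lborel. cis (x \<bullet> \<xi> + t * norm \<xi> powr a) * F0 (norm \<xi>)))\<^sup>2) \<le> Z x) \<and>
       (\<integral>\<^sup>+ x. Z x \<partial>lborel) \<le> ennreal C * (\<integral>\<^sup>+ \<xi>. ennreal ((1 + (norm (\<xi> :: real^'n))\<^sup>2) powr s * (cmod (F0 (norm \<xi>)))\<^sup>2) \<partial>lborel))"
proof -
  define k where "k = (real CARD('n) - 1) / 2"
  have k: "k > 0" using n by (simp add: k_def)
  have k2: "2 * k = real (CARD('n) - 1)" using n by (simp add: k_def of_nat_diff)
  have s0: "s > 0" using s a by simp
  define J0 where "J0 = sphere_transform k 0"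
  have J0: "J0 > 0" unfolding J0_def by (rule sphere_transform_0_pos[OF k])
  define \<omega> where "\<omega> = unit_ball_vol (real (CARD('n) - 1))"
  have \<omega>: "\<omega> > 0" by (simp add: \<omega>_def)
  obtain A B :: complex and M where M: "M > 0"
    and as: "\<And>s. s > 0 \<Longrightarrow> cmod (of_real (s powr k * sphere_transform k s) - (A * cis s + B * cis (- s))) \<le> M * min 1 (1 / s)"
    using sphere_transform_asymptotics[OF k] by blast
  obtain C1 where C1: "C1 > 0" and mx: "\<And>g. integrable lborel g \<Longrightarrow> (\<And>r. r < 0 \<Longrightarrow> g r = 0) \<Longrightarrow>
     (\<exists>W \<in> borel_measurable borel.
        (\<forall>\<rho> t. \<bar>t\<bar> < 1 \<longrightarrow> ennreal ((cmod (osc_transform a t g \<rho>))\<^sup>2) \<le> W \<rho>) \<and>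
        (\<integral>\<^sup>+ \<rho>. W \<rho> \<partial>lborel) \<le> ennreal C1 * sobolev_mass s g)"
    using maximal_oscillatory_bound[OF a s] by blast
  define D where "D = (cmod A)\<^sup>2 * C1 + (cmod B)\<^sup>2 * C1 + M\<^sup>2 * 16"
  have D: "D > 0" unfolding D_def using M C1 by (intro add_nonneg_pos add_nonneg_nonneg) auto
  define C where "C = 3 * \<omega>\<^sup>2 * D"
  have C: "C > 0" using D \<omega> by (simp add: C_def)
  have w: "radial_weight CARD('n) r = \<omega> * (r ^ (CARD('n) - 1) * indicator {0..} r)" for r
    by (simp add: radial_weight_def \<omega>_def)
  have rk: "r ^ (CARD('n) - 1) = r powr k * r powr k" if "r > 0" for r :: real
  proof -
    have "r ^ (CARD('n) - 1) = r powr (2 * k)" unfolding k2 using that by (rule powr_realpow[symmetric])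
    then show ?thesis by (simp flip: powr_add)
  qed
  have wr: "radial_weight CARD('n) r = \<omega> * (r powr k * r powr k)" if "r > 0" for r
    unfolding w rk[OF that] using that by simp
  have w0: "radial_weight CARD('n) r = 0" if "r \<le> 0" for r
  proof (cases "r = 0")
    case True
    then show ?thesis using n by (simp add: w)
  next
    case False
    then show ?thesis using that by (simp add: w)
  qed
  have main: "\<exists>Z \<in> borel_measurable (borel :: (real^'n) measure).
       (\<forall>x t. x \<noteq> 0 \<longrightarrow> \<bar>t\<bar> < 1 \<longrightarrow> ennreal ((cmod (LINT \<xi>|lborel. cis (x \<bullet> \<xi> + t * norm \<xi> powr a) * F0 (norm \<xi>)))\<^sup>2) \<le> Z x) \<and>
       (\<integral>\<^sup>+ x. Z x \<partial>lborel) \<le> ennreal C * (\<integral>\<^sup>+ \<xi>. ennreal ((1 + (norm (\<xi> :: real^'n))\<^sup>2) powr s * (cmod (F0 (norm \<xi>)))\<^sup>2) \<partial>lborel)"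
    if [measurable]: "F0 \<in> borel_measurable borel" and int: "integrable (lborel :: (real^'n) measure) (\<lambda>\<xi>. F0 (norm \<xi>))" for F0
  proof -
    define E where "E = (\<integral>\<^sup>+ \<xi>. ennreal ((1 + (norm (\<xi> :: real^'n))\<^sup>2) powr s * (cmod (F0 (norm \<xi>)))\<^sup>2) \<partial>lborel)"
    show ?thesis
    proof (cases "E = top")
      case True
      then show ?thesis using C unfolding E_def[symmetric]
        by (intro bexI[of _ "\<lambda>_. top"]) (auto simp: ennreal_mult_top)
    next
      case False
      define g where "g r = (if r > 0 then of_real (r powr k) * F0 r else 0)" for r
      have gm [measurable]: "g \<in> borel_measurable borel" unfolding g_def[abs_def] by measurable
      have g0: "g r = 0" if "r \<le> 0" for r using that by (simp add: g_def)
      have gn: "cmod (g r) = r powr k * cmod (F0 r)" if "r > 0" for r using that by (simp add: g_def norm_mult)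
      define G where "G = sobolev_mass s g"
      \<comment> \<open>The Sobolev norm of the radial function is a weighted norm of its profile.\<close>
      have EG: "E = ennreal (J0 * \<omega>) * G"
      proof -
        have "E = ennreal J0 * (\<integral>\<^sup>+ r. ennreal (radial_weight CARD('n) r) * ennreal ((1 + r\<^sup>2) powr s * (cmod (F0 r))\<^sup>2) \<partial>lborel)"
          unfolding E_def J0_def k_def
          by (rule nn_integral_polar[OF n, where \<phi> = "\<lambda>r. ennreal ((1 + r\<^sup>2) powr s * (cmod (F0 r))\<^sup>2)"]) measurable
        also have "(\<integral>\<^sup>+ r. ennreal (radial_weight CARD('n) r) * ennreal ((1 + r\<^sup>2) powr s * (cmod (F0 r))\<^sup>2) \<partial>lborel)
            = (\<integral>\<^sup>+ r. ennreal \<omega> * ennreal ((1 + r\<^sup>2) powr s * (cmod (g r))\<^sup>2) \<partial>lborel)"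
        proof (rule nn_integral_cong)
          fix r :: real
          show "ennreal (radial_weight CARD('n) r) * ennreal ((1 + r\<^sup>2) powr s * (cmod (F0 r))\<^sup>2) = ennreal \<omega> * ennreal ((1 + r\<^sup>2) powr s * (cmod (g r))\<^sup>2)"
          proof (cases "r > 0")
            case True
            have e: "radial_weight CARD('n) r * ((1 + r\<^sup>2) powr s * (cmod (F0 r))\<^sup>2) = \<omega> * ((1 + r\<^sup>2) powr s * (cmod (g r))\<^sup>2)"
              unfolding wr[OF True] gn[OF True] by (simp add: power2_eq_square)
            show ?thesis
              using e \<omega> radial_weight_nonneg[of "CARD('n)" r] by (simp flip: ennreal_mult)
          next
            case False
            then show ?thesis by (simp add: w0 g0)
          qed
        qed
        also have "\<dots> = ennreal \<omega> * G" unfolding G_def by (rule nn_integral_cmult) measurable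
        finally show ?thesis using J0 \<omega> by (simp add: ennreal_mult mult.assoc)
      qed
      have Gf: "G < top"
      proof (rule ccontr)
        assume "\<not> G < top"
        then have "G = top" using top.not_eq_extremum by blast
        then have "E = top" using J0 \<omega> by (simp add: EG ennreal_mult_top)
        then show False using False by simp
      qed
      have l1: "(\<integral>\<^sup>+ r. ennreal (r ^ (CARD('n) - 1) * indicator {0..} r) * ennreal (cmod (F0 r)) \<partial>lborel) < top"
      proof -
        let ?I = "\<integral>\<^sup>+ r. ennreal (r ^ (CARD('n) - 1) * indicator {0..} r) * ennreal (cmod (F0 r)) \<partial>lborel"
        have "(\<integral>\<^sup>+ \<xi>. ennreal (cmod (F0 (norm \<xi>))) \<partial>(lborel :: (real^'n) measure)) =
           ennreal J0 * (\<integral>\<^sup>+ r. ennreal (radial_weight CARD('n) r) * ennreal (cmod (F0 r)) \<partial>lborel)"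
          unfolding J0_def k_def by (rule nn_integral_polar[OF n, where \<phi> = "\<lambda>r. ennreal (cmod (F0 r))"]) measurable
        also have "(\<integral>\<^sup>+ r. ennreal (radial_weight CARD('n) r) * ennreal (cmod (F0 r)) \<partial>lborel) = (\<integral>\<^sup>+ r. ennreal \<omega> * (ennreal (r ^ (CARD('n) - 1) * indicator {0..} r) * ennreal (cmod (F0 r))) \<partial>lborel)"
          using \<omega> by (intro nn_integral_cong) (simp add: w ennreal_mult' mult.assoc)
        also have "\<dots> = ennreal \<omega> * ?I" by (rule nn_integral_cmult) measurable
        finally have "ennreal J0 * (ennreal \<omega> * ?I) < top" using int by (simp add: integrable_iff_bounded)
        then show ?thesis using J0 \<omega> by (auto simp: ennreal_mult_less_top)
      qed
      have gi: "integrable lborel g"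
        by (rule radial_profile_integrable[OF gm that(1) gn g0 k k2 s0 _ l1]) (use Gf in \<open>simp_all add: G_def\<close>)
      obtain W where W [measurable]: "W \<in> borel_measurable borel"
        and Wb: "\<And>\<rho> t. \<bar>t\<bar> < 1 \<Longrightarrow> ennreal ((cmod (osc_transform a t g \<rho>))\<^sup>2) \<le> W \<rho>"
        and Wi: "(\<integral>\<^sup>+ \<rho>. W \<rho> \<partial>lborel) \<le> ennreal C1 * G"
        using mx[OF gi g0] unfolding G_def by auto
      define h where "h \<rho> = (\<integral>\<^sup>+ r. ennreal (min 1 (1 / (r * \<rho>))) * ennreal (cmod (g r)) * indicator {0<..} r \<partial>lborel)" for \<rho>
      have [measurable]: "h \<in> borel_measurable borel" unfolding h_def[abs_def] by measurable
      define X where "X \<rho> = ennreal ((cmod A)\<^sup>2) * W \<rho> + ennreal ((cmod B)\<^sup>2) * W (- \<rho>) + ennreal (M\<^sup>2) * (h \<rho>)\<^sup>2" for \<rho>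
      have [measurable]: "X \<in> borel_measurable borel" unfolding X_def[abs_def] by measurable
      define Y where "Y \<rho> = ennreal ((\<omega> * \<rho> powr (- k))\<^sup>2) * (3 * X \<rho>)" for \<rho>
      have [measurable]: "Y \<in> borel_measurable borel" unfolding Y_def[abs_def] by measurable
      have pt: "ennreal ((cmod (LINT \<xi>|lborel. cis (x \<bullet> \<xi> + t * norm \<xi> powr a) * F0 (norm \<xi>)))\<^sup>2) \<le> Y (norm x)"
        if x: "x \<noteq> 0" and t: "\<bar>t\<bar> < 1" for x :: "real^'n" and t
      proof -
        define \<rho> where "\<rho> = norm x"
        have \<rho>: "\<rho> > 0" using x by (simp add: \<rho>_def)
        define Ft where "Ft r = cis (t * r powr a) * F0 r" for r
        have [measurable]: "Ft \<in> borel_measurable borel" unfolding Ft_def[abs_def] by measurable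
        have Fti: "integrable (lborel :: (real^'n) measure) (\<lambda>\<xi>. Ft (norm \<xi>))"
          by (rule Bochner_Integration.integrable_bound[OF int]) (auto simp: Ft_def norm_mult)
        have "(LINT \<xi>|lborel. cis (x \<bullet> \<xi> + t * norm \<xi> powr a) * F0 (norm \<xi>)) = (LINT \<xi>|lborel. cis (x \<bullet> \<xi>) * Ft (norm \<xi>))"
          by (intro Bochner_Integration.integral_cong) (auto simp: Ft_def cis_mult simp flip: mult.assoc)
        also have "\<dots> = (LINT r|lborel. of_real (radial_weight CARD('n) r * sphere_transform k (\<rho> * r)) * Ft r)"
          unfolding k_def \<rho>_def by (rule fourier_polar[OF n _ Fti]) measurable
        also have "\<dots> = (LINT r|lborel. of_real (\<omega> * \<rho> powr (- k)) * (of_real ((r * \<rho>) powr k * sphere_transform k (r * \<rho>)) * (cis (t * r powr a) * g r)))"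
        proof (rule Bochner_Integration.integral_cong[OF refl])
          fix r
          show "of_real (radial_weight CARD('n) r * sphere_transform k (\<rho> * r)) * Ft r =
            of_real (\<omega> * \<rho> powr (- k)) * (of_real ((r * \<rho>) powr k * sphere_transform k (r * \<rho>)) * (cis (t * r powr a) * g r))"
          proof (cases "r > 0")
            case True
            have one: "\<rho> powr (- k) * \<rho> powr k = 1" using \<rho> by (simp flip: powr_add)
            have "radial_weight CARD('n) r = \<omega> * (r powr k * r powr k) * (\<rho> powr (- k) * \<rho> powr k)"
              unfolding one wr[OF True] by simp
            also have "\<dots> = (\<omega> * \<rho> powr (- k)) * (r * \<rho>) powr k * r powr k"
              using True \<rho> by (simp add: powr_mult mult_ac)
            finally have e: "radial_weight CARD('n) r = (\<omega> * \<rho> powr (- k)) * (r * \<rho>) powr k * r powr k" .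
            have gr: "g r = of_real (r powr k) * F0 r" using True by (simp add: g_def)
            show ?thesis unfolding e Ft_def gr of_real_mult mult.commute[of \<rho> r] by (simp only: mult_ac)
          next
            case False
            then show ?thesis by (simp add: w0 g0)
          qed
        qed
        also have "\<dots> = of_real (\<omega> * \<rho> powr (- k)) * (LINT r|lborel. of_real ((r * \<rho>) powr k * sphere_transform k (r * \<rho>)) * (cis (t * r powr a) * g r))" (is "_ = _ * ?L")
          by (rule integral_mult_right_zero)
        finally have eq: "(LINT \<xi>|lborel. cis (x \<bullet> \<xi> + t * norm \<xi> powr a) * F0 (norm \<xi>)) = of_real (\<omega> * \<rho> powr (- k)) * ?L" .
        have "ennreal ((cmod (LINT \<xi>|lborel. cis (x \<bullet> \<xi> + t * norm \<xi> powr a) * F0 (norm \<xi>)))\<^sup>2) =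
            ennreal ((\<omega> * \<rho> powr (- k))\<^sup>2) * ennreal ((cmod ?L)\<^sup>2)"
          unfolding eq norm_mult norm_of_real power_mult_distrib power2_abs by (rule ennreal_mult) auto
        also have "ennreal ((cmod ?L)\<^sup>2) \<le> 3 * (ennreal ((cmod A)\<^sup>2) * ennreal ((cmod (osc_transform a t g \<rho>))\<^sup>2) +
             ennreal ((cmod B)\<^sup>2) * ennreal ((cmod (osc_transform a t g (- \<rho>)))\<^sup>2) + ennreal (M\<^sup>2) * (h \<rho>)\<^sup>2)"
          unfolding h_def by (rule sphere_transform_split[OF k gi g0 as M \<rho>])
        also have "\<dots> \<le> 3 * X \<rho>"
          unfolding X_def by (intro mult_left_mono add_mono Wb t order_refl) auto
        finally show ?thesis unfolding Y_def \<rho>_def by (simp add: mult_left_mono)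
      qed
      \<comment> \<open>\<open>W (- \<rho>)\<close> costs no more than \<open>W \<rho>\<close>, as the maximal estimate holds on the whole line.\<close>
      have XI: "(\<integral>\<^sup>+ \<rho>. X \<rho> * indicator {0<..} \<rho> \<partial>lborel) \<le> ennreal D * G"
      proof -
        have "(\<integral>\<^sup>+ \<rho>. X \<rho> * indicator {0<..} \<rho> \<partial>lborel) \<le>
          (\<integral>\<^sup>+ \<rho>. ennreal ((cmod A)\<^sup>2) * W \<rho> + ennreal ((cmod B)\<^sup>2) * W (- \<rho>) + ennreal (M\<^sup>2) * ((h \<rho>)\<^sup>2 * indicator {0<..} \<rho>) \<partial>lborel)"
          by (intro nn_integral_mono) (auto simp: X_def indicator_def)
        also have "\<dots> = ennreal ((cmod A)\<^sup>2) * (\<integral>\<^sup>+ \<rho>. W \<rho> \<partial>lborel) + ennreal ((cmod B)\<^sup>2) * (\<integral>\<^sup>+ \<rho>. W (- \<rho>) \<partial>lborel)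
            + ennreal (M\<^sup>2) * (\<integral>\<^sup>+ \<rho>. (h \<rho>)\<^sup>2 * indicator {0<..} \<rho> \<partial>lborel)"
          by (simp add: nn_integral_add nn_integral_cmult)
        also have "(\<integral>\<^sup>+ \<rho>. W (- \<rho>) \<partial>lborel) = (\<integral>\<^sup>+ \<rho>. W \<rho> \<partial>lborel)"
          using nn_integral_real_affine[of W "-1" 0] by simp
        also have "ennreal ((cmod A)\<^sup>2) * (\<integral>\<^sup>+ \<rho>. W \<rho> \<partial>lborel) + ennreal ((cmod B)\<^sup>2) * (\<integral>\<^sup>+ \<rho>. W \<rho> \<partial>lborel)
            + ennreal (M\<^sup>2) * (\<integral>\<^sup>+ \<rho>. (h \<rho>)\<^sup>2 * indicator {0<..} \<rho> \<partial>lborel)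
          \<le> ennreal ((cmod A)\<^sup>2) * (ennreal C1 * G) + ennreal ((cmod B)\<^sup>2) * (ennreal C1 * G) + ennreal (M\<^sup>2) * (16 * G)"
        proof (intro add_mono mult_left_mono Wi)
          have "(\<integral>\<^sup>+ \<rho>. (h \<rho>)\<^sup>2 * indicator {0<..} \<rho> \<partial>lborel) \<le> 16 * (\<integral>\<^sup>+ r. (ennreal (cmod (g r)))\<^sup>2 * indicator {0<..} r \<partial>lborel)"
            unfolding h_def by (rule hardy_kernel_bound) measurable
          also have "\<dots> \<le> 16 * G"
            unfolding G_def
          proof (intro mult_left_mono nn_integral_mono)
            fix r :: real
            have "1 \<le> (1 + r\<^sup>2) powr s" using s0 by (intro ge_one_powr_ge_zero) auto
            then have "1 * (cmod (g r))\<^sup>2 \<le> (1 + r\<^sup>2) powr s * (cmod (g r))\<^sup>2" by (intro mult_right_mono) auto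
            then show "(ennreal (cmod (g r)))\<^sup>2 * indicator {0<..} r \<le> ennreal ((1 + r\<^sup>2) powr s * (cmod (g r))\<^sup>2)"
              by (auto simp: indicator_def ennreal_power intro: ennreal_leI)
          qed simp
          finally show "(\<integral>\<^sup>+ \<rho>. (h \<rho>)\<^sup>2 * indicator {0<..} \<rho> \<partial>lborel) \<le> 16 * G" .
        qed auto
        also have "\<dots> = ennreal D * G"
          unfolding D_def using C1 by (simp add: ennreal_mult distrib_right mult.assoc)
        finally show ?thesis .
      qed
      have "(\<integral>\<^sup>+ x. Y (norm x) \<partial>(lborel :: (real^'n) measure)) = ennreal J0 * (\<integral>\<^sup>+ r. ennreal (radial_weight CARD('n) r) * Y r \<partial>lborel)"
        unfolding J0_def k_def by (rule nn_integral_polar[OF n]) measurable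
      also have "(\<integral>\<^sup>+ r. ennreal (radial_weight CARD('n) r) * Y r \<partial>lborel) = (\<integral>\<^sup>+ r. (ennreal (\<omega> ^ 3) * 3) * (X r * indicator {0<..} r) \<partial>lborel)"
      proof (rule nn_integral_cong)
        fix r :: real
        show "ennreal (radial_weight CARD('n) r) * Y r = (ennreal (\<omega> ^ 3) * 3) * (X r * indicator {0<..} r)"
        proof (cases "r > 0")
          case True
          have one: "r powr (- k) * r powr k = 1" using True by (simp flip: powr_add)
          have "radial_weight CARD('n) r * (\<omega> * r powr (- k))\<^sup>2 = \<omega> ^ 3 * ((r powr (- k) * r powr k) * (r powr (- k) * r powr k))"
            unfolding wr[OF True] by (simp add: power2_eq_square power3_eq_cube)
          then have e: "radial_weight CARD('n) r * (\<omega> * r powr (- k))\<^sup>2 = \<omega> ^ 3" by (simp only: one mult_1_right)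
          have "ennreal (radial_weight CARD('n) r) * Y r = ennreal (radial_weight CARD('n) r * (\<omega> * r powr (- k))\<^sup>2) * (3 * X r)"
            unfolding Y_def using radial_weight_nonneg[of "CARD('n)" r] by (simp add: ennreal_mult mult.assoc)
          then show ?thesis unfolding e using True by (simp add: mult.assoc)
        next
          case False
          then show ?thesis by (simp add: w0)
        qed
      qed
      also have "\<dots> = (ennreal (\<omega> ^ 3) * 3) * (\<integral>\<^sup>+ r. X r * indicator {0<..} r \<partial>lborel)"
        by (rule nn_integral_cmult) measurable
      also have "ennreal J0 * \<dots> \<le> ennreal J0 * ((ennreal (\<omega> ^ 3) * 3) * (ennreal D * G))"
        by (intro mult_left_mono XI) auto
      also have "\<dots> = ennreal C * E"
      proof -
        have CJ: "C * (J0 * \<omega>) = J0 * ((\<omega> ^ 3 * 3) * D)" by (simp add: C_def power2_eq_square power3_eq_cube)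
        have "ennreal C * ennreal (J0 * \<omega>) = ennreal (J0 * ((\<omega> ^ 3 * 3) * D))"
          unfolding CJ[symmetric] by (rule ennreal_mult[symmetric]) (use C J0 \<omega> in auto)
        also have "\<dots> = ennreal J0 * ((ennreal (\<omega> ^ 3) * 3) * ennreal D)"
          using J0 \<omega> D by (simp add: ennreal_mult)
        finally show ?thesis unfolding EG by (simp add: mult.assoc[symmetric])
      qed
      finally have "(\<integral>\<^sup>+ x. Y (norm x) \<partial>(lborel :: (real^'n) measure)) \<le> ennreal C * E" .
      moreover have "(\<lambda>x :: real^'n. Y (norm x)) \<in> borel_measurable borel" by measurable
      ultimately show ?thesis
        unfolding E_def[symmetric] by (intro bexI[of _ "\<lambda>x. Y (norm x)"] conjI allI impI pt)
    qed
  qed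
  show ?thesis using C main by blast
qed

lemma ennreal_sqrt_le_mult:
  assumes K: "K > 0" and le: "y \<le> ennreal (K\<^sup>2) * z"
  shows "ennreal_sqrt y \<le> ennreal K * ennreal_sqrt z"
proof (cases "z = top")
  case True
  then show ?thesis using K by (simp add: ennreal_sqrt_def ennreal_mult_top)
next
  case False
  then obtain z' where z': "z = ennreal z'" "z' \<ge> 0" by (cases z) auto
  have le': "y \<le> ennreal (K\<^sup>2 * z')" using le z' by (simp add: ennreal_mult)
  then obtain y' where y': "y = ennreal y'" "y' \<ge> 0" by (cases y) (auto simp: top_unique)
  have "y' \<le> K\<^sup>2 * z'" using le' y' z' by (simp add: ennreal_le_iff)
  then have "sqrt y' \<le> sqrt (K\<^sup>2 * z')" by simp
  also have "\<dots> = K * sqrt z'" using K by (simp add: real_sqrt_mult)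
  finally have "ennreal (sqrt y') \<le> ennreal K * ennreal (sqrt z')"
    using K z' by (simp add: ennreal_leI flip: ennreal_mult)
  then show ?thesis using y' z' by (simp add: ennreal_sqrt_def)
qed

theorem theoremA:
  fixes a s :: real
  assumes "a > 0" and "a \<noteq> 1" and "CARD('n::finite) \<ge> 2" and "s > a / 4"
  shows "\<exists>C :: real. \<forall>f :: real^'n \<Rightarrow> complex.
    f \<in> test_functions (UNIV - {0}) \<and> radial f \<longrightarrow>
    ennreal_sqrt (\<integral>\<^sup>+ x. (SUP t \<in> {t :: real. \<bar>t\<bar> < 1}. ennreal ((cmod (S_op a f x t))\<^sup>2)) \<partial>lborel)
      \<le> ennreal C * sobolev_norm s f"
proof -
  obtain C where C: "C > 0" and est: "\<And>F0. F0 \<in> borel_measurable borel \<Longrightarrow> integrable (lborel :: (real^'n) measure) (\<lambda>\<xi>. F0 (norm \<xi>)) \<Longrightarrow>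
    (\<exists>Z \<in> borel_measurable (borel :: (real^'n) measure).
       (\<forall>x t. x \<noteq> 0 \<longrightarrow> \<bar>t\<bar> < 1 \<longrightarrow> ennreal ((cmod (LINT \<xi>|lborel. cis (x \<bullet> \<xi> + t * norm \<xi> powr a) * F0 (norm \<xi>)))\<^sup>2) \<le> Z x) \<and>
       (\<integral>\<^sup>+ x. Z x \<partial>lborel) \<le> ennreal C * (\<integral>\<^sup>+ \<xi>. ennreal ((1 + (norm (\<xi> :: real^'n))\<^sup>2) powr s * (cmod (F0 (norm \<xi>)))\<^sup>2) \<partial>lborel))"
    using radial_maximal_estimate[where 'n = 'n, OF assms] by blast
  define c where "c = 1 / (2 * pi) ^ CARD('n)"
  have c: "c > 0" by (simp add: c_def)
  define K where "K = c * sqrt C"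
  have K: "K > 0" using c C by (simp add: K_def)
  have K2: "K\<^sup>2 = c\<^sup>2 * C" using C by (simp add: K_def power_mult_distrib)
  have main: "ennreal_sqrt (\<integral>\<^sup>+ x. (SUP t \<in> {t :: real. \<bar>t\<bar> < 1}. ennreal ((cmod (S_op a f x t))\<^sup>2)) \<partial>lborel)
      \<le> ennreal K * sobolev_norm s f"
    if f: "f \<in> test_functions (UNIV - {0})" and rad: "radial f" for f :: "real^'n \<Rightarrow> complex"
  proof -
    have "times_cont_diff 0 f" using f unfolding test_functions_def smooth_def by blast
    then have fm: "f \<in> borel_measurable borel" by (intro borel_measurable_continuous_onI) simp
    define F where "F = fourier f"
    have S: "S_op a f x t = of_real c * (LINT \<xi>|lborel. cis (x \<bullet> \<xi> + t * norm \<xi> powr a) * F \<xi>)" for x t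
      by (simp add: S_op_def c_def F_def cis_conv_exp)
    have "(\<integral>\<^sup>+ x. (SUP t \<in> {t :: real. \<bar>t\<bar> < 1}. ennreal ((cmod (S_op a f x t))\<^sup>2)) \<partial>lborel)
       \<le> ennreal (K\<^sup>2) * (\<integral>\<^sup>+ \<xi>. ennreal ((1 + (norm \<xi>)\<^sup>2) powr s * (cmod (F \<xi>))\<^sup>2) \<partial>lborel)"
    \<comment> \<open>If the Fourier transform is not integrable, then neither is its product with a phase, and
      the Bochner integral that defines the solution is 0 by convention.\<close>
    proof (cases "integrable lborel F")
      case False
      have z: "S_op a f x t = 0" for x t
      proof -
        have "\<not> integrable lborel (\<lambda>\<xi>. cis (x \<bullet> \<xi> + t * norm \<xi> powr a) * F \<xi>)"
        proof
          assume i: "integrable lborel (\<lambda>\<xi>. cis (x \<bullet> \<xi> + t * norm \<xi> powr a) * F \<xi>)"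
          note [measurable] = borel_measurable_integrable[OF i]
          have "integrable lborel (\<lambda>\<xi>. cis (- (x \<bullet> \<xi> + t * norm \<xi> powr a)) * (cis (x \<bullet> \<xi> + t * norm \<xi> powr a) * F \<xi>))"
            by (rule Bochner_Integration.integrable_bound[OF i]) (auto simp: norm_mult)
          then have "integrable lborel F" by (simp add: cis_mult flip: mult.assoc)
          then show False using False by simp
        qed
        then show ?thesis by (simp add: S not_integrable_integral_eq)
      qed
      have "(SUP t \<in> {t :: real. \<bar>t\<bar> < 1}. ennreal ((cmod (S_op a f x t))\<^sup>2)) = 0" for x
        by (rule antisym, rule SUP_least) (auto simp: z)
      then show ?thesis by simp
    next
      case True
      obtain j :: 'n where "True" by simp
      define F0 where "F0 r = F (r *\<^sub>R axis j 1)" for r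
      have FF: "F \<xi> = F0 (norm \<xi>)" for \<xi>
        unfolding F_def F0_def by (rule fourier_cong_norm[OF fm rad]) (simp add: norm_axis_1)
      note [measurable] = borel_measurable_integrable[OF True]
      have F0m: "F0 \<in> borel_measurable borel" unfolding F0_def[abs_def] by measurable
      obtain Z where Z [measurable]: "Z \<in> borel_measurable (borel :: (real^'n) measure)"
        and Zb: "\<And>x t. x \<noteq> 0 \<Longrightarrow> \<bar>t\<bar> < 1 \<Longrightarrow> ennreal ((cmod (LINT \<xi>|lborel. cis (x \<bullet> \<xi> + t * norm \<xi> powr a) * F \<xi>))\<^sup>2) \<le> Z x"
        and Zi: "(\<integral>\<^sup>+ x. Z x \<partial>lborel) \<le> ennreal C * (\<integral>\<^sup>+ \<xi>. ennreal ((1 + (norm \<xi>)\<^sup>2) powr s * (cmod (F \<xi>))\<^sup>2) \<partial>lborel)"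
        using est[OF F0m] True unfolding FF by blast
      have "(\<integral>\<^sup>+ x. (SUP t \<in> {t :: real. \<bar>t\<bar> < 1}. ennreal ((cmod (S_op a f x t))\<^sup>2)) \<partial>lborel) \<le> (\<integral>\<^sup>+ x. ennreal (c\<^sup>2) * Z x \<partial>lborel)"
      proof (rule nn_integral_mono_AE)
        show "AE x in lborel. (SUP t \<in> {t :: real. \<bar>t\<bar> < 1}. ennreal ((cmod (S_op a f x t))\<^sup>2)) \<le> ennreal (c\<^sup>2) * Z x"
          using AE_lborel_singleton[of "0 :: real^'n"]
        proof eventually_elim
          case (elim x)
          show ?case
          proof (rule SUP_least)
            fix t assume "t \<in> {t :: real. \<bar>t\<bar> < 1}"
            then have t: "\<bar>t\<bar> < 1" by simp
            have "ennreal ((cmod (S_op a f x t))\<^sup>2) = ennreal (c\<^sup>2) * ennreal ((cmod (LINT \<xi>|lborel. cis (x \<bullet> \<xi> + t * norm \<xi> powr a) * F \<xi>))\<^sup>2)"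
              unfolding S norm_mult norm_of_real power_mult_distrib power2_abs by (rule ennreal_mult) auto
            also have "\<dots> \<le> ennreal (c\<^sup>2) * Z x" by (intro mult_left_mono Zb elim t) simp
            finally show "ennreal ((cmod (S_op a f x t))\<^sup>2) \<le> ennreal (c\<^sup>2) * Z x" .
          qed
        qed
      qed
      also have "\<dots> = ennreal (c\<^sup>2) * (\<integral>\<^sup>+ x. Z x \<partial>lborel)" by (rule nn_integral_cmult) measurable
      also have "\<dots> \<le> ennreal (c\<^sup>2) * (ennreal C * (\<integral>\<^sup>+ \<xi>. ennreal ((1 + (norm \<xi>)\<^sup>2) powr s * (cmod (F \<xi>))\<^sup>2) \<partial>lborel))"
        by (intro mult_left_mono Zi) simp
      also have "\<dots> = ennreal (K\<^sup>2) * (\<integral>\<^sup>+ \<xi>. ennreal ((1 + (norm \<xi>)\<^sup>2) powr s * (cmod (F \<xi>))\<^sup>2) \<partial>lborel)"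
        unfolding K2 using C by (simp add: ennreal_mult mult.assoc)
      finally show ?thesis .
    qed
    then show ?thesis unfolding sobolev_norm_def F_def by (rule ennreal_sqrt_le_mult[OF K])
  qed
  then show ?thesis by blast
qed

end
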